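(* Let $H$ be a multigraph (loops allowed, no multiple edges) such that $|N_H(h)\cap N_H(h')|\le 1$ for all distinct vertices $h,h'$ of $H$. Let $t\ge 4$. Then for every $P_t$-free graph $G$ on $n$ vertices, with any lists $L$ and any weights $w_{v,h}$, the polynomial $p_{(G,L)\to H}(x)$ can be calculated in time $2^{O\left(\sqrt{tn\log(n)}\right)}$.
   Context: $G$ is a finite simple graph; $P_t$ is the path on $t$ vertices and $G$ is $P_t$-free if it has no induced subgraph isomorphic to $P_t$. For a multigraph $H$, $N_H(h)=\{h' : hh'\in E(H)\}$, which contains $h$ iff $H$ has a loop at $h$. A graph homomorphism from $G$ to $H$ is a map $f:V(G)\to V(H)$ with $f(v)f(v')\in E(H)$ whenever $vv'\in E(G)$. A list $H$-colouring instance $(G,L)$ consists of $G$ and an assignment of a subset $L_v\subseteq V(H)$ to each $v\in V(G)$; a list $H$-colouring of it is a homomorphism $f$ from $G$ to $H$ with $f(v)\in L_v$ for all $v$; let $\mathcal{LC}((G,L),H)$ be the set of these. Given weights $w_{v,h}$ ($v\in V(G)$, $h\in V(H)$) and variables $x_h$ ($h\in V(H)$), the partition function is $p_{(G,L)\to H}(x)=\sum_{f\in\mathcal{LC}((G,L),H)}\prod_{u\in V(G)} w_{u,f(u)}x_{f(u)}$ (written $p_{G\to H}(x)$ when lists are clear; with all lists equal to $V(H)$ it is a sum over all homomorphisms). $H$ is fixed, so constants may depend on $H$. *)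

theory Defs
  imports Complex_Main "HOL-Library.FuncSet" "HOL-Library.Poly_Mapping"
begin

section \<open>Graphs\<close>

text \<open>A graph is a pair of a vertex set \<open>V\<close> and a set \<open>E\<close> of unordered pairs \<open>{u, v}\<close>; a loop
  at \<open>u\<close> is the edge \<open>{u, u} = {u}\<close>. Multiple edges cannot occur since \<open>E\<close> is a set.\<close>

definition loop_graph :: "'a set \<Rightarrow> 'a set set \<Rightarrow> bool" where
  "loop_graph V E \<longleftrightarrow> finite V \<and> E \<subseteq> {{u, v} |u v. u \<in> V \<and> v \<in> V}"

definition simple_graph :: "'a set \<Rightarrow> 'a set set \<Rightarrow> bool" where
  "simple_graph V E \<longleftrightarrow> finite V \<and> E \<subseteq> {{u, v} |u v. u \<in> V \<and> v \<in> V \<and> u \<noteq> v}"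

definition nbhd :: "'a set set \<Rightarrow> 'a \<Rightarrow> 'a set" where
  "nbhd E h = {h'. {h, h'} \<in> E}"

definition induced_edges :: "'a set set \<Rightarrow> 'a set \<Rightarrow> 'a set set" where
  "induced_edges E W = {e \<in> E. e \<subseteq> W}"

definition graph_iso :: "'a set \<Rightarrow> 'a set set \<Rightarrow> 'b set \<Rightarrow> 'b set set \<Rightarrow> bool" where
  "graph_iso V E V' E' \<longleftrightarrow> (\<exists>\<phi>. bij_betw \<phi> V V' \<and> E' = (\<lambda>e. \<phi> ` e) ` E)"

definition path_edges :: "nat \<Rightarrow> nat set set" where
  "path_edges t = {{i, Suc i} |i. Suc i < t}"

definition path_free :: "nat \<Rightarrow> 'a set \<Rightarrow> 'a set set \<Rightarrow> bool" where
  "path_free t V E \<longleftrightarrow>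
    \<not> (\<exists>W \<subseteq> V. graph_iso W (induced_edges E W) {..<t} (path_edges t))"

section \<open>List colourings and the partition function\<close>

text \<open>Maps \<open>V(G) \<rightarrow> V(H)\<close> are the extensional ones, so that each homomorphism is counted once.\<close>

definition graph_homs :: "'v set \<Rightarrow> 'v set set \<Rightarrow> 'h set \<Rightarrow> 'h set set \<Rightarrow> ('v \<Rightarrow> 'h) set" where
  "graph_homs VG EG VH EH =
    {f \<in> VG \<rightarrow>\<^sub>E VH. \<forall>u v. {u, v} \<in> EG \<longrightarrow> {f u, f v} \<in> EH}"

definition list_colourings ::
  "'v set \<Rightarrow> 'v set set \<Rightarrow> ('v \<Rightarrow> 'h set) \<Rightarrow> 'h set \<Rightarrow> 'h set set \<Rightarrow> ('v \<Rightarrow> 'h) set" where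
  "list_colourings VG EG L VH EH = {f \<in> graph_homs VG EG VH EH. \<forall>v \<in> VG. f v \<in> L v}"

text \<open>A polynomial in variables indexed by \<open>'h\<close> is a finitely supported map from monomials
  (finitely supported exponent vectors) to coefficients, with the convolution product.\<close>

type_synonym ('h, 'r) mpoly = "('h \<Rightarrow>\<^sub>0 nat) \<Rightarrow>\<^sub>0 'r"

definition mpoly_const :: "'r::comm_ring_1 \<Rightarrow> ('h, 'r) mpoly" where
  "mpoly_const c = Poly_Mapping.single 0 c"

definition mpoly_var :: "'h \<Rightarrow> ('h, 'r::comm_ring_1) mpoly" where
  "mpoly_var h = Poly_Mapping.single (Poly_Mapping.single h 1) 1"

definition partition_function ::
  "'v set \<Rightarrow> 'v set set \<Rightarrow> ('v \<Rightarrow> 'h set) \<Rightarrow> 'h set \<Rightarrow> 'h set set \<Rightarrow>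
   ('v \<Rightarrow> 'h \<Rightarrow> 'r::comm_ring_1) \<Rightarrow> ('h, 'r) mpoly" where
  "partition_function VG EG L VH EH w =
    (\<Sum>f \<in> list_colourings VG EG L VH EH.
      \<Prod>u \<in> VG. mpoly_const (w u (f u)) * mpoly_var (f u))"

section \<open>Model of computation\<close>

text \<open>Running time is measured in a first-order call-by-value functional language over cons cells
  (pure LISP), in the unit-cost model: every evaluated expression node costs one step. Each step is
  a constant amount of pointer work, one addition or truncated subtraction of naturals, or one ring
  operation. There is no multiplication of naturals, so a computation of \<open>c\<close> steps only handles
  naturals of at most \<open>O(c)\<close> bits beyond the input size. Ring elements (weights and coefficients)
  are opaque: they can be copied, added and multiplied, but not tested.

  A program is a list of function bodies; a function has one argument, and \<open>Var i\<close> is the de Bruijn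
  index into the environment. Ill-typed operations have no evaluation. Variable indices and literals
  are part of the program, hence constants.\<close>

datatype 'r val = VNat nat | VRing 'r | VNil | VCons "'r val" "'r val"

datatype expr =
    Var nat
  | LetIn expr expr
  | Call nat expr
  | NilC
  | Pair expr expr
  | Head expr
  | Tail expr
  | IfNil expr expr expr
  | NatC nat
  | Plus expr expr
  | Minus expr expr
  | IfZero expr expr expr
  | RZero
  | ROne
  | RPlus expr expr
  | RTimes expr expr

type_synonym prog = "expr list"

text \<open>\<open>eval P env e v c\<close>: in environment \<open>env\<close> the expression \<open>e\<close> evaluates to \<open>v\<close> in \<open>c\<close> steps.\<close>

inductive eval :: "prog \<Rightarrow> 'r::comm_ring_1 val list \<Rightarrow> expr \<Rightarrow> 'r val \<Rightarrow> nat \<Rightarrow> bool"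
  for P :: prog where
  Var: "i < length env \<Longrightarrow> eval P env (Var i) (env ! i) 1"
| LetIn: "eval P env a v c \<Longrightarrow> eval P (v # env) b v' c' \<Longrightarrow> eval P env (LetIn a b) v' (c + c' + 1)"
| Call: "eval P env a v c \<Longrightarrow> k < length P \<Longrightarrow> eval P [v] (P ! k) v' c' \<Longrightarrow>
    eval P env (Call k a) v' (c + c' + 1)"
| NilC: "eval P env NilC VNil 1"
| Pair: "eval P env a v c \<Longrightarrow> eval P env b v' c' \<Longrightarrow>
    eval P env (Pair a b) (VCons v v') (c + c' + 1)"
| Head: "eval P env a (VCons v v') c \<Longrightarrow> eval P env (Head a) v (c + 1)"
| Tail: "eval P env a (VCons v v') c \<Longrightarrow> eval P env (Tail a) v' (c + 1)"
| IfNil_Nil: "eval P env a VNil c \<Longrightarrow> eval P env b v c' \<Longrightarrow>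
    eval P env (IfNil a b d) v (c + c' + 1)"
| IfNil_Cons: "eval P env a (VCons u u') c \<Longrightarrow> eval P env d v c' \<Longrightarrow>
    eval P env (IfNil a b d) v (c + c' + 1)"
| NatC: "eval P env (NatC n) (VNat n) 1"
| Plus: "eval P env a (VNat m) c \<Longrightarrow> eval P env b (VNat n) c' \<Longrightarrow>
    eval P env (Plus a b) (VNat (m + n)) (c + c' + 1)"
| Minus: "eval P env a (VNat m) c \<Longrightarrow> eval P env b (VNat n) c' \<Longrightarrow>
    eval P env (Minus a b) (VNat (m - n)) (c + c' + 1)"
| IfZero_0: "eval P env a (VNat 0) c \<Longrightarrow> eval P env b v c' \<Longrightarrow>
    eval P env (IfZero a b d) v (c + c' + 1)"
| IfZero_Suc: "eval P env a (VNat (Suc n)) c \<Longrightarrow> eval P env d v c' \<Longrightarrow>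
    eval P env (IfZero a b d) v (c + c' + 1)"
| RZero: "eval P env RZero (VRing 0) 1"
| ROne: "eval P env ROne (VRing 1) 1"
| RPlus: "eval P env a (VRing r) c \<Longrightarrow> eval P env b (VRing s) c' \<Longrightarrow>
    eval P env (RPlus a b) (VRing (r + s)) (c + c' + 1)"
| RTimes: "eval P env a (VRing r) c \<Longrightarrow> eval P env b (VRing s) c' \<Longrightarrow>
    eval P env (RTimes a b) (VRing (r * s)) (c + c' + 1)"

inductive_cases eval_elims:
  "eval P env (Var i) v c"
  "eval P env (LetIn a b) v c"
  "eval P env (Call k a) v c"
  "eval P env NilC v c"
  "eval P env (Pair a b) v c"
  "eval P env (Head a) v c"
  "eval P env (Tail a) v c"
  "eval P env (IfNil a b d) v c"
  "eval P env (NatC n) v c"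
  "eval P env (Plus a b) v c"
  "eval P env (Minus a b) v c"
  "eval P env (IfZero a b d) v c"
  "eval P env RZero v c"
  "eval P env ROne v c"
  "eval P env (RPlus a b) v c"
  "eval P env (RTimes a b) v c"

lemma eval_deterministic:
  assumes "eval P env e v c" and "eval P env e v' c'"
  shows "v' = v \<and> c' = c"
  using assms
proof (induction arbitrary: v' c' rule: eval.induct)
  case Var
  from Var.prems show ?case by (rule eval_elims) auto
next
  case LetIn
  from LetIn.prems show ?case
    by (rule eval_elims) (auto dest!: LetIn.IH)
next
  case Call
  from Call.prems show ?case
    by (rule eval_elims) (auto dest!: Call.IH)
next
  case NilC
  from NilC.prems show ?case by (rule eval_elims) auto
next
  case Pair
  from Pair.prems show ?case
    by (rule eval_elims) (auto dest!: Pair.IH)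
next
  case Head
  from Head.prems show ?case
    by (rule eval_elims) (auto dest!: Head.IH)
next
  case Tail
  from Tail.prems show ?case
    by (rule eval_elims) (auto dest!: Tail.IH)
next
  case IfNil_Nil
  from IfNil_Nil.prems show ?case
    by (rule eval_elims) (auto dest!: IfNil_Nil.IH)
next
  case IfNil_Cons
  from IfNil_Cons.prems show ?case
    by (rule eval_elims) (auto dest!: IfNil_Cons.IH)
next
  case NatC
  from NatC.prems show ?case by (rule eval_elims) auto
next
  case Plus
  from Plus.prems show ?case
    by (rule eval_elims) (auto dest!: Plus.IH)
next
  case Minus
  from Minus.prems show ?case
    by (rule eval_elims) (auto dest!: Minus.IH)
next
  case IfZero_0
  from IfZero_0.prems show ?case
    by (rule eval_elims) (auto dest!: IfZero_0.IH)
next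
  case IfZero_Suc
  from IfZero_Suc.prems show ?case
    by (rule eval_elims) (auto dest!: IfZero_Suc.IH)
next
  case RZero
  from RZero.prems show ?case by (rule eval_elims) auto
next
  case ROne
  from ROne.prems show ?case by (rule eval_elims) auto
next
  case RPlus
  from RPlus.prems show ?case
    by (rule eval_elims) (auto dest!: RPlus.IH)
next
  case RTimes
  from RTimes.prems show ?case
    by (rule eval_elims) (auto dest!: RTimes.IH)
qed

definition computes_in :: "prog \<Rightarrow> 'r::comm_ring_1 val \<Rightarrow> 'r val \<Rightarrow> nat \<Rightarrow> bool" where
  "computes_in P inp out c \<longleftrightarrow> eval P [inp] (Call 0 (Var 0)) out c"

section \<open>Input and output format\<close>

fun enc_list :: "'r val list \<Rightarrow> 'r val" where
  "enc_list [] = VNil"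
| "enc_list (x # xs) = VCons x (enc_list xs)"

definition enc_bool :: "bool \<Rightarrow> 'r val" where
  "enc_bool b = VNat (if b then 1 else 0)"

text \<open>With \<open>vs\<close> and \<open>hs\<close> enumerating \<open>V(G)\<close> and \<open>V(H)\<close>, the instance is given vertex by vertex:
  the row of the adjacency matrix, the characteristic vector of the list, and the weights.\<close>

definition enc_instance ::
  "'v list \<Rightarrow> 'h list \<Rightarrow> 'v set set \<Rightarrow> ('v \<Rightarrow> 'h set) \<Rightarrow> ('v \<Rightarrow> 'h \<Rightarrow> 'r) \<Rightarrow> 'r val" where
  "enc_instance vs hs EG L w =
    enc_list (map (\<lambda>v.
      VCons (enc_list (map (\<lambda>u. enc_bool ({v, u} \<in> EG)) vs))
        (VCons (enc_list (map (\<lambda>h. enc_bool (h \<in> L v)) hs))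
          (enc_list (map (\<lambda>h. VRing (w v h)) hs)))) vs)"

text \<open>A polynomial is output as a list of pairs (exponent vector, coefficient) with pairwise distinct
  exponent vectors. Monomials that are not listed have coefficient \<open>0\<close>; zero coefficients may be
  listed, since a program cannot test ring elements for zero.\<close>

definition enc_mono :: "'h list \<Rightarrow> ('h \<Rightarrow>\<^sub>0 nat) \<Rightarrow> 'r val" where
  "enc_mono hs m = enc_list (map (\<lambda>h. VNat (Poly_Mapping.lookup m h)) hs)"

definition represents_mpoly :: "'h list \<Rightarrow> 'r::comm_ring_1 val \<Rightarrow> ('h, 'r) mpoly \<Rightarrow> bool" where
  "represents_mpoly hs out p \<longleftrightarrow>
    (\<exists>ts :: (('h \<Rightarrow>\<^sub>0 nat) \<times> 'r) list.
      distinct (map fst ts) \<and>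
      (\<forall>(m, c) \<in> set ts. Poly_Mapping.keys m \<subseteq> set hs) \<and>
      out = enc_list (map (\<lambda>(m, c). VCons (enc_mono hs m) (VRing c)) ts) \<and>
      p = (\<Sum>(m, c) \<leftarrow> ts. Poly_Mapping.single m c))"

end

theory Submission
  imports Defs "HOL-Library.Multiset"
begin

text \<open>The program keeps a table that maps a monomial together with the residual lists of the
  uncoloured vertices to a coefficient, colours one more vertex of every entry per step, and
  merges equal keys; so its running time is polynomial in the number of residual instances that
  occur. Let \<open>d\<close> be about \<open>sqrt (n * log n / t)\<close>. While some vertex \<open>v\<close> has at least \<open>d\<close>
  uncoloured neighbours with lists of size at least two, \<open>v\<close> is coloured next. As distinct
  neighbourhoods of \<open>H\<close> share at most one vertex, all colours of \<open>v\<close> but one shorten at least \<open>d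
  / 2\<close> lists, and this can happen only \<open>O(n / d)\<close> times, which leaves \<open>n ^ O(n / d)\<close> instances.
  Once all degrees are below \<open>d\<close>, the vertices are taken in a search order: visiting a vertex
  appends all its new neighbours, and the most recent vertex is visited first. The vertices
  whose neighbours are waiting form an induced path, so at most \<open>t * d\<close> coloured vertices have
  an uncoloured neighbour, and a residual instance is determined by their colours.\<close>

section \<open>Symbolic evaluation of programs\<close>

text \<open>Phase 0 is measured by the total length of all lists, at most \<open>k * n\<close> for
  \<open>k\<close> colours: a colour that shortens half of \<open>d\<close> lists removes
  \<open>d / 2\<close> of it, so one branch meets at most \<open>2 * k * n / d\<close> such colours.
  Counting lists of size at least two only has two reasons. A vertex with at most one colour can be
  taken at once without branching, and a list of size two cannot lie inside two distinct
  neighbourhoods of \<open>H\<close>. The search order is computed once, when every remaining list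
  still has two colours, so the later shortening of lists cannot disturb it. Its peculiarity,
  listing a vertex when it is discovered and not when it is visited, keeps the border inside the
  stack: a visited vertex has no uncoloured neighbour once its group is complete. Exponents belong
  to the key because coefficients of different monomials must stay apart; they multiply the number
  of keys by at most \<open>(n + 1) ^ k\<close>. The trivial bound \<open>n\<close> on the border is
  carried along with \<open>t * d\<close>: if \<open>t\<close> is beyond \<open>n * log n\<close>,
  then \<open>d = 1\<close> and \<open>t * d\<close> alone would be too large.\<close>

definition run :: "prog \<Rightarrow> 'r::comm_ring_1 val list \<Rightarrow> expr \<Rightarrow> ('r val \<times> nat) option" where
  "run P env e = (if \<exists>v c. eval P env e v c
     then Some (THE vc. eval P env e (fst vc) (snd vc)) else None)"

lemma run_eq_Some: "run P env e = Some (v, c) \<longleftrightarrow> eval P env e v c"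
proof -
  have the: "(THE vc. eval P env e (fst vc) (snd vc)) = (v', c')" if e: "eval P env e v' c'"
    for v' c'
  proof (rule the_equality)
    show "vc = (v', c')" if "eval P env e (fst vc) (snd vc)" for vc
      using eval_deterministic[OF e that] by (cases vc) auto
  qed (use e in simp)
  show ?thesis
  proof
    assume r: "run P env e = Some (v, c)"
    then obtain v' c' where e: "eval P env e v' c'"
      by (auto simp: run_def split: if_splits)
    with r the[OF e] show "eval P env e v c" by (auto simp: run_def split: if_splits)
  next
    assume e: "eval P env e v c"
    with the[OF e] show "run P env e = Some (v, c)" by (auto simp: run_def)
  qed
qed

definition delay :: "nat \<Rightarrow> ('a \<times> nat) option \<Rightarrow> ('a \<times> nat) option" where
  "delay c r = map_option (\<lambda>(v, c'). (v, c + c' + 1)) r"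

lemma delay_simps [simp]: "delay c None = None" "delay c (Some (v, c')) = Some (v, c + c' + 1)"
  by (auto simp: delay_def)

lemma delay_eq_Some: "delay c r = Some (v, d) \<longleftrightarrow> (\<exists>c'. r = Some (v, c') \<and> d = c + c' + 1)"
  by (auto simp: delay_def)

text \<open>Calls stay behind this constant, since the simplifier would unfold recursive bodies
  forever. A body is opened once, at the outer call; the recursive call inside is then rewritten
  with its known result and cost.\<close>

definition fn :: "prog \<Rightarrow> nat \<Rightarrow> 'r::comm_ring_1 val \<Rightarrow> ('r val \<times> nat) option" where
  "fn P k v = (if k < length P then run P [v] (P ! k) else None)"

lemma option_eqI_Some: "(\<And>v c. r = Some (v, c) \<longleftrightarrow> s = Some (v, c)) \<Longrightarrow> r = s"
  by (cases r; cases s) (force+)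

fun un_nat :: "'r val \<Rightarrow> nat option" where
  "un_nat (VNat n) = Some n"
| "un_nat _ = None"

fun un_ring :: "'r val \<Rightarrow> 'r option" where
  "un_ring (VRing r) = Some r"
| "un_ring _ = None"

fun un_pair :: "'r val \<Rightarrow> ('r val \<times> 'r val) option" where
  "un_pair (VCons x y) = Some (x, y)"
| "un_pair _ = None"

fun un_nil :: "'r val \<Rightarrow> bool option" where
  "un_nil VNil = Some True"
| "un_nil (VCons x y) = Some False"
| "un_nil _ = None"

lemma un_eq_Some:
  "un_nat v = Some n \<longleftrightarrow> v = VNat n"
  "un_ring v = Some r \<longleftrightarrow> v = VRing r"
  "un_pair v = Some p \<longleftrightarrow> v = VCons (fst p) (snd p)"
  "un_nil v = Some b \<longleftrightarrow> (if b then v = VNil else (\<exists>x y. v = VCons x y))"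
  by (cases v; cases p; auto)+

text \<open>The rules for \<open>VNat 0\<close> and \<open>VNat (Suc n)\<close> are merged into one
  with a conditional, so that a single rewrite rule covers both.\<close>

lemma eval_IfZero_if:
  "eval P env a (VNat n) c \<Longrightarrow> eval P env (if n = 0 then b else d) v c' \<Longrightarrow>
    eval P env (IfZero a b d) v (Suc (c + c'))"
  by (cases n) (auto intro: eval.IfZero_0[simplified] eval.IfZero_Suc[simplified])

lemma run_IfZero [simp]:
  "run P env (IfZero a b d) = Option.bind (run P env a) (\<lambda>(v, c).
     Option.bind (un_nat v) (\<lambda>n. delay c (run P env (if n = 0 then b else d))))"
  by (rule option_eqI_Some, rule iffI, unfold run_eq_Some, erule eval_elims;
      auto simp: run_eq_Some[symmetric])
    (auto simp: bind_eq_Some_conv un_eq_Some delay_eq_Some run_eq_Some split del: if_split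
      intro: eval_IfZero_if)

lemma run_simps [simp]:
  "run P env (Var i) = (if i < length env then Some (env ! i, 1) else None)"
  "run P env (LetIn a b) = Option.bind (run P env a) (\<lambda>(v, c). delay c (run P (v # env) b))"
  "run P env (Call k a) = Option.bind (run P env a) (\<lambda>(v, c). delay c (fn P k v))"
  "run P env NilC = Some (VNil, 1)"
  "run P env (Pair a b) = Option.bind (run P env a) (\<lambda>(v, c).
     Option.bind (run P env b) (\<lambda>(v', c'). Some (VCons v v', c + c' + 1)))"
  "run P env (Head a) = Option.bind (run P env a) (\<lambda>(v, c).
     Option.bind (un_pair v) (\<lambda>p. Some (fst p, c + 1)))"
  "run P env (Tail a) = Option.bind (run P env a) (\<lambda>(v, c).
     Option.bind (un_pair v) (\<lambda>p. Some (snd p, c + 1)))"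
  "run P env (IfNil a b d) = Option.bind (run P env a) (\<lambda>(v, c).
     Option.bind (un_nil v) (\<lambda>t. delay c (run P env (if t then b else d))))"
  "run P env (NatC n) = Some (VNat n, 1)"
  "run P env (Plus a b) = Option.bind (run P env a) (\<lambda>(v, c).
     Option.bind (run P env b) (\<lambda>(v', c').
       Option.bind (un_nat v) (\<lambda>m. Option.bind (un_nat v') (\<lambda>n. Some (VNat (m + n), c + c' + 1)))))"
  "run P env (Minus a b) = Option.bind (run P env a) (\<lambda>(v, c).
     Option.bind (run P env b) (\<lambda>(v', c').
       Option.bind (un_nat v) (\<lambda>m. Option.bind (un_nat v') (\<lambda>n. Some (VNat (m - n), c + c' + 1)))))"
  "run P env RZero = Some (VRing 0, 1)"
  "run P env ROne = Some (VRing 1, 1)"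
  "run P env (RPlus a b) = Option.bind (run P env a) (\<lambda>(v, c).
     Option.bind (run P env b) (\<lambda>(v', c').
       Option.bind (un_ring v) (\<lambda>r. Option.bind (un_ring v')
         (\<lambda>s. Some (VRing (r + s), c + c' + 1)))))"
  "run P env (RTimes a b) = Option.bind (run P env a) (\<lambda>(v, c).
     Option.bind (run P env b) (\<lambda>(v', c').
       Option.bind (un_ring v) (\<lambda>r. Option.bind (un_ring v')
         (\<lambda>s. Some (VRing (r * s), c + c' + 1)))))"
  by (rule option_eqI_Some, rule iffI, unfold run_eq_Some,
    (erule eval_elims; auto simp: run_eq_Some[symmetric] fn_def),
      auto simp: bind_eq_Some_conv un_eq_Some delay_eq_Some fn_def run_eq_Some split: if_splits
        intro: eval.intros[simplified])+

section \<open>The algorithm\<close>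

text \<open>A row is a vertex index followed by the characteristic vector of the remaining list of
  that vertex. A key is \<open>(phase # exponents) # rows\<close>, with one row for each uncoloured vertex:
  in phase 0 the next vertex is chosen by its list or its degree, in phase 1 the rows are
  already in search order.\<close>

definition nbr :: "nat list \<Rightarrow> nat list list \<Rightarrow> nat list list" where
  "nbr a rows = filter (\<lambda>u. a ! hd u \<noteq> 0 \<and> 2 \<le> sum_list (tl u)) rows"

definition non_nbr :: "nat list \<Rightarrow> nat list list \<Rightarrow> nat list list" where
  "non_nbr a rows = filter (\<lambda>u. \<not> (a ! hd u \<noteq> 0 \<and> 2 \<le> sum_list (tl u))) rows"

text \<open>\<open>acc\<close> collects the rejected rows, whereas degrees are taken in the full
  list \<open>rows\<close>. The outcome is a permutation with the chosen row in front; the empty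
  list signals that no row qualifies.\<close>

fun select :: "(nat \<Rightarrow> nat list) \<Rightarrow> nat \<Rightarrow> nat list list \<Rightarrow> nat list list \<Rightarrow> nat list list \<Rightarrow>
  nat list list"
  where
  "select a d rows acc [] = []"
| "select a d rows acc (v # vs) =
    (if sum_list (tl v) < 2 \<or> d \<le> length (nbr (a (hd v)) rows) then v # acc @ vs
     else select a d rows (v # acc) vs)"

lemma length_nbr: "length (nbr a rows) + length (non_nbr a rows) = length rows"
  unfolding nbr_def non_nbr_def by (rule sum_length_filter_compl)

text \<open>A row is emitted and pushed when it is discovered; its neighbours are inspected only
  when it is popped. In the termination measure a row in \<open>unv\<close> weighs two and a row on
  the stack one, so every discovery and every pop lowers it.\<close>

function dfs :: "(nat \<Rightarrow> nat list) \<Rightarrow> nat list list \<Rightarrow> nat list list \<Rightarrow> nat list list" where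
  "dfs a [] [] = []"
| "dfs a [] (r # unv) = r # dfs a [r] unv"
| "dfs a (v # st) unv =
    nbr (a (hd v)) unv @ dfs a (nbr (a (hd v)) unv @ st) (non_nbr (a (hd v)) unv)"
  by pat_completeness auto
termination
proof (relation "measure (\<lambda>(a, st, unv). 2 * length unv + length st)")
  show "((a, nbr (a (hd v)) unv @ st, non_nbr (a (hd v)) unv), (a, v # st, unv))
    \<in> measure (\<lambda>(a, st, unv). 2 * length unv + length st)" for a v st unv
    using length_nbr[of "a (hd v)" unv] by simp
qed auto

definition restrict_row :: "nat list \<Rightarrow> nat list \<Rightarrow> nat list" where
  "restrict_row l b = map2 (\<lambda>x y. if y = 0 then 0 else x) l b"

definition update :: "nat list \<Rightarrow> nat list \<Rightarrow> nat list list \<Rightarrow> nat list list" where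
  "update a b rows = map (\<lambda>u. if a ! hd u = 0 then u else hd u # restrict_row (tl u) b) rows"

definition bump :: "nat \<Rightarrow> nat list \<Rightarrow> nat list" where
  "bump i xs = xs[i := Suc (xs ! i)]"

type_synonym 'r entry = "nat list list \<times> 'r"

text \<open>\<open>i\<close> is the position in \<open>e\<close> of the exponent of the current
  colour; \<open>expand\<close> starts at 1 because position 0 holds the phase. \<open>ws\<close>
  and \<open>ah\<close> are consumed in parallel with the list of the vertex, forbidden colours
  included.\<close>

fun branch :: "nat list \<Rightarrow> nat list \<Rightarrow> nat list list \<Rightarrow> 'r::comm_ring_1 \<Rightarrow> nat list \<Rightarrow> 'r list \<Rightarrow>
    nat list list \<Rightarrow> nat \<Rightarrow> 'r entry list" where
  "branch a e rest c [] ws ah i = []"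
| "branch a e rest c (x # l) ws ah i =
    (if x = 0 then [] else [(bump i e # update a (hd ah) rest, c * hd ws)])
    @ branch a e rest c l (tl ws) (tl ah) (Suc i)"

text \<open>A single remaining row is put into phase 1, so that all keys of the final table agree in
  their phase and hence differ in their exponents.\<close>

definition normalise :: "(nat \<Rightarrow> nat list) \<Rightarrow> nat \<Rightarrow> nat list list \<Rightarrow> nat list list" where
  "normalise a d key =
    (if hd (hd key) = 0 then
      (let s = select a d (tl key) [] (tl key) in
       if s = [] then (1 # tl (hd key)) # dfs a [] (tl key)
       else (if tl s = [] then 1 # tl (hd key) else hd key) # s)
     else key)"

type_synonym 'r vertex_data = "nat list \<times> nat list \<times> 'r list"

definition expand :: "'r::comm_ring_1 vertex_data list \<Rightarrow> nat list list \<Rightarrow> nat \<Rightarrow> 'r entry \<Rightarrow>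
  'r entry list"
  where
  "expand inp ah d = (\<lambda>(key, c).
    let key' = normalise (\<lambda>i. fst (inp ! i)) d key; v = hd (tl key')
    in branch (fst (inp ! hd v)) (hd key') (tl (tl key')) c (tl v) (snd (snd (inp ! hd v))) ah 1)"

fun insert_entry :: "'r::comm_ring_1 entry \<Rightarrow> 'r entry list \<Rightarrow> 'r entry list" where
  "insert_entry e [] = [e]"
| "insert_entry e (f # tab) =
    (if fst e = fst f then (fst e, snd e + snd f) # tab else f # insert_entry e tab)"

definition insert_all :: "'r::comm_ring_1 entry list \<Rightarrow> 'r entry list \<Rightarrow> 'r entry list" where
  "insert_all es tab = foldr insert_entry es tab"

definition step :: "'r::comm_ring_1 vertex_data list \<Rightarrow> nat list list \<Rightarrow> nat \<Rightarrow> 'r entry list \<Rightarrow>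
    'r entry list" where
  "step inp ah d tab = foldr (\<lambda>e. insert_all (expand inp ah d e)) tab []"

definition enc_nats :: "nat list \<Rightarrow> 'r val" where "enc_nats xs = enc_list (map VNat xs)"

definition enc_rows :: "nat list list \<Rightarrow> 'r val" where "enc_rows xss = enc_list (map enc_nats xss)"

definition enc_rings :: "'r list \<Rightarrow> 'r val" where "enc_rings rs = enc_list (map VRing rs)"

definition enc_entry :: "'r entry \<Rightarrow> 'r val" where
  "enc_entry e = VCons (enc_rows (fst e)) (VRing (snd e))"

definition enc_table :: "'r entry list \<Rightarrow> 'r val" where
  "enc_table tab = enc_list (map enc_entry tab)"

definition enc_vertex :: "'r vertex_data \<Rightarrow> 'r val" where
  "enc_vertex r = VCons (enc_nats (fst r)) (VCons (enc_nats (fst (snd r)))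
    (enc_rings (snd (snd r))))"

abbreviation enc_vertices :: "'r vertex_data list \<Rightarrow> 'r val" where
  "enc_vertices inp \<equiv> enc_list (map enc_vertex inp)"

lemma enc_simps [simp]:
  "enc_nats [] = VNil" "enc_nats (x # xs) = VCons (VNat x) (enc_nats xs)"
  "enc_rows [] = VNil" "enc_rows (ys # yss) = VCons (enc_nats ys) (enc_rows yss)"
  "enc_rings [] = VNil" "enc_rings (r # rs) = VCons (VRing r) (enc_rings rs)"
  "enc_table [] = VNil" "enc_table (e # tab) = VCons (VCons (enc_rows (fst e)) (VRing (snd e)))
    (enc_table tab)"
  by (auto simp: enc_nats_def enc_rows_def enc_rings_def enc_table_def enc_entry_def)

section \<open>The program\<close>

text \<open>Arguments are right-nested pairs. Those of the longer functions are, in this order, \<open>(inp,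
  d, rows, acc, vs)\<close> for \<open>i_select\<close>, \<open>(inp, st, unv)\<close> for \<open>i_dfs\<close>, \<open>((a, e, rest, c), l, ws, ah,
  i)\<close> for \<open>i_branch\<close>, \<open>(inp, d, key)\<close> for \<open>i_normalise\<close>, \<open>(inp, d, key, c)\<close> for \<open>i_expand\<close>,
  \<open>(inp, d, tab)\<close> for \<open>i_step\<close> and \<open>(xs, inp, d, tab)\<close> for \<open>i_iterate\<close>, which performs one step
  per element of \<open>xs\<close>.\<close>

abbreviation (input) "i_main \<equiv> 0::nat"
abbreviation (input) "i_nth \<equiv> 1::nat"
abbreviation (input) "i_app \<equiv> 2::nat"
abbreviation (input) "i_sum \<equiv> 3::nat"
abbreviation (input) "i_len \<equiv> 4::nat"
abbreviation (input) "i_nbr \<equiv> 5::nat"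
abbreviation (input) "i_non_nbr \<equiv> 6::nat"
abbreviation (input) "i_select \<equiv> 7::nat"
abbreviation (input) "i_dfs \<equiv> 8::nat"
abbreviation (input) "i_restrict \<equiv> 9::nat"
abbreviation (input) "i_update \<equiv> 10::nat"
abbreviation (input) "i_bump \<equiv> 11::nat"
abbreviation (input) "i_branch \<equiv> 12::nat"
abbreviation (input) "i_normalise \<equiv> 13::nat"
abbreviation (input) "i_expand \<equiv> 14::nat"
abbreviation (input) "i_eq \<equiv> 15::nat"
abbreviation (input) "i_eqs \<equiv> 16::nat"
abbreviation (input) "i_insert \<equiv> 17::nat"
abbreviation (input) "i_insert_all \<equiv> 18::nat"
abbreviation (input) "i_step \<equiv> 19::nat"
abbreviation (input) "i_iterate \<equiv> 20::nat"
abbreviation (input) "i_output \<equiv> 21::nat"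
abbreviation (input) "i_init \<equiv> 22::nat"
abbreviation (input) "i_log \<equiv> 23::nat"
abbreviation (input) "i_mult \<equiv> 24::nat"
abbreviation (input) "i_degree \<equiv> 25::nat"

abbreviation (input) "Par \<equiv> Var 0"
abbreviation (input) "Tail2 e \<equiv> Tail (Tail e)"
abbreviation (input) "Tail3 e \<equiv> Tail (Tail2 e)"
abbreviation (input) "Tail4 e \<equiv> Tail (Tail3 e)"
abbreviation (input) "Snd e \<equiv> Head (Tail e)"
abbreviation (input) "Third e \<equiv> Head (Tail2 e)"
abbreviation (input) "Fourth e \<equiv> Head (Tail3 e)"

fun literal :: "nat list \<Rightarrow> expr" where
  "literal [] = NilC"
| "literal (x # xs) = Pair (NatC x) (literal xs)"

fun literals :: "nat list list \<Rightarrow> expr" where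
  "literals [] = NilC"
| "literals (x # xs) = Pair (literal x) (literals xs)"

definition "nth_body = IfZero (Head Par) (Snd Par)
  (Call i_nth (Pair (Minus (Head Par) (NatC 1)) (Tail2 Par)))"

definition "app_body = IfNil (Head Par) (Tail Par)
  (Pair (Head (Head Par)) (Call i_app (Pair (Tail (Head Par)) (Tail Par))))"

definition "sum_body = IfNil Par (NatC 0) (Plus (Head Par) (Call i_sum (Tail Par)))"

definition "len_body = IfNil Par (NatC 0) (Plus (NatC 1) (Call i_len (Tail Par)))"

text \<open>A conjunction by arithmetic: truncated subtraction of 1 leaves a nonzero number exactly
  if the list has at least two colours, and for non-neighbours this number is replaced by 0.\<close>

definition "nbr_test = IfZero (Call i_nth (Pair (Head (Snd Par)) (Head Par))) (NatC 0)
  (Minus (Call i_sum (Tail (Snd Par))) (NatC 1))"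

definition "nbr_body = IfNil (Tail Par) NilC
  (LetIn (Call i_nbr (Pair (Head Par) (Tail2 Par)))
    (IfZero (LetIn (Var 1) nbr_test) Par (Pair (Snd (Var 1)) Par)))"

definition "non_nbr_body = IfNil (Tail Par) NilC
  (LetIn (Call i_non_nbr (Pair (Head Par) (Tail2 Par)))
    (IfZero (LetIn (Var 1) nbr_test) (Pair (Snd (Var 1)) Par) Par))"

definition "select_pick = Pair (Head (Tail4 Par)) (Call i_app
  (Pair (Fourth Par) (Tail (Tail4 Par))))"

definition "select_body = IfNil (Tail4 Par) NilC
  (IfZero (Minus (Call i_sum (Tail (Head (Tail4 Par)))) (NatC 1)) select_pick
    (IfZero (Minus (Snd Par) (Call i_len (Call i_nbr
        (Pair (Head (Call i_nth (Pair (Head (Head (Tail4 Par))) (Head Par)))) (Third Par)))))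
      select_pick
      (Call i_select (Pair (Head Par) (Pair (Snd Par) (Pair (Third Par)
        (Pair (Pair (Head (Tail4 Par)) (Fourth Par)) (Tail (Tail4 Par)))))))))"

definition "dfs_body = IfNil (Snd Par)
  (IfNil (Tail2 Par) NilC
    (Pair (Third Par) (Call i_dfs (Pair (Head Par) (Pair (Pair (Third Par) NilC) (Tail3 Par))))))
  (LetIn (Head (Call i_nth (Pair (Head (Head (Snd Par))) (Head Par))))
    (LetIn (Call i_nbr (Pair Par (Tail2 (Var 1))))
      (Call i_app (Pair Par (Call i_dfs (Pair (Head (Var 2))
        (Pair (Call i_app (Pair Par (Tail (Snd (Var 2)))))
          (Call i_non_nbr (Pair (Var 1) (Tail2 (Var 2)))))))))))"

definition "restrict_body = IfNil (Head Par) NilC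
  (Pair (IfZero (Snd Par) (NatC 0) (Head (Head Par)))
    (Call i_restrict (Pair (Tail (Head Par)) (Tail2 Par))))"

definition "update_body = IfNil (Tail2 Par) NilC
  (Pair (IfZero (Call i_nth (Pair (Head (Third Par)) (Head Par))) (Third Par)
      (Pair (Head (Third Par)) (Call i_restrict (Pair (Tail (Third Par)) (Snd Par)))))
    (Call i_update (Pair (Head Par) (Pair (Snd Par) (Tail3 Par)))))"

definition "bump_body = IfZero (Head Par) (Pair (Plus (Snd Par) (NatC 1)) (Tail2 Par))
  (Pair (Snd Par) (Call i_bump (Pair (Minus (Head Par) (NatC 1)) (Tail2 Par))))"

definition "branch_body = IfNil (Snd Par) NilC
  (LetIn (Call i_branch (Pair (Head Par)
      (Pair (Tail (Snd Par)) (Pair (Tail (Third Par))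
        (Pair (Tail (Fourth Par)) (Plus (Tail4 Par) (NatC 1)))))))
    (IfZero (Head (Snd (Var 1))) Par
      (Pair (Pair
          (Pair (Call i_bump (Pair (Tail4 (Var 1)) (Snd (Head (Var 1)))))
            (Call i_update (Pair (Head (Head (Var 1)))
              (Pair (Head (Fourth (Var 1))) (Third (Head (Var 1)))))))
          (RTimes (Tail3 (Head (Var 1))) (Head (Third (Var 1))))) Par)))"

definition "normalise_body = IfZero (Head (Head (Tail2 Par)))
  (LetIn
    (Call i_select (Pair (Head Par) (Pair (Snd Par) (Pair (Tail3 Par) (Pair NilC (Tail3 Par))))))
    (IfNil Par
      (Pair (Pair (NatC 1) (Tail (Head (Tail2 (Var 1)))))
        (Call i_dfs (Pair (Head (Var 1)) (Pair NilC (Tail3 (Var 1))))))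
      (IfNil (Tail Par) (Pair (Pair (NatC 1) (Tail (Head (Tail2 (Var 1))))) Par)
        (Pair (Head (Tail2 (Var 1))) Par))))
  (Tail2 Par)"

definition "expand_body ah = LetIn (Call i_normalise (Pair (Head Par) (Pair (Snd Par) (Third Par))))
  (LetIn (Call i_nth (Pair (Head (Snd Par)) (Head (Var 1))))
    (Call i_branch (Pair
      (Pair (Head Par) (Pair (Head (Var 1)) (Pair (Tail2 (Var 1)) (Tail3 (Var 2)))))
      (Pair (Tail (Snd (Var 1))) (Pair (Tail2 Par) (Pair (literals ah) (NatC 1)))))))"

text \<open>With truncation, \<open>m - n\<close> and \<open>n - m\<close> both vanish exactly if
  \<open>m = n\<close>. Equality is reported as 0, ready for \<open>IfZero\<close>.\<close>

definition "eq_body = IfNil (Head Par) (IfNil (Tail Par) (NatC 0) (NatC 1))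
  (IfNil (Tail Par) (NatC 1)
    (IfZero (Plus (Minus (Head (Head Par)) (Snd Par)) (Minus (Snd Par) (Head (Head Par))))
      (Call i_eq (Pair (Tail (Head Par)) (Tail2 Par))) (NatC 1)))"

definition "eqs_body = IfNil (Head Par) (IfNil (Tail Par) (NatC 0) (NatC 1))
  (IfNil (Tail Par) (NatC 1)
    (IfZero (Call i_eq (Pair (Head (Head Par)) (Snd Par)))
      (Call i_eqs (Pair (Tail (Head Par)) (Tail2 Par))) (NatC 1)))"

definition "insert_body = IfNil (Tail Par) (Pair (Head Par) NilC)
  (IfZero (Call i_eqs (Pair (Head (Head Par)) (Head (Snd Par))))
    (Pair (Pair (Head (Head Par)) (RPlus (Tail (Head Par)) (Tail (Snd Par)))) (Tail2 Par))
    (Pair (Snd Par) (Call i_insert (Pair (Head Par) (Tail2 Par)))))"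

definition "insert_all_body = IfNil (Head Par) (Tail Par)
  (Call i_insert (Pair (Head (Head Par)) (Call i_insert_all (Pair (Tail (Head Par)) (Tail Par)))))"

definition "step_body = IfNil (Tail2 Par) NilC
  (Call i_insert_all (Pair
    (Call i_expand (Pair (Head Par) (Pair (Snd Par) (Third Par))))
    (Call i_step (Pair (Head Par) (Pair (Snd Par) (Tail3 Par))))))"

definition "iterate_body = IfNil (Head Par) (Tail3 Par)
  (Call i_iterate (Pair (Tail (Head Par)) (Pair (Snd Par) (Pair (Third Par)
    (Call i_step (Tail Par))))))"

definition "output_body = IfNil Par NilC
  (Pair (Pair (Tail (Head (Head (Head Par)))) (Tail (Head Par))) (Call i_output (Tail Par)))"

definition "init_body = IfNil (Tail Par) NilC
  (Pair (Pair (Head Par) (Snd (Snd Par))) (Call i_init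
    (Pair (Plus (Head Par) (NatC 1)) (Tail2 Par))))"

text \<open>The arguments are \<open>(p, i, n)\<close>, and \<open>p\<close> doubles until it
  reaches \<open>n\<close>. As \<open>main_body\<close> starts with \<open>p = 1\<close> and
  \<open>i = 1\<close>, the result is \<open>Suc (ceil_log n)\<close>, which is positive also for
  \<open>n = 1\<close>.\<close>

definition "log_body = IfZero (Minus (Tail2 Par) (Head Par)) (Snd Par)
  (Call i_log (Pair (Plus (Head Par) (Head Par)) (Pair (Plus (Snd Par) (NatC 1)) (Tail2 Par))))"

definition "mult_body = IfZero (Head Par) (NatC 0)
  (Plus (Tail Par) (Call i_mult (Pair (Minus (Head Par) (NatC 1)) (Tail Par))))"

definition "degree_body t = IfZero
  (Minus (Tail Par) (Call i_mult (Pair (Call i_mult (Pair (Head Par) (Head Par))) (NatC t))))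
    (Head Par)
  (Call i_degree (Pair (Plus (Head Par) (NatC 1)) (Tail Par)))"

text \<open>The encoded vertex list doubles as loop counter of \<open>i_iterate\<close>. The
  \<open>Suc k\<close> zeros of the initial header are the phase and the \<open>k\<close>
  exponents.\<close>

definition "main_body k = LetIn
  (Call i_degree (Pair (NatC 1)
    (Call i_mult (Pair (Call i_len Par) (Call i_log
      (Pair (NatC 1) (Pair (NatC 1) (Call i_len Par))))))))
  (Call i_output (Call i_iterate (Pair (Var 1) (Pair (Var 1) (Pair Par
    (Pair (Pair (Pair (literal (replicate (Suc k) 0)) (Call i_init (Pair (NatC 0) (Var 1)))) ROne)
      NilC))))))"

definition program :: "nat \<Rightarrow> nat list list \<Rightarrow> prog" where
  "program t ah = [main_body (length ah), nth_body, app_body, sum_body, len_body, nbr_body,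
    non_nbr_body, select_body, dfs_body, restrict_body, update_body, bump_body, branch_body,
    normalise_body, expand_body ah, eq_body, eqs_body, insert_body, insert_all_body, step_body,
    iterate_body, output_body, init_body, log_body, mult_body, degree_body t]"

text \<open>The parameter \<open>ring\<close> only fixes the coefficient type.\<close>

locale machine =
  fixes t :: nat and ah :: "nat list list" and ring :: "'r::comm_ring_1 itself"
begin

abbreviation exec :: "'r val list \<Rightarrow> expr \<Rightarrow> ('r val \<times> nat) option" where
  "exec \<equiv> run (program t ah)"

abbreviation call :: "nat \<Rightarrow> 'r val \<Rightarrow> ('r val \<times> nat) option" where
  "call \<equiv> fn (program t ah)"

lemma fn_bodies:
  "call i_main v = exec [v] (main_body (length ah))"
  "call i_nth v = exec [v] nth_body"
  "call i_app v = exec [v] app_body"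
  "call i_sum v = exec [v] sum_body"
  "call i_len v = exec [v] len_body"
  "call i_nbr v = exec [v] nbr_body"
  "call i_non_nbr v = exec [v] non_nbr_body"
  "call i_select v = exec [v] select_body"
  "call i_dfs v = exec [v] dfs_body"
  "call i_restrict v = exec [v] restrict_body"
  "call i_update v = exec [v] update_body"
  "call i_bump v = exec [v] bump_body"
  "call i_branch v = exec [v] branch_body"
  "call i_normalise v = exec [v] normalise_body"
  "call i_expand v = exec [v] (expand_body ah)"
  "call i_eq v = exec [v] eq_body"
  "call i_eqs v = exec [v] eqs_body"
  "call i_insert v = exec [v] insert_body"
  "call i_insert_all v = exec [v] insert_all_body"
  "call i_step v = exec [v] step_body"
  "call i_iterate v = exec [v] iterate_body"
  "call i_output v = exec [v] output_body"
  "call i_init v = exec [v] init_body"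
  "call i_log v = exec [v] log_body"
  "call i_mult v = exec [v] mult_body"
  "call i_degree v = exec [v] (degree_body t)"
  by (simp_all add: fn_def program_def)

end

section \<open>Correctness and running time of the program\<close>

text \<open>\<open>N\<close> bounds vertex indices and \<open>S\<close> bounds lengths, so a look-up
  by index and a scan of a row both cost \<open>O(S)\<close>.\<close>

definition row_ok :: "nat \<Rightarrow> nat \<Rightarrow> nat list \<Rightarrow> bool" where
  "row_ok N S u \<longleftrightarrow> u \<noteq> [] \<and> hd u < N \<and> N \<le> S \<and> length u \<le> S"

context machine
begin

text \<open>The pattern of all cost lemmas: the body is opened once, the induction hypothesis
  supplies value and cost of the recursive call, and simplification adds up the steps of one round.
  The constant per round is generous.\<close>

lemma fn_nth:
  "i < length xs \<Longrightarrow> \<exists>c \<le> 20 * Suc i. call i_nth (VCons (VNat i) (enc_list xs)) = Some (xs ! i, c)"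
proof (induction xs arbitrary: i)
  case (Cons x xs)
  show ?case
  proof (cases i)
    case 0
    then show ?thesis by (subst fn_bodies(2)) (simp add: nth_body_def)
  next
    case (Suc j)
    with Cons obtain c where "c \<le> 20 * Suc j"
      "call i_nth (VCons (VNat j) (enc_list xs)) = Some (xs ! j, c)" by fastforce
    with Suc show ?thesis by (subst fn_bodies(2)) (simp add: nth_body_def)
  qed
qed simp

lemma fn_nth_nats:
  "i < length xs \<Longrightarrow> \<exists>c \<le> 20 * Suc i. call i_nth (VCons (VNat i) (enc_nats xs)) =
    Some (VNat (xs ! i), c)"
  using fn_nth[of i "map VNat xs"] by (simp add: enc_nats_def)

lemma fn_app:
  "\<exists>c \<le> 20 * Suc (length xs). call i_app (VCons (enc_rows xs) (enc_rows ys)) =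
    Some (enc_rows (xs @ ys), c)"
proof (induction xs)
  case (Cons x xs)
  then obtain c where "c \<le> 20 * Suc (length xs)"
    "call i_app (VCons (enc_rows xs) (enc_rows ys)) = Some (enc_rows (xs @ ys), c)" by blast
  then show ?case by (subst fn_bodies(3)) (simp add: app_body_def)
qed (simp add: fn_bodies(3) app_body_def)

lemma fn_sum: "\<exists>c \<le> 10 * Suc (length xs). call i_sum (enc_nats xs) = Some (VNat (sum_list xs), c)"
proof (induction xs)
  case (Cons x xs)
  then obtain c where "c \<le> 10 * Suc (length xs)" "call i_sum (enc_nats xs) =
    Some (VNat (sum_list xs), c)"
    by blast
  then show ?case by (subst fn_bodies(4)) (simp add: sum_body_def)
qed (simp add: fn_bodies(4) sum_body_def)

lemma fn_len: "\<exists>c \<le> 10 * Suc (length xs). call i_len (enc_list xs) = Some (VNat (length xs), c)"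
proof (induction xs)
  case (Cons x xs)
  then obtain c where "c \<le> 10 * Suc (length xs)" "call i_len (enc_list xs) =
    Some (VNat (length xs), c)"
    by blast
  then show ?case by (subst fn_bodies(5)) (simp add: len_body_def)
qed (simp add: fn_bodies(5) len_body_def)

lemma run_nbr_test:
  assumes "row_ok N S u" "N \<le> length a"
  shows "\<exists>c \<le> 30 * S + 25. \<exists>m. exec (VCons (enc_nats a) (VCons (enc_nats u) z) # env) nbr_test =
    Some (VNat m, c) \<and>
    (m = 0 \<longleftrightarrow> \<not> (a ! hd u \<noteq> 0 \<and> 2 \<le> sum_list (tl u)))"
proof -
  obtain h l where u: "u = h # l" "h < N" "N \<le> S" "length l < S" using assms(1)
    by (cases u) (auto simp: row_ok_def)
  obtain c1 where c1: "c1 \<le> 20 * Suc h" "call i_nth (VCons (VNat h) (enc_nats a)) =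
    Some (VNat (a ! h), c1)"
    using fn_nth_nats[of h a] u assms(2) by auto
  obtain c2 where c2: "c2 \<le> 10 * Suc (length l)" "call i_sum (enc_nats l) =
    Some (VNat (sum_list l), c2)"
    using fn_sum by blast
  show ?thesis using u c1 c2 by (auto simp: nbr_test_def)
qed

lemma fn_nbr:
  assumes "\<forall>u\<in>set rows. row_ok N S u" "N \<le> length a" "1 \<le> S"
  shows "\<exists>c \<le> 80 * S * Suc (length rows).
    call i_nbr (VCons (enc_nats a) (enc_rows rows)) = Some (enc_rows (nbr a rows), c)"
  using assms(1)
proof (induction rows)
  case Nil
  then show ?case using assms(3) by (simp add: fn_bodies(6) nbr_body_def nbr_def)
next
  case (Cons u rows)
  then obtain c where c: "c \<le> 80 * S * Suc (length rows)"
    "call i_nbr (VCons (enc_nats a) (enc_rows rows)) = Some (enc_rows (nbr a rows), c)" by auto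
  obtain c1 m where "c1 \<le> 30 * S + 25"
    "exec [VCons (enc_nats a) (VCons (enc_nats u) (enc_rows rows)), enc_rows (nbr a rows), VCons
      (enc_nats a) (VCons (enc_nats u) (enc_rows rows))]
       nbr_test = Some (VNat m, c1)"
    "m = 0 \<longleftrightarrow> \<not> (a ! hd u \<noteq> 0 \<and> 2 \<le> sum_list (tl u))"
    using run_nbr_test[of N S u a] Cons.prems assms(2) by (metis list.set_intros(1))
  note this(1,2) and m = this(3)
  then show ?case using c assms(3)
    by (subst fn_bodies(6)) (cases "m = 0"; use m in \<open>simp add: nbr_body_def nbr_def algebra_simps\<close>)
qed

lemma fn_non_nbr:
  assumes "\<forall>u\<in>set rows. row_ok N S u" "N \<le> length a" "1 \<le> S"
  shows "\<exists>c \<le> 80 * S * Suc (length rows).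
    call i_non_nbr (VCons (enc_nats a) (enc_rows rows)) = Some (enc_rows (non_nbr a rows), c)"
  using assms(1)
proof (induction rows)
  case Nil
  then show ?case using assms(3) by (simp add: fn_bodies(7) non_nbr_body_def non_nbr_def)
next
  case (Cons u rows)
  then obtain c where c: "c \<le> 80 * S * Suc (length rows)"
    "call i_non_nbr (VCons (enc_nats a) (enc_rows rows)) = Some (enc_rows (non_nbr a rows), c)"
      by auto
  obtain c1 m where "c1 \<le> 30 * S + 25"
    "exec [VCons (enc_nats a) (VCons (enc_nats u) (enc_rows rows)), enc_rows (non_nbr a rows),
      VCons (enc_nats a) (VCons (enc_nats u) (enc_rows rows))]
       nbr_test = Some (VNat m, c1)"
    "m = 0 \<longleftrightarrow> \<not> (a ! hd u \<noteq> 0 \<and> 2 \<le> sum_list (tl u))"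
    using run_nbr_test[of N S u a] Cons.prems assms(2) by (metis list.set_intros(1))
  note this(1,2) and m = this(3)
  then show ?case using c assms(3)
    by (subst fn_bodies(7)) (cases "m = 0"; use m in \<open>simp add: non_nbr_body_def non_nbr_def
      algebra_simps\<close>)
qed

lemma fn_restrict:
  "length l \<le> length b \<Longrightarrow> \<exists>c \<le> 30 * Suc (length l).
    call i_restrict (VCons (enc_nats l) (enc_nats b)) = Some (enc_nats (restrict_row l b), c)"
proof (induction l arbitrary: b)
  case Nil
  then show ?case by (simp add: fn_bodies(10) restrict_body_def restrict_row_def)
next
  case (Cons x l)
  then obtain y b' where b: "b = y # b'" "length l \<le> length b'" by (cases b) auto
  with Cons.IH obtain c where "c \<le> 30 * Suc (length l)"
    "call i_restrict (VCons (enc_nats l) (enc_nats b')) = Some (enc_nats (restrict_row l b'), c)"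
      by blast
  then show ?case using b
    by (subst fn_bodies(10)) (simp add: restrict_body_def restrict_row_def)
qed

lemma fn_update:
  assumes "\<forall>u\<in>set rows. row_ok N S u \<and> length u \<le> Suc (length b)" "N \<le> length a" "1 \<le> S"
  shows "\<exists>c \<le> 110 * S * Suc (length rows).
    call i_update (VCons (enc_nats a) (VCons (enc_nats b) (enc_rows rows))) = Some
      (enc_rows (update a b rows), c)"
  using assms(1)
proof (induction rows)
  case Nil
  then show ?case using assms(3) by (simp add: fn_bodies(11) update_body_def update_def)
next
  case (Cons u rows)
  then obtain c where c: "c \<le> 110 * S * Suc (length rows)"
    "call i_update (VCons (enc_nats a) (VCons (enc_nats b) (enc_rows rows))) =
      Some (enc_rows (update a b rows), c)" by auto
  obtain h l where u: "u = h # l" "h < N" "N \<le> S" "length l < S" "length l \<le> length b"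
    using Cons.prems by (cases u) (auto simp: row_ok_def)
  obtain c1 where c1: "c1 \<le> 20 * Suc h" "call i_nth (VCons (VNat h) (enc_nats a)) =
    Some (VNat (a ! h), c1)"
    using fn_nth_nats[of h a] u assms(2) by auto
  obtain c2 where c2: "c2 \<le> 30 * Suc (length l)"
     "call i_restrict (VCons (enc_nats l) (enc_nats b)) = Some (enc_nats (restrict_row l b), c2)"
    using fn_restrict u by blast
  show ?case using c u c1 c2 assms(3)
    by (subst fn_bodies(11)) (simp add: update_body_def update_def algebra_simps)
qed

lemma fn_bump:
  "i < length xs \<Longrightarrow> \<exists>c \<le> 30 * Suc i. call i_bump (VCons (VNat i) (enc_nats xs)) =
    Some (enc_nats (bump i xs), c)"
proof (induction xs arbitrary: i)
  case (Cons x xs)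
  show ?case
  proof (cases i)
    case 0
    then show ?thesis by (simp add: fn_bodies(12) bump_body_def bump_def)
  next
    case (Suc j)
    with Cons obtain c where "c \<le> 30 * Suc j"
      "call i_bump (VCons (VNat j) (enc_nats xs)) = Some (enc_nats (bump j xs), c)" by fastforce
    with Suc show ?thesis by (subst fn_bodies(12)) (simp add: bump_body_def bump_def)
  qed
qed simp

lemma fn_eq:
  "\<exists>c \<le> 40 * Suc (length xs). \<exists>m. call i_eq (VCons (enc_nats xs) (enc_nats ys)) = Some (VNat m, c) \<and>
    (m = 0 \<longleftrightarrow> xs = ys)"
proof (induction xs arbitrary: ys)
  case Nil
  then show ?case by (cases ys) (simp_all add: fn_bodies(16) eq_body_def)
next
  case (Cons x xs)
  show ?case
  proof (cases ys)
    case Nil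
    then show ?thesis by (simp add: fn_bodies(16) eq_body_def)
  next
    case ys: (Cons y ys')
    from Cons.IH[of ys'] obtain c m where "c \<le> 40 * Suc (length xs)"
      "call i_eq (VCons (enc_nats xs) (enc_nats ys')) = Some (VNat m, c)" "m = 0 \<longleftrightarrow> xs = ys'"
        by blast
    then show ?thesis
      by (subst fn_bodies(16)) (cases "x = y"; simp add: eq_body_def ys)
  qed
qed

lemma fn_eqs:
  assumes "\<forall>x\<in>set xs. length x \<le> S" "1 \<le> S"
  shows "\<exists>c \<le> 120 * S * Suc (length xs). \<exists>m.
    call i_eqs (VCons (enc_rows xs) (enc_rows ys)) = Some (VNat m, c) \<and> (m = 0 \<longleftrightarrow> xs = ys)"
  using assms(1)
proof (induction xs arbitrary: ys)
  case Nil
  then show ?case using assms(2) by (cases ys) (simp_all add: fn_bodies(17) eqs_body_def)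
next
  case (Cons x xs)
  show ?case
  proof (cases ys)
    case Nil
    then show ?thesis using assms(2) by (simp add: fn_bodies(17) eqs_body_def)
  next
    case ys: (Cons y ys')
    from Cons obtain c m where c: "c \<le> 120 * S * Suc (length xs)"
      "call i_eqs (VCons (enc_rows xs) (enc_rows ys')) = Some (VNat m, c)" "m = 0 \<longleftrightarrow> xs = ys'"
      by (metis list.set_intros(2))
    obtain c1 m1 where c1: "c1 \<le> 40 * Suc (length x)"
      "call i_eq (VCons (enc_nats x) (enc_nats y)) = Some (VNat m1, c1)" "m1 = 0 \<longleftrightarrow> x = y"
      using fn_eq by blast
    show ?thesis using c c1 Cons.prems assms(2)
      by (subst fn_bodies(17)) (cases "m1 = 0"; simp add: eqs_body_def ys algebra_simps)
  qed
qed

text \<open>\<open>S * S\<close> is the order of the cost of one call of \<open>nbr\<close>. It is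
  hidden behind \<open>Q\<close>, as \<open>S * S * S\<close> is behind \<open>R\<close> further on,
  so that the accounting stays linear in named quantities.\<close>

lemma fn_select:
  assumes "\<forall>u\<in>set rows \<union> set vs. row_ok N S u" "length rows \<le> S" "length acc + length vs \<le> S"
    and "\<forall>x\<in>set inp. N \<le> length (fst x)" "N \<le> length inp" "1 \<le> S" "S * S \<le> Q"
  shows "\<exists>c \<le> 400 * Q * Suc (length vs).
    call i_select (VCons (enc_vertices inp) (VCons (VNat d) (VCons (enc_rows rows)
      (VCons (enc_rows acc) (enc_rows vs))))) = Some
        (enc_rows (select (\<lambda>i. fst (inp ! i)) d rows acc vs), c)"
  using assms(1,3)
proof (induction vs arbitrary: acc)
  case Nil
  have "1 \<le> Q" using assms(6,7) le_square[of S] by linarith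
  then show ?case by (subst fn_bodies(8)) (simp add: select_body_def)
next
  case (Cons v vs)
  have SS: "S \<le> Q" using assms(7) le_square[of S] by linarith
  from Cons.prems Cons.IH[of "v # acc"] obtain c where c: "c \<le> 400 * Q * Suc (length vs)"
    "call i_select (VCons (enc_vertices inp) (VCons (VNat d) (VCons (enc_rows rows)
      (VCons (enc_rows (v # acc)) (enc_rows vs))))) = Some
        (enc_rows (select (\<lambda>i. fst (inp ! i)) d rows (v # acc) vs), c)"
    by auto
  obtain h l where v: "v = h # l" "h < N" "N \<le> S" "length l < S"
    using Cons.prems by (cases v) (auto simp: row_ok_def)
  have h: "h < length inp" using v assms(5) by simp
  obtain c1 where c1: "c1 \<le> 20 * Suc h"
    "call i_nth (VCons (VNat h) (enc_vertices inp)) = Some (enc_vertex (inp ! h), c1)"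
    using fn_nth[of h "map enc_vertex inp"] h by auto
  obtain c2 where c2: "c2 \<le> 10 * Suc (length l)" "call i_sum (enc_nats l) =
    Some (VNat (sum_list l), c2)"
    using fn_sum by blast
  have a: "N \<le> length (fst (inp ! h))" using h assms(4) by simp
  obtain c3 where c3: "c3 \<le> 80 * S * Suc (length rows)"
    "call i_nbr (VCons (enc_nats (fst (inp ! h))) (enc_rows rows)) =
      Some (enc_rows (nbr (fst (inp ! h)) rows), c3)"
    using fn_nbr[OF _ a assms(6)] Cons.prems by auto
  have c3': "c3 \<le> 80 * Q + 80 * S"
    using c3(1) mult_le_mono2[OF assms(2), of S] assms(7) unfolding mult_Suc_right by linarith
  have l4: "length (nbr (fst (inp ! h)) rows) \<le> S"
    using length_filter_le assms(2) by (metis nbr_def le_trans)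
  obtain c4 where c4: "c4 \<le> 10 * Suc (length (nbr (fst (inp ! h)) rows))"
    "call i_len (enc_rows (nbr (fst (inp ! h)) rows)) =
      Some (VNat (length (nbr (fst (inp ! h)) rows)), c4)"
    using fn_len[of "map enc_nats (nbr (fst (inp ! h)) rows)"] by (auto simp: enc_rows_def)
  obtain c5 where c5: "c5 \<le> 20 * Suc (length acc)"
    "call i_app (VCons (enc_rows acc) (enc_rows vs)) = Some (enc_rows (acc @ vs), c5)"
    using fn_app by blast
  note facts = v(2-4) c c1 c2 c3(2) c3' c4 l4 c5 Cons.prems(2) SS assms(6)
  consider "sum_list l < 2" | "\<not> sum_list l < 2" "d \<le> length (nbr (fst (inp ! h)) rows)"
    | "\<not> sum_list l < 2" "\<not> d \<le> length (nbr (fst (inp ! h)) rows)" by blast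
  then show ?case
  proof cases
    case 1
    with facts show ?thesis
      by (subst fn_bodies(8)) (simp add: select_body_def select_pick_def v(1) enc_vertex_def
        algebra_simps)
  next
    case 2
    with facts show ?thesis
      by (subst fn_bodies(8)) (simp add: select_body_def select_pick_def v(1) enc_vertex_def
        algebra_simps)
  next
    case 3
    with facts show ?thesis
      by (subst fn_bodies(8)) (simp add: select_body_def select_pick_def v(1) enc_vertex_def
        algebra_simps)
  qed
qed

lemma fn_dfs:
  assumes "\<forall>u\<in>set st \<union> set unv. row_ok N S u" "length st + length unv \<le> S"
    and "\<forall>x\<in>set inp. N \<le> length (fst x)" "N \<le> length inp" "1 \<le> S" "S * S \<le> Q"
  shows "\<exists>c \<le> 800 * Q * Suc (2 * length unv + length st).
    call i_dfs (VCons (enc_vertices inp) (VCons (enc_rows st) (enc_rows unv)))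
      = Some (enc_rows (dfs (\<lambda>i. fst (inp ! i)) st unv), c)"
  using assms(1,2)
proof (induction "\<lambda>i. fst (inp ! i)" st unv rule: dfs.induct)
  case 1
  have "1 \<le> Q" using assms(5,6) le_square[of S] by linarith
  then show ?case by (subst fn_bodies(9)) (simp add: dfs_body_def)
next
  case (2 r unv)
  have SS: "S \<le> Q" using assms(6) le_square[of S] by linarith
  from 2 obtain c where "c \<le> 800 * Q * Suc (2 * length unv + length [r])"
    "call i_dfs (VCons (enc_vertices inp) (VCons (enc_rows [r]) (enc_rows unv)))
      = Some (enc_rows (dfs (\<lambda>i. fst (inp ! i)) [r] unv), c)" by auto
  then show ?case using SS assms(5)
    by (subst fn_bodies(9)) (simp add: dfs_body_def algebra_simps)
next
  case (3 v st unv)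
  have SS: "S \<le> Q" using assms(6) le_square[of S] by linarith
  obtain h l where v: "v = h # l" "h < N" "N \<le> S" "length l < S"
    using 3(2) by (cases v) (auto simp: row_ok_def)
  define a where "a = fst (inp ! h)"
  have h: "h < length inp" using v assms(4) by simp
  obtain c1 where c1: "c1 \<le> 20 * Suc h"
    "call i_nth (VCons (VNat h) (enc_vertices inp)) = Some (enc_vertex (inp ! h), c1)"
    using fn_nth[of h "map enc_vertex inp"] h by auto
  have la: "N \<le> length a" using h assms(3) by (simp add: a_def)
  obtain c2 where c2: "c2 \<le> 80 * S * Suc (length unv)"
    "call i_nbr (VCons (enc_nats a) (enc_rows unv)) = Some (enc_rows (nbr a unv), c2)"
    using fn_nbr[OF _ la assms(5)] 3(2) by auto
  obtain c3 where c3: "c3 \<le> 80 * S * Suc (length unv)"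
    "call i_non_nbr (VCons (enc_nats a) (enc_rows unv)) = Some (enc_rows (non_nbr a unv), c3)"
    using fn_non_nbr[OF _ la assms(5)] 3(2) by auto
  have lu: "length unv \<le> S" using 3(3) by simp
  have c23: "c2 \<le> 80 * Q + 80 * S" "c3 \<le> 80 * Q + 80 * S"
    using c2(1) c3(1) mult_le_mono2[OF lu, of S] assms(6) unfolding mult_Suc_right by linarith+
  have len: "length (nbr a unv) + length (non_nbr a unv) = length unv" by (rule length_nbr)
  have "set (nbr a unv) \<subseteq> set unv" "set (non_nbr a unv) \<subseteq> set unv"
    by (auto simp: nbr_def non_nbr_def)
  then have "\<forall>u\<in>set (nbr a unv @ st) \<union> set (non_nbr a unv). row_ok N S u" using 3(2) by auto
  moreover have "length (nbr a unv @ st) + length (non_nbr a unv) \<le> S" using 3(3) len by simp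
  ultimately obtain c4 where
    c4: "c4 \<le> 800 * Q * Suc (2 * length (non_nbr a unv) + length (nbr a unv @ st))"
    "call i_dfs (VCons (enc_vertices inp) (VCons (enc_rows (nbr a unv @ st))
      (enc_rows (non_nbr a unv))))
      = Some (enc_rows (dfs (\<lambda>i. fst (inp ! i)) (nbr a unv @ st) (non_nbr a unv)), c4)"
    using 3(1) by (auto simp: a_def v(1))
  have le: "2 * length (non_nbr a unv) + length (nbr a unv @ st) \<le> 2 * length unv + length st"
    using len by simp
  have c4': "c4 \<le> 800 * Q * Suc (2 * length unv + length st)"
    using c4(1) mult_le_mono2[of _ _ "800 * Q"] le by (meson Suc_le_mono le_trans)
  obtain c5 where c5: "c5 \<le> 20 * Suc (length (nbr a unv))"
    "call i_app (VCons (enc_rows (nbr a unv)) (enc_rows st)) = Some (enc_rows (nbr a unv @ st), c5)"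
    using fn_app by blast
  obtain c6 where c6: "c6 \<le> 20 * Suc (length (nbr a unv))"
    "call i_app (VCons (enc_rows (nbr a unv)) (enc_rows
      (dfs (\<lambda>i. fst (inp ! i)) (nbr a unv @ st) (non_nbr a unv))))
      = Some (enc_rows (nbr a unv @ dfs (\<lambda>i. fst (inp ! i)) (nbr a unv @ st) (non_nbr a unv)), c6)"
    using fn_app by blast
  have "length (nbr a unv) \<le> S" using len lu by simp
  then show ?case
    using v(2-4) c1 c2(2) c3(2) c23 c4(2) c4' c5 c6 SS assms(5)
    by (subst fn_bodies(9)) (simp add: dfs_body_def v(1) enc_vertex_def a_def algebra_simps)
qed

end

section \<open>Shape of the keys under reordering and branching\<close>

lemma mset_select: "select a d rows acc vs \<noteq> [] \<Longrightarrow> mset (select a d rows acc vs) =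
  mset acc + mset vs"
  by (induction vs arbitrary: acc) (auto split: if_splits)

lemma mset_nbr: "mset (nbr a unv) + mset (non_nbr a unv) = mset unv"
  by (simp add: nbr_def non_nbr_def mset_filter)

lemma mset_dfs: "mset (dfs a st unv) = mset unv"
proof (induction a st unv rule: dfs.induct)
  case (3 a v st unv)
  then show ?case by (simp add: mset_nbr)
qed auto

text \<open>Normalising touches only the phase and the order of the rows. The cost analysis needs to
  know nothing else about it.\<close>

lemma normalise_eq:
  assumes "e \<noteq> []"
  obtains e' rows' where "normalise a d (e # rows) = e' # rows'" "e' \<noteq> []" "tl e' = tl e"
    "mset rows' = mset rows"
proof (cases "hd e = 0")
  case False
  then show ?thesis using that[of e rows] assms by (simp add: normalise_def)
next
  case True
  show ?thesis
  proof (cases "select a d rows [] rows = []")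
    case False
    with True show ?thesis
      using that[of "if tl (select a d rows [] rows) = [] then 1 # tl e else e"
        "select a d rows [] rows"] assms
      by (simp add: normalise_def Let_def mset_select)
  next
    case sel: True
    show ?thesis using that[of "1 # tl e" "dfs a [] rows"] True sel assms
      by (simp add: normalise_def Let_def mset_dfs)
  qed
qed

lemma length_branch: "length (branch a e rest c l ws ah i) \<le> length l"
  by (induction l arbitrary: ws ah i) (auto intro: le_SucI)

text \<open>\<open>m\<close> is the number of uncoloured vertices. Header and rows have the same
  length: phase and \<open>k\<close> exponents, or index and \<open>k\<close> list entries. Only the
  shape matters for the running time.\<close>

definition key_ok :: "nat \<Rightarrow> nat \<Rightarrow> nat \<Rightarrow> nat list list \<Rightarrow> bool" where
  "key_ok N k m key \<longleftrightarrow> (\<exists>e rows. key = e # rows \<and> length e = Suc k \<and> length rows = m \<and>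
    (\<forall>u\<in>set rows. length u = Suc k \<and> hd u < N))"

lemma branch_key_ok:
  assumes "length e = Suc k" "length rest = m" "\<forall>u\<in>set rest. length u = Suc k \<and> hd u < N"
    and "\<forall>b\<in>set ah. length b = k" "length l \<le> length ah"
    and "(key, c') \<in> set (branch a e rest c l ws ah i)"
  shows "key_ok N k m key"
  using assms(4-6)
proof (induction l arbitrary: ws ah i)
  case (Cons x l)
  then obtain b ah' where ah: "ah = b # ah'" by (cases ah) auto
  have upd: "key_ok N k m (bump i e # update a b rest)"
    using Cons.prems(1) assms(1-3) by (auto simp: key_ok_def bump_def update_def restrict_row_def
      ah)
  show ?case
  proof (cases "(key, c') \<in> set (branch a e rest c l (tl ws) (tl ah) (Suc i))")
    case True
    then show ?thesis using Cons.IH[of "tl ah" "tl ws" "Suc i"] Cons.prems by (auto simp: ah)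
  next
    case False
    with Cons.prems(3) have "key = bump i e # update a b rest"
      by (auto simp: ah split: if_splits)
    with upd show ?thesis by simp
  qed
qed simp

lemma expand_key_ok:
  assumes "key_ok N k (Suc m) key" "\<forall>b\<in>set ah. length b = k" "length ah = k"
    and "(key', c') \<in> set (expand inp ah d (key, c))"
  shows "key_ok N k m key'"
proof -
  obtain e rows where key: "key = e # rows" "length e = Suc k" "length rows = Suc m"
    "\<forall>u\<in>set rows. length u = Suc k \<and> hd u < N" using assms(1) by (auto simp: key_ok_def)
  define a where "a = (\<lambda>i. fst (inp ! i))"
  obtain e' rows' where n: "normalise a d (e # rows) = e' # rows'" "e' \<noteq> []" "tl e' = tl e"
    "mset rows' = mset rows" using normalise_eq[of e a d rows] key(2)
      by (metis list.size(3) nat.distinct(1))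
  have s: "set rows' = set rows" "length rows' = length rows"
    using mset_eq_setD[OF n(4)] mset_eq_length[OF n(4)] by simp_all
  then obtain v rest where r: "rows' = v # rest" using key(3) by (cases rows') auto
  have le: "length e' = Suc k" using n(2,3) key(2) by (cases e; cases e') auto
  have vr: "v \<in> set rows" "\<forall>u\<in>set rest. u \<in> set rows" using s r by auto
  then have v: "length v = Suc k" and rest: "\<forall>u\<in>set rest. length u = Suc k \<and> hd u < N"
    using key(4) by auto
  have "(key', c') \<in> set (branch (a (hd v)) e' rest c (tl v) (snd (snd (inp ! hd v))) ah 1)"
    using assms(4) n(1) by (simp add: expand_def key(1) r Let_def flip: a_def) (simp add: a_def)
  then show ?thesis
    using branch_key_ok[OF le, of rest m N ah "tl v"] assms(2,3) key(3) s(2) r v rest by auto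
qed

lemma length_expand:
  assumes "key_ok N k (Suc m) key"
  shows "length (expand inp ah d (key, c)) \<le> k"
proof -
  obtain e rows where key: "key = e # rows" "length e = Suc k" "length rows = Suc m"
    "\<forall>u\<in>set rows. length u = Suc k \<and> hd u < N" using assms(1) by (auto simp: key_ok_def)
  define a where "a = (\<lambda>i. fst (inp ! i))"
  obtain e' rows' where n: "normalise a d (e # rows) = e' # rows'" "mset rows' = mset rows"
    using normalise_eq[of e a d rows] key(2) by (metis list.size(3) nat.distinct(1))
  have s: "set rows' = set rows" "length rows' = length rows"
    using mset_eq_setD[OF n(2)] mset_eq_length[OF n(2)] by simp_all
  then obtain v rest where r: "rows' = v # rest" using key(3) by (cases rows') auto
  have "v \<in> set rows" using s r by auto
  then have v: "length (tl v) = k" using key(4) by simp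
  have "expand inp ah d (key, c) = branch (a (hd v)) e' rest c (tl v) (snd (snd (inp ! hd v))) ah 1"
    using n(1) by (simp add: expand_def key(1) r Let_def flip: a_def) (simp add: a_def)
  then show ?thesis using length_branch v by metis
qed

context machine
begin

lemma fn_branch:
  assumes "\<forall>u\<in>set rest. row_ok N S u" "length rest \<le> S" "N \<le> length a" "length e \<le> S" "1 \<le> S"
    and Q: "S * S \<le> Q"
    and "\<forall>u\<in>set rest. \<forall>b\<in>set bs. length u \<le> Suc (length b)"
    and "length l \<le> length ws" "length l \<le> length bs" "i + length l \<le> length e"
  shows "\<exists>c' \<le> 400 * Q * Suc (length l).
    call i_branch (VCons (VCons (enc_nats a) (VCons (enc_nats e) (VCons (enc_rows rest) (VRing c))))
      (VCons (enc_nats l) (VCons (enc_rings ws) (VCons (enc_rows bs) (VNat i)))))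
    = Some (enc_table (branch a e rest c l ws bs i), c')"
  using assms(7-)
proof (induction l arbitrary: ws bs i)
  case Nil
  have "1 \<le> Q" using assms(5) Q le_square[of S] by linarith
  then show ?case by (subst fn_bodies(13)) (simp add: branch_body_def)
next
  case (Cons x l)
  have SS: "S \<le> Q" using Q le_square[of S] by linarith
  obtain w ws' where ws: "ws = w # ws'" using Cons.prems by (cases ws) auto
  obtain b bs' where bs: "bs = b # bs'" using Cons.prems by (cases bs) auto
  obtain c1 where c1: "c1 \<le> 400 * Q * Suc (length l)"
    "call i_branch
      (VCons (VCons (enc_nats a) (VCons (enc_nats e) (VCons (enc_rows rest) (VRing c))))
      (VCons (enc_nats l) (VCons (enc_rings ws') (VCons (enc_rows bs') (VNat (Suc i))))))
    = Some (enc_table (branch a e rest c l ws' bs' (Suc i)), c1)"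
    using Cons.IH[of bs' ws' "Suc i"] Cons.prems by (auto simp: ws bs)
  obtain c2 where c2: "c2 \<le> 30 * Suc i" "call i_bump (VCons (VNat i) (enc_nats e)) =
    Some (enc_nats (bump i e), c2)"
    using fn_bump[of i e] Cons.prems by auto
  obtain c3 where c3: "c3 \<le> 110 * S * Suc (length rest)"
    "call i_update (VCons (enc_nats a) (VCons (enc_nats b) (enc_rows rest))) =
      Some (enc_rows (update a b rest), c3)"
    using fn_update[of rest N S b a] assms(1,3,5) Cons.prems by (auto simp: bs)
  have c3': "c3 \<le> 110 * Q + 110 * S"
    using c3(1) mult_le_mono2[OF assms(2), of S] Q unfolding mult_Suc_right by linarith
  have "Suc i \<le> S" using Cons.prems assms(4) by simp
  then show ?case using c1 c2 c3(2) c3' SS assms(5)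
    by (subst fn_bodies(13)) (cases "x = 0"; simp add: branch_body_def ws bs algebra_simps)
qed

lemma fn_normalise:
  assumes "\<forall>u\<in>set rows. row_ok N S u" "length rows \<le> S" "e \<noteq> []"
    and "\<forall>x\<in>set inp. N \<le> length (fst x)" "N \<le> length inp" "1 \<le> S" and R: "S * S * S \<le> R"
  shows "\<exists>c \<le> 4000 * R.
    call i_normalise (VCons (enc_vertices inp) (VCons (VNat d) (enc_rows (e # rows))))
    = Some (enc_rows (normalise (\<lambda>i. fst (inp ! i)) d (e # rows)), c)"
proof -
  define a where "a = (\<lambda>i. fst (inp ! i))"
  define Q where "Q = S * S"
  have SS: "S \<le> Q" "Q \<le> R" "Q * S \<le> R"
    using R mult_le_mono2[OF assms(6), of "S * S"] le_square[of S] unfolding Q_def mult_1_right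
    by linarith+
  obtain p e' where e: "e = p # e'" using assms(3) by (cases e) auto
  obtain c1 where c1: "c1 \<le> 400 * Q * Suc (length rows)"
    "call i_select (VCons (enc_vertices inp) (VCons (VNat d) (VCons (enc_rows rows)
      (VCons VNil (enc_rows rows))))) = Some (enc_rows (select a d rows [] rows), c1)"
    using fn_select[of rows rows N S "[]" inp Q d] assms by (auto simp: a_def Q_def)
  obtain c2 where c2: "c2 \<le> 800 * Q * Suc (2 * length rows)"
    "call i_dfs (VCons (enc_vertices inp) (VCons VNil (enc_rows rows)))
      = Some (enc_rows (dfs a [] rows), c2)"
    using fn_dfs[of "[]" rows N S inp Q] assms by (auto simp: a_def Q_def)
  have b: "c1 \<le> 400 * R + 400 * Q" "c2 \<le> 1600 * R + 800 * Q"
    using c1(1) c2(1) mult_le_mono2[OF assms(2), of Q] SS(3) unfolding mult_Suc_right by linarith+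
  show ?thesis
  proof (cases "select a d rows [] rows")
    case Nil
    with c1(2) c2(2) b SS assms(6) show ?thesis
      by (subst fn_bodies(14)) (simp add: normalise_body_def normalise_def e flip: a_def)
  next
    case (Cons v vs)
    with c1(2) c2(2) b SS assms(6) show ?thesis
      by (subst fn_bodies(14)) (cases vs; simp add: normalise_body_def normalise_def e Let_def
        flip: a_def)
  qed
qed

lemma run_literal: "exec env (literal xs) = Some (enc_nats xs, Suc (2 * length xs))"
  by (induction xs) auto

lemma run_literals:
  "\<forall>x\<in>set xs. length x \<le> S \<Longrightarrow> \<exists>c \<le> (2 * S + 2) * length xs + 1. exec env (literals xs) =
    Some (enc_rows xs, c)"
proof (induction xs)
  case (Cons x xs)
  then obtain c where "c \<le> (2 * S + 2) * length xs + 1"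
    "exec env (literals xs) = Some (enc_rows xs, c)"
    by auto
  then show ?case using Cons.prems by (simp add: run_literal)
qed auto

lemma fn_expand:
  assumes key: "key_ok N k (Suc m) key" and ah: "length ah = k" "\<forall>b\<in>set ah. length b = k"
    and S: "Suc N \<le> S" "Suc k \<le> S" "Suc m \<le> S"
    and inp: "length inp = N" "\<forall>x\<in>set inp. length (fst x) = N \<and> length (snd (snd x)) = k"
    and R: "S * S * S \<le> R"
  shows "\<exists>c' \<le> 6000 * R.
    call i_expand (VCons (enc_vertices inp) (VCons (VNat d) (VCons (enc_rows key) (VRing c))))
    = Some (enc_table (expand inp ah d (key, c)), c')"
proof -
  obtain e rows where key: "key = e # rows" "length e = Suc k" "length rows = Suc m"
    "\<forall>u\<in>set rows. length u = Suc k \<and> hd u < N" using assms(1) by (auto simp: key_ok_def)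
  have S1: "1 \<le> S" using S by simp
  define Q where "Q = S * S"
  have SS: "S \<le> Q" "Q \<le> R" "Q * S \<le> R"
    using R mult_le_mono2[OF S1, of "S * S"] le_square[of S] unfolding Q_def mult_1_right
    by linarith+
  have rok: "\<forall>u\<in>set rows. row_ok N S u" using key(4) S by (auto simp: row_ok_def)
  define a where "a = (\<lambda>i. fst (inp ! i))"
  obtain e' rows' where n: "normalise a d (e # rows) = e' # rows'" "e' \<noteq> []" "tl e' = tl e"
    "mset rows' = mset rows" using normalise_eq[of e a d rows] key(2)
      by (metis list.size(3) nat.distinct(1))
  have s: "set rows' = set rows" "length rows' = length rows"
    using mset_eq_setD[OF n(4)] mset_eq_length[OF n(4)] by simp_all
  then obtain v rest where r: "rows' = v # rest" using key(3) by (cases rows') auto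
  have le: "length e' = Suc k" using n(2,3) key(2) by (cases e; cases e') auto
  have vr: "v \<in> set rows" "set rest \<subseteq> set rows" "length rest = m" using s r key(3) by auto
  obtain h l where v: "v = h # l" "h < N" "length l = k" using key(4) vr(1) by (cases v) auto
  have h: "length (a h) = N" "length (snd (snd (inp ! h))) = k" using v inp by (auto simp: a_def)
  have "e \<noteq> []" using key(2) by auto
  then obtain c1 where c1: "c1 \<le> 4000 * R"
    "call i_normalise (VCons (enc_vertices inp) (VCons (VNat d) (enc_rows (e # rows))))
    = Some (enc_rows (normalise a d (e # rows)), c1)"
    using fn_normalise[OF rok, of e inp R d] key(3) S inp R by (auto simp: a_def)
  obtain c2 where c2: "c2 \<le> 20 * Suc h"
    "call i_nth (VCons (VNat h) (enc_vertices inp)) = Some (enc_vertex (inp ! h), c2)"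
    using fn_nth[of h "map enc_vertex inp"] v(2) inp(1) by auto
  obtain c3 where c3: "c3 \<le> 400 * Q * Suc (length l)"
    "call i_branch
      (VCons (VCons (enc_nats (a h)) (VCons (enc_nats e') (VCons (enc_rows rest) (VRing c))))
      (VCons (enc_nats l) (VCons (enc_rings (snd (snd (inp ! h)))) (VCons (enc_rows ah) (VNat 1)))))
    = Some (enc_table (branch (a h) e' rest c l (snd (snd (inp ! h))) ah 1), c3)"
  proof -
    have "\<forall>u\<in>set rest. \<forall>b\<in>set ah. length u \<le> Suc (length b)" using vr(2) key(4) ah(2) by auto
    then show ?thesis
      using that fn_branch[of rest N S "a h" e' Q ah l "snd (snd (inp ! h))" 1 c] rok vr h le v S ah
      by (auto simp: subset_iff Q_def)
  qed
  have c3': "c3 \<le> 400 * R"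
    using c3(1) mult_le_mono2[OF S(2), of Q] SS(3) v(3) by simp
  \<comment> \<open>The literals contain no variables, so one cost serves every environment, in
    particular the one built by the two \<open>LetIn\<close>.\<close>
  obtain c4 where c4: "c4 \<le> (2 * S + 2) * length ah + 1"
    "\<And>env. exec env (literals ah) = Some (enc_rows ah, c4)"
  proof -
    have "exec env (literals ah) = exec [] (literals ah)" for env :: "'r val list"
    proof -
      have "exec env (literals xs) = exec [] (literals xs)" for xs
        by (induction xs) (auto simp: run_literal)
      then show ?thesis .
    qed
    then show ?thesis using that run_literals[of ah S "[]"] ah S by (metis Suc_leD)
  qed
  have "c4 \<le> 4 * Q + 1"
    using c4(1) S(2) mult_le_mono2[OF Suc_leD[OF S(2)], of S] SS(1)
      unfolding Q_def add_mult_distrib ah(1)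
    by linarith
  moreover have "h < S" using v S by simp
  ultimately show ?thesis using c1 c2 c3(2) c3' c4(2) SS S1
    by (subst fn_bodies(15)) (simp add: expand_body_def expand_def key(1) n(1) r v(1) Let_def
      enc_vertex_def flip: a_def,
      simp add: a_def)
qed

lemma fn_insert:
  assumes "\<forall>x\<in>set (fst e). length x \<le> S" "length (fst e) \<le> S" "1 \<le> S" and Q: "S * S \<le> Q"
  shows "\<exists>c \<le> 300 * Q * Suc (length tab).
    call i_insert (VCons (VCons (enc_rows (fst e)) (VRing (snd e))) (enc_table tab)) = Some
      (enc_table (insert_entry e tab), c)"
proof (induction tab)
  case Nil
  have "1 \<le> Q" using assms(3) Q le_square[of S] by linarith
  then show ?case by (subst fn_bodies(18)) (simp add: insert_body_def)
next
  case (Cons f tab)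
  then obtain c where c: "c \<le> 300 * Q * Suc (length tab)"
    "call i_insert (VCons (VCons (enc_rows (fst e)) (VRing (snd e))) (enc_table tab)) =
      Some (enc_table (insert_entry e tab), c)"
    by blast
  obtain c1 m where c1: "c1 \<le> 120 * S * Suc (length (fst e))"
    "call i_eqs (VCons (enc_rows (fst e)) (enc_rows (fst f))) = Some (VNat m, c1)"
      "m = 0 \<longleftrightarrow> fst e = fst f"
    using fn_eqs[OF assms(1,3)] by blast
  have "c1 \<le> 120 * Q + 120 * S"
    using c1(1) mult_le_mono2[OF assms(2), of S] Q unfolding mult_Suc_right by linarith
  moreover have "S \<le> Q" using Q le_square[of S] by linarith
  ultimately show ?case using c c1(2,3) assms(3)
    by (subst fn_bodies(18)) (cases "m = 0"; simp add: insert_body_def algebra_simps)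
qed

lemma length_insert_entry: "length (insert_entry e tab) \<le> Suc (length tab)"
  by (induction tab) auto

lemma length_insert_all: "length (insert_all es tab) \<le> length es + length tab"
proof (induction es)
  case (Cons e es)
  then show ?case using length_insert_entry[of e "insert_all es tab"] by (simp add: insert_all_def)
qed (simp add: insert_all_def)

lemma fn_insert_all:
  assumes "\<forall>e\<in>set es. (\<forall>x\<in>set (fst e). length x \<le> S) \<and> length (fst e) \<le> S"
    and "1 \<le> S" "S * S \<le> Q" "length es + length tab \<le> M"
  shows "\<exists>c \<le> 400 * Q * (M + 1) * Suc (length es).
    call i_insert_all (VCons (enc_table es) (enc_table tab)) = Some
      (enc_table (insert_all es tab), c)"
  using assms(1,4)
proof (induction es)
  case Nil
  have "1 * 1 \<le> Q * (M + 1)" using assms(2,3) le_square[of S] by (intro mult_le_mono) linarith+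
  then show ?case by (subst fn_bodies(19)) (simp add: insert_all_body_def insert_all_def)
next
  case (Cons e es)
  define T where "T = Q * (M + 1)"
  have T: "1 * 1 \<le> T" unfolding T_def using assms(2,3) le_square[of S]
    by (intro mult_le_mono) linarith+
  from Cons obtain c where c: "c \<le> 400 * T * Suc (length es)"
    "call i_insert_all (VCons (enc_table es) (enc_table tab)) =
      Some (enc_table (insert_all es tab), c)"
    by (auto simp: T_def mult.assoc)
  obtain c1 where c1: "c1 \<le> 300 * Q * Suc (length (insert_all es tab))"
    "call i_insert (VCons (VCons (enc_rows (fst e)) (VRing (snd e)))
      (enc_table (insert_all es tab)))
      = Some (enc_table (insert_entry e (insert_all es tab)), c1)"
    using fn_insert[OF _ _ assms(2,3), of e "insert_all es tab"] Cons.prems(1)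
      by (meson list.set_intros(1))
  have "Suc (length (insert_all es tab)) \<le> M + 1"
    using length_insert_all[of es tab] Cons.prems by simp
  from c1(1) mult_le_mono2[OF this, of Q] have "c1 \<le> 300 * T" unfolding T_def by linarith
  then have "\<exists>c \<le> 400 * T * Suc (length (e # es)).
    call i_insert_all (VCons (enc_table (e # es)) (enc_table tab)) = Some
      (enc_table (insert_all (e # es) tab), c)"
    using c c1(2) T
    by (subst fn_bodies(19)) (simp add: insert_all_body_def insert_all_def algebra_simps)
  then show ?case by (simp only: T_def mult.assoc)
qed

text \<open>\<open>foldr\<close> builds the new table from the right, so the intermediate tables are
  the steps of the suffixes of \<open>tab\<close>, and \<open>M\<close> has to bound these as well.
  While one expansion is inserted, at most \<open>k\<close> more entries are present, hence
  \<open>M + S\<close>.\<close>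

lemma fn_step:
  assumes tab: "\<forall>e\<in>set tab. key_ok N k (Suc m) (fst e)"
    and ah: "length ah = k" "\<forall>b\<in>set ah. length b = k"
    and S: "Suc N \<le> S" "Suc k \<le> S" "Suc m \<le> S"
    and inp: "length inp = N" "\<forall>x\<in>set inp. length (fst x) = N \<and> length (snd (snd x)) = k"
    and M: "\<And>tab1 tab2. tab = tab1 @ tab2 \<Longrightarrow> length (step inp ah d tab2) \<le> M"
    and R: "S * S * S \<le> R"
  shows "\<exists>c' \<le> 7000 * (R * (M + S + 1)) * Suc (length tab).
    call i_step (VCons (enc_vertices inp) (VCons (VNat d) (enc_table tab)))
    = Some (enc_table (step inp ah d tab), c')"
  using tab M
proof (induction tab)
  case Nil
  have "1 * 1 * 1 \<le> S * S * S" using S by (intro mult_le_mono) auto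
  then have "1 * 1 \<le> R * (M + S + 1)" using R by (intro mult_le_mono) linarith+
  then show ?case by (subst fn_bodies(20)) (simp add: step_body_def step_def)
next
  case (Cons e tab)
  define Q where "Q = S * S"
  define T where "T = R * (M + S + 1)"
  have S1: "1 \<le> S" using S by simp
  have "1 * 1 * 1 \<le> S * S * S" using S1 by (intro mult_le_mono) auto
  then have R1: "1 \<le> R" "Q * S \<le> R" using R unfolding Q_def by linarith+
  have T: "1 * 1 \<le> T" unfolding T_def using R1(1) by (intro mult_le_mono) linarith+
  have RT: "R * 1 \<le> T" unfolding T_def by (intro mult_le_mono) linarith+
  obtain c where c: "c \<le> 7000 * T * Suc (length tab)"
    "call i_step (VCons (enc_vertices inp) (VCons (VNat d) (enc_table tab)))
    = Some (enc_table (step inp ah d tab), c)"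
    using Cons.IH Cons.prems(1) Cons.prems(2)[of "e # _"] unfolding T_def by auto
  obtain c1 where c1: "c1 \<le> 6000 * R"
    "call i_expand (VCons (enc_vertices inp) (VCons (VNat d)
      (VCons (enc_rows (fst e)) (VRing (snd e)))))
    = Some (enc_table (expand inp ah d (fst e, snd e)), c1)"
    using fn_expand[OF _ ah S inp R, of "fst e" d "snd e"] Cons.prems(1) by auto
  define es where "es = expand inp ah d e"
  have les: "length es \<le> k"
    using length_expand[of N k m "fst e" inp ah d "snd e"] Cons.prems(1) by (simp add: es_def)
  have eok: "(\<forall>x\<in>set (fst f). length x \<le> S) \<and> length (fst f) \<le> S" if "f \<in> set es" for f
  proof -
    have "key_ok N k m (fst f)"
      using expand_key_ok[of N k m "fst e" ah "fst f" "snd f" inp d "snd e"] Cons.prems(1) ah that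
      by (simp add: es_def)
    then show ?thesis using S by (auto simp: key_ok_def)
  qed
  have lt: "length (step inp ah d tab) \<le> M" using Cons.prems(2)[of "[e]" tab] by simp
  obtain c2 where c2: "c2 \<le> 400 * Q * (M + S + 1) * Suc (length es)"
    "call i_insert_all (VCons (enc_table es) (enc_table (step inp ah d tab)))
      = Some (enc_table (insert_all es (step inp ah d tab)), c2)"
    using fn_insert_all[of es S Q "step inp ah d tab" "M + S"] eok S1 les lt S by (auto simp: Q_def)
  have "Q * (M + S + 1) * Suc (length es) \<le> Q * (M + S + 1) * S"
    using les S(2) by (intro mult_le_mono) linarith+
  also have "\<dots> = Q * S * (M + S + 1)" by (simp only: mult_ac)
  also have "\<dots> \<le> T" unfolding T_def using R1(2) by (intro mult_le_mono) linarith+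
  finally have "c2 \<le> 400 * T" using c2(1) unfolding mult.assoc by linarith
  then have "\<exists>c' \<le> 7000 * T * Suc (length (e # tab)).
    call i_step (VCons (enc_vertices inp) (VCons (VNat d) (enc_table (e # tab))))
    = Some (enc_table (step inp ah d (e # tab)), c')"
    using c c1 c2(2) T RT
    by (subst fn_bodies(20)) (simp add: step_body_def step_def es_def algebra_simps)
  then show ?case by (simp only: T_def)
qed

end

section \<open>Keys of the table, initial data and the degree parameter\<close>

lemma keys_insert_entry: "fst ` set (insert_entry e tab) = insert (fst e) (fst ` set tab)"
  by (induction tab) auto

lemma distinct_insert_entry: "distinct (map fst tab) \<Longrightarrow> distinct (map fst (insert_entry e tab))"
proof (induction tab)
  case (Cons f tab)
  have "fst f \<notin> fst ` set (insert_entry e tab)" if "fst e \<noteq> fst f"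
    using Cons.prems that by (auto simp: keys_insert_entry)
  with Cons show ?case by auto
qed auto

lemma keys_insert_all: "fst ` set (insert_all es tab) = fst ` set es \<union> fst ` set tab"
  by (induction es) (auto simp: insert_all_def keys_insert_entry)

lemma distinct_insert_all: "distinct (map fst tab) \<Longrightarrow> distinct (map fst (insert_all es tab))"
  by (induction es) (auto simp: insert_all_def distinct_insert_entry)

lemma keys_step: "fst ` set (step inp ah d tab) = (\<Union>e\<in>set tab. fst ` set (expand inp ah d e))"
  by (induction tab) (auto simp: step_def keys_insert_all image_iff)

lemma distinct_step: "distinct (map fst (step inp ah d tab))"
  by (induction tab) (auto simp: step_def distinct_insert_all)

definition final_terms :: "'r entry list \<Rightarrow> (nat list \<times> 'r) list" where
  "final_terms tab = map (\<lambda>e. (tl (hd (fst e)), snd e)) tab"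

fun init_rows :: "nat \<Rightarrow> 'r vertex_data list \<Rightarrow> nat list list" where
  "init_rows i [] = []"
| "init_rows i (x # inp) = (i # fst (snd x)) # init_rows (Suc i) inp"

definition init_table :: "nat \<Rightarrow> 'r::comm_ring_1 vertex_data list \<Rightarrow> 'r entry list" where
  "init_table k inp = [(replicate (Suc k) 0 # init_rows 0 inp, 1)]"

definition ceil_log :: "nat \<Rightarrow> nat" where
  "ceil_log n = (LEAST j. n \<le> 2 ^ j)"

text \<open>Roughly \<open>sqrt (n * log n / t)\<close>, which balances the two phases.\<close>

definition degree_bound :: "nat \<Rightarrow> nat \<Rightarrow> nat" where
  "degree_bound t n = (LEAST d. 1 \<le> d \<and> n * Suc (ceil_log n) \<le> d * d * t)"

lemma ceil_log_le: "ceil_log n \<le> n"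
  unfolding ceil_log_def by (rule Least_le) (simp add: less_imp_le)

text \<open>\<open>Suc n\<close> meets the defining condition because
  \<open>ceil_log n \<le> n\<close>, so the least value exists. The second fact later bounds
  \<open>n / d\<close>; the third, which is minimality, bounds \<open>t * d\<close>.\<close>

lemma degree_bound_props:
  assumes "1 \<le> t"
  shows "1 \<le> degree_bound t n" "n * Suc (ceil_log n) \<le> degree_bound t n * degree_bound t n * t"
    "1 \<le> d \<Longrightarrow> d < degree_bound t n \<Longrightarrow> d * d * t < n * Suc (ceil_log n)"
    "degree_bound t n \<le> Suc n"
proof -
  have "n * Suc (ceil_log n) \<le> Suc n * Suc n" by (intro mult_le_mono) (auto simp: ceil_log_le)
  also have "\<dots> * 1 \<le> Suc n * Suc n * t" using assms by (rule mult_le_mono2)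
  finally have ex: "1 \<le> Suc n \<and> n * Suc (ceil_log n) \<le> Suc n * Suc n * t" by simp
  from LeastI[where P = "\<lambda>d. 1 \<le> d \<and> n * Suc (ceil_log n) \<le> d * d * t", OF ex]
  show "1 \<le> degree_bound t n" "n * Suc (ceil_log n) \<le> degree_bound t n * degree_bound t n * t"
    by (simp_all add: degree_bound_def)
  from Least_le[where P = "\<lambda>d. 1 \<le> d \<and> n * Suc (ceil_log n) \<le> d * d * t", OF ex]
  show "degree_bound t n \<le> Suc n" by (simp add: degree_bound_def)
  show "d * d * t < n * Suc (ceil_log n)" if "1 \<le> d" "d < degree_bound t n"
    using not_less_Least[of d "\<lambda>d. 1 \<le> d \<and> n * Suc (ceil_log n) \<le> d * d * t"] that
    by (simp add: degree_bound_def)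
qed

context machine
begin

text \<open>\<open>K j\<close> is any family of sets containing the keys after \<open>j\<close>
  steps; keeping it abstract separates the machine from the combinatorial estimate of
  \<open>M\<close>. As the keys of a table are distinct, \<open>card (K j)\<close> bounds its
  length.\<close>

lemma fn_iterate:
  assumes K: "\<forall>j<N. \<forall>key\<in>K j. \<forall>c key' c'. (key', c') \<in> set (expand inp ah d (key, c)) \<longrightarrow> key' \<in> K
    (Suc j)"
    and Kfin: "\<And>j. finite (K j)" "\<And>j. card (K j) \<le> M"
    and Kok: "\<And>j key. j \<le> N \<Longrightarrow> key \<in> K j \<Longrightarrow> key_ok N k (N - j) key"
    and ah: "length ah = k" "\<forall>b\<in>set ah. length b = k"
    and S: "Suc N \<le> S" "Suc k \<le> S"
    and inp: "length inp = N" "\<forall>x\<in>set inp. length (fst x) = N \<and> length (snd (snd x)) = k"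
    and R: "S * S * S \<le> R"
  shows "fst ` set tab \<subseteq> K j \<Longrightarrow> distinct (map fst tab) \<Longrightarrow> j + length xs = N \<Longrightarrow>
    \<exists>c' \<le> 8000 * (R * (M + S + 1) * Suc M) * Suc (length xs).
    call i_iterate (VCons (enc_list xs) (VCons (enc_vertices inp) (VCons (VNat d) (enc_table tab))))
    = Some (enc_table ((step inp ah d ^^ length xs) tab), c')"
proof (induction xs arbitrary: j tab)
  case Nil
  have "1 * 1 * 1 \<le> S * S * S" using S by (intro mult_le_mono) auto
  then have "1 * 1 * 1 \<le> R * (M + S + 1) * Suc M" using R by (intro mult_le_mono) linarith+
  then show ?case by (subst fn_bodies(21)) (simp add: iterate_body_def)
next
  case (Cons x xs)
  have len: "length tab' \<le> M" if "fst ` set tab' \<subseteq> K i" "distinct (map fst tab')" for tab' ::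
    "'r entry list" and i
  proof -
    have "length tab' = card (fst ` set tab')" using distinct_card[OF that(2)] by simp
    also have "\<dots> \<le> card (K i)" using that(1) Kfin(1) by (rule card_mono[rotated])
    finally show ?thesis using Kfin(2)[of i] by linarith
  qed
  have sub: "fst ` set (step inp ah d tab') \<subseteq> K (Suc j)" if "set tab' \<subseteq> set tab" for tab'
    using that Cons.prems(1,3) K[rule_format, of j] unfolding keys_step by fastforce
  define W where "W = R * (M + S + 1) * Suc M"
  have "1 * 1 * 1 \<le> S * S * S" using S by (intro mult_le_mono) auto
  then have W: "1 * 1 * 1 \<le> W" unfolding W_def using R by (intro mult_le_mono) linarith+
  obtain c where c: "c \<le> 8000 * W * Suc (length xs)"
    "call i_iterate (VCons (enc_list xs) (VCons (enc_vertices inp) (VCons (VNat d)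
      (enc_table (step inp ah d tab)))))
    = Some (enc_table ((step inp ah d ^^ length xs) (step inp ah d tab)), c)"
    using Cons.IH[OF sub[OF subset_refl] distinct_step] Cons.prems(3) unfolding W_def by auto
  have m: "N - j = Suc (length xs)" using Cons.prems(3) by simp
  have tabok: "\<forall>e\<in>set tab. key_ok N k (Suc (length xs)) (fst e)"
    using Kok[of j] Cons.prems(1,3) unfolding m[symmetric] by auto
  have "length (step inp ah d tab2) \<le> M" if "tab = tab1 @ tab2" for tab1 tab2
    using len[OF sub distinct_step, of tab2] that by auto
  then obtain c1 where c1: "c1 \<le> 7000 * (R * (M + S + 1)) * Suc (length tab)"
    "call i_step (VCons (enc_vertices inp) (VCons (VNat d) (enc_table tab)))
    = Some (enc_table (step inp ah d tab), c1)"
    using fn_step[OF tabok ah S _ inp _ R, of d M] Cons.prems(3) S(1) by auto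
  have "R * (M + S + 1) * Suc (length tab) \<le> W"
    unfolding W_def using len[OF Cons.prems(1,2)] by (intro mult_le_mono2) simp
  then have "c1 \<le> 7000 * W" using c1(1) unfolding mult.assoc by linarith
  then have "\<exists>c' \<le> 8000 * W * Suc (length (x # xs)).
    call i_iterate (VCons (enc_list (x # xs)) (VCons (enc_vertices inp)
      (VCons (VNat d) (enc_table tab))))
    = Some (enc_table ((step inp ah d ^^ length (x # xs)) tab), c')"
    using c c1(2) W
    by (subst fn_bodies(21)) (simp add: iterate_body_def funpow_swap1 algebra_simps)
  then show ?case unfolding W_def .
qed

lemma fn_output:
  assumes "\<forall>e\<in>set tab. \<exists>e' key. fst e = e' # key \<and> e' \<noteq> []"
  shows "\<exists>c \<le> 30 * Suc (length tab). call i_output (enc_table tab) =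
    Some (enc_list (map (\<lambda>(m, c). VCons (enc_nats m) (VRing c)) (final_terms tab)), c)"
  using assms
proof (induction tab)
  case Nil
  then show ?case by (simp add: fn_bodies(22) output_body_def final_terms_def)
next
  case (Cons e tab)
  then obtain c where c: "c \<le> 30 * Suc (length tab)" "call i_output (enc_table tab) =
    Some (enc_list (map (\<lambda>(m, c). VCons (enc_nats m) (VRing c)) (final_terms tab)), c)" by auto
  from Cons.prems obtain p e' key where e: "fst e = (p # e') # key"
    by (metis list.set_intros(1) neq_Nil_conv)
  from c show ?case
    by (subst fn_bodies(22)) (simp add: output_body_def final_terms_def e)
qed

lemma fn_init:
  "\<exists>c \<le> 30 * Suc (length inp). call i_init (VCons (VNat i) (enc_vertices inp)) =
    Some (enc_rows (init_rows i inp), c)"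
proof (induction inp arbitrary: i)
  case Nil
  then show ?case by (simp add: fn_bodies(23) init_body_def)
next
  case (Cons x inp)
  then obtain c where "c \<le> 30 * Suc (length inp)"
    "call i_init (VCons (VNat (Suc i)) (enc_vertices inp)) =
      Some (enc_rows (init_rows (Suc i) inp), c)"
    by blast
  then show ?case by (subst fn_bodies(23)) (simp add: init_body_def enc_vertex_def)
qed

lemma fn_log:
  "n \<le> p * 2 ^ j \<Longrightarrow> \<forall>j'<j. p * 2 ^ j' < n \<Longrightarrow>
    \<exists>c \<le> 40 * Suc j. call i_log (VCons (VNat p) (VCons (VNat i) (VNat n))) = Some (VNat (i + j), c)"
proof (induction j arbitrary: p i)
  case 0
  then show ?case by (subst fn_bodies(24)) (simp add: log_body_def)
next
  case (Suc j)
  have "(p + p) * 2 ^ j' < n" if "j' < j" for j'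
    using Suc.prems(2)[rule_format, of "Suc j'"] that by (simp add: algebra_simps)
  moreover have "p < n" using Suc.prems(2)[rule_format, of 0] by simp
  ultimately show ?case
    using Suc.IH[of "p + p" "Suc i"] Suc.prems(1)
    by (subst fn_bodies(24)) (auto simp: log_body_def algebra_simps)
qed

lemma fn_mult: "\<exists>c \<le> 30 * Suc a. call i_mult (VCons (VNat a) (VNat b)) = Some (VNat (a * b), c)"
proof (induction a)
  case 0
  then show ?case by (subst fn_bodies(25)) (simp add: mult_body_def)
next
  case (Suc a)
  then obtain c where "c \<le> 30 * Suc a" "call i_mult (VCons (VNat a) (VNat b)) =
    Some (VNat (a * b), c)" by blast
  then show ?case by (subst fn_bodies(25)) (simp add: mult_body_def)
qed

lemma fn_degree:
  assumes "m \<le> d * d * t" "\<forall>d'<d. 1 \<le> d' \<longrightarrow> d' * d' * t < m" "1 \<le> d"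
  shows "1 \<le> e \<Longrightarrow> e + r = d \<Longrightarrow> \<exists>c \<le> 200 * (Suc d * Suc d) * Suc r.
    call i_degree (VCons (VNat e) (VNat m)) = Some (VNat d, c)"
proof (induction r arbitrary: e)
  case 0
  obtain c1 where c1: "c1 \<le> 30 * Suc d" "call i_mult (VCons (VNat d) (VNat d)) =
    Some (VNat (d * d), c1)"
    using fn_mult by blast
  obtain c2 where c2: "c2 \<le> 30 * Suc (d * d)" "call i_mult (VCons (VNat (d * d)) (VNat t)) =
    Some (VNat (d * d * t), c2)"
    using fn_mult by blast
  from 0 c1 c2 assms(1,3) show ?case
    by (subst fn_bodies(26)) (simp add: degree_body_def algebra_simps)
next
  case (Suc r)
  obtain c where c: "c \<le> 200 * (Suc d * Suc d) * Suc r"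
    "call i_degree (VCons (VNat (Suc e)) (VNat m)) = Some (VNat d, c)"
    using Suc.IH[of "Suc e"] Suc.prems by auto
  obtain c1 where c1: "c1 \<le> 30 * Suc e" "call i_mult (VCons (VNat e) (VNat e)) =
    Some (VNat (e * e), c1)"
    using fn_mult by blast
  obtain c2 where c2: "c2 \<le> 30 * Suc (e * e)" "call i_mult (VCons (VNat (e * e)) (VNat t)) =
    Some (VNat (e * e * t), c2)"
    using fn_mult by blast
  have "e * e * t < m" "e < d" using Suc.prems assms(2) by auto
  moreover from this(2) have "e * e \<le> d * d" by (intro mult_le_mono) auto
  ultimately show ?case using c c1 c2
    by (subst fn_bodies(26)) (simp add: degree_body_def algebra_simps)
qed

text \<open>Origin of the exponents: three factors \<open>N + k + 2\<close> pay for handling one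
  entry, one absorbs the sum \<open>M + S + 1\<close> into a product with \<open>M + 1\<close>, and
  one counts the steps. One factor \<open>M + 1\<close> stands for the entries expanded in a step,
  the other for the entries scanned by an insertion.\<close>

lemma fn_main:
  assumes t: "1 \<le> t"
    and ah: "length ah = k" "\<forall>b\<in>set ah. length b = k"
    and inp: "length inp = N" "\<forall>x\<in>set inp. length (fst x) = N \<and> length (snd (snd x)) = k"
    and K: "\<forall>j<N. \<forall>key\<in>K j. \<forall>c key' c'.
      (key', c') \<in> set (expand inp ah (degree_bound t N) (key, c)) \<longrightarrow> key' \<in> K (Suc j)"
    and Kfin: "\<And>j. finite (K j)" "\<And>j. card (K j) \<le> M"
    and Kok: "\<And>j key. j \<le> N \<Longrightarrow> key \<in> K j \<Longrightarrow> key_ok N k (N - j) key"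
    and K0: "replicate (Suc k) 0 # init_rows 0 inp \<in> K 0"
  shows "\<exists>c' \<le> 10000 * ((N + k + 2) ^ 5 * (M + 1) ^ 2).
    call i_main (enc_vertices inp)
    = Some (enc_list (map (\<lambda>(m, c). VCons (enc_nats m) (VRing c))
        (final_terms ((step inp ah (degree_bound t N) ^^ N) (init_table k inp)))), c')"
proof -
  define d where "d = degree_bound t N"
  define S where "S = N + k + 2"
  define T where "T = (step inp ah d ^^ N) (init_table k inp)"
  define W where "W = S * S * S * (M + S + 1) * Suc M"
  define Z where "Z = S ^ 5 * (M + 1) ^ 2"
  have dp_keys: "fst ` set ((step inp ah d ^^ j) (init_table k inp)) \<subseteq> K j \<and>
    distinct (map fst ((step inp ah d ^^ j) (init_table k inp)))" if "j \<le> N" for j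
    using that
  proof (induction j)
    case 0
    then show ?case using K0 by (simp add: init_table_def)
  next
    case (Suc j)
    show ?case
    proof
      show "fst ` set ((step inp ah d ^^ Suc j) (init_table k inp)) \<subseteq> K (Suc j)"
      proof
        fix key' assume "key' \<in> fst ` set ((step inp ah d ^^ Suc j) (init_table k inp))"
        then obtain e c' where "e \<in> set ((step inp ah d ^^ j) (init_table k inp))"
          "(key', c') \<in> set (expand inp ah d (fst e, snd e))" by (auto simp: keys_step)
        moreover from this(1) have "fst e \<in> K j" using Suc by auto
        ultimately show "key' \<in> K (Suc j)" using K[rule_format, of j "fst e" key' c' "snd e"]
          Suc.prems
          by (simp add: d_def)
      qed
    qed (simp add: distinct_step)
  qed
  have "length T = card (set (map fst T))" using distinct_card[of "map fst T"] dp_keys[of N]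
    unfolding T_def by simp
  also have "\<dots> \<le> card (K N)" using dp_keys[of N] Kfin(1)[of N] unfolding T_def set_map
    by (intro card_mono) auto
  finally have lT: "length T \<le> M" using Kfin(2)[of N] by linarith
  have S1: "2 \<le> S" "Suc N \<le> S" "Suc k \<le> S" by (simp_all add: S_def)
  obtain c1 where c1: "c1 \<le> 10 * Suc N" "call i_len (enc_vertices inp) = Some (VNat N, c1)"
    using fn_len[of "map enc_vertex inp"] inp(1) by auto
  have log: "N \<le> 1 * 2 ^ ceil_log N" "\<forall>j'<ceil_log N. 1 * 2 ^ j' < N"
    using LeastI[where P = "\<lambda>j. N \<le> 2 ^ j", of N] not_less_Least[where P = "\<lambda>j. N \<le> 2 ^ j"]
    by (auto simp: ceil_log_def less_imp_le not_le)
  obtain c2 where c2: "c2 \<le> 40 * Suc (ceil_log N)"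
    "call i_log (VCons (VNat 1) (VCons (VNat 1) (VNat N))) = Some (VNat (1 + ceil_log N), c2)"
    using fn_log[OF log] by blast
  obtain c3 where c3: "c3 \<le> 30 * Suc N"
    "call i_mult (VCons (VNat N) (VNat (1 + ceil_log N))) = Some (VNat (N * (1 + ceil_log N)), c3)"
    using fn_mult by blast
  obtain c4 where c4: "c4 \<le> 200 * (Suc d * Suc d) * Suc (d - 1)"
    "call i_degree (VCons (VNat 1) (VNat (N * (1 + ceil_log N)))) = Some (VNat d, c4)"
  proof -
    have "\<forall>d'<d. 1 \<le> d' \<longrightarrow> d' * d' * t < N * (1 + ceil_log N)"
      using degree_bound_props(3)[OF t, where n = N] by (simp add: d_def)
    then show ?thesis
      using that fn_degree[of "N * (1 + ceil_log N)" d 1 "d - 1"]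
        degree_bound_props(1,2)[OF t, of N]
      by (auto simp: d_def)
  qed
  have d: "d \<le> Suc N" using degree_bound_props(4)[OF t] by (simp add: d_def)
  obtain c5 where c5: "c5 \<le> 30 * Suc N"
    "call i_init (VCons (VNat 0) (enc_vertices inp)) = Some (enc_rows (init_rows 0 inp), c5)"
    using fn_init[of inp 0] inp(1) by auto
  obtain c6 where c6: "c6 \<le> 8000 * W * Suc N"
    "call i_iterate (VCons (enc_vertices inp) (VCons (enc_vertices inp)
      (VCons (VNat d) (enc_table (init_table k inp))))) = Some (enc_table T, c6)"
    using fn_iterate[where K = K and M = M and d = d and xs = "map enc_vertex inp" and j = 0 and
        tab = "init_table k inp", OF K[folded d_def] Kfin Kok ah S1(2,3) inp order_refl]
      dp_keys[of 0] inp(1) unfolding W_def T_def by (simp del: funpow.simps) blast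
  have "\<forall>e\<in>set T. \<exists>e' key. fst e = e' # key \<and> e' \<noteq> []"
  proof
    fix e assume "e \<in> set T"
    then have "fst e \<in> K N" using dp_keys[of N] unfolding T_def by auto
    then show "\<exists>e' key. fst e = e' # key \<and> e' \<noteq> []" using Kok[of N "fst e"]
      by (auto simp: key_ok_def)
  qed
  then obtain c7 where c7: "c7 \<le> 30 * Suc (length T)" "call i_output (enc_table T) =
    Some (enc_list (map (\<lambda>(m, c). VCons (enc_nats m) (VRing c)) (final_terms T)), c7)"
    using fn_output by blast
  have ex: "\<exists>c'. c' \<le> c1 + c1 + c2 + c3 + c4 + c5 + c6 + c7 + 2 * k + 60 \<and>
    call i_main (enc_vertices inp) =
    Some (enc_list (map (\<lambda>(m, c). VCons (enc_nats m) (VRing c)) (final_terms T)), c')"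
    using c1(2) c2(2) c3(2) c4(2) c5(2) c6(2) c7(2)
    by (subst fn_bodies(1)) (simp add: main_body_def run_literal ah(1) init_table_def del:
      replicate_Suc literal.simps)
  have Z1: "S * S * S \<le> Z" "M \<le> Z" "S \<le> Z" "W * S \<le> Z"
  proof -
    \<comment> \<open>The initial key makes \<open>K 0\<close> nonempty, hence
      \<open>1 \<le> M\<close>; without it \<open>M + S + 1 \<le> S * (M + 1)\<close> fails.\<close>
    have "0 < card (K 0)" using K0 Kfin(1)[of 0] by (auto simp: card_gt_0_iff)
    then have "1 \<le> M" using Kfin(2)[of 0] by linarith
    then have "M + S + 1 \<le> S * (M + 1)" using S1(1) by (cases S) (auto simp: algebra_simps)
    then have "W * S \<le> S * S * S * (S * (M + 1)) * Suc M * S" unfolding W_def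
      by (intro mult_le_mono) auto
    also have "\<dots> = Z" by (simp add: Z_def eval_nat_numeral algebra_simps)
    finally show W: "W * S \<le> Z" .
    have "S * S * S * 1 * 1 * 1 \<le> W * S" unfolding W_def using S1 by (intro mult_le_mono) auto
    with W show "S * S * S \<le> Z" by linarith
    have "1 * 1 * 1 * 1 * Suc M * 1 \<le> W * S" unfolding W_def using S1 by (intro mult_le_mono) auto
    then have "Suc M \<le> W * S" by simp
    with W show "M \<le> Z" by linarith
    have "1 * 1 * 1 * 1 * 1 * S \<le> W * S" unfolding W_def using S1 by (intro mult_le_mono) auto
    then have "S \<le> W * S" by simp
    with W show "S \<le> Z" by linarith
  qed
  have "c6 \<le> 8000 * Z"
  proof -
    have "W * Suc N \<le> W * S" using S1(2) by (rule mult_le_mono2)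
    with c6(1) Z1(4) show ?thesis unfolding mult.assoc by linarith
  qed
  moreover have "c4 \<le> 200 * Z"
  proof -
    have "Suc d * Suc d * Suc (d - 1) \<le> S * S * S"
      using d by (intro mult_le_mono) (auto simp: S_def)
    with c4(1) Z1(1) show ?thesis unfolding mult.assoc by linarith
  qed
  moreover have "c7 \<le> 60 * Z" using c7(1) lT Z1(2,3) S1(1) unfolding mult_Suc_right by linarith
  moreover have "c1 + c1 + c2 + c3 + c5 + 2 * k + 60 \<le> 300 * S"
    using c1(1) c2(1) c3(1) c5(1) ceil_log_le[of N] by (simp add: S_def)
  ultimately have "c1 + c1 + c2 + c3 + c4 + c5 + c6 + c7 + 2 * k + 60 \<le> 10000 * Z"
    using Z1(3) by linarith
  with ex show ?thesis unfolding Z_def S_def T_def d_def by (meson le_trans)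
qed

end

section \<open>The number of residual instances\<close>

text \<open>Mirrors \<open>normalise\<close> on states, which forget exponents and coefficients.
  Keys are then counted as states times exponent vectors.\<close>

definition norm_state :: "(nat \<Rightarrow> nat list) \<Rightarrow> nat \<Rightarrow> nat \<times> nat list list \<Rightarrow> nat \<times> nat list list" where
  "norm_state a d = (\<lambda>(p, rows). if p = 0 then
    (let s = select a d rows [] rows in if s = [] then (1, dfs a [] rows)
     else (if tl s = [] then 1 else 0, s)) else (p, rows))"

definition succs :: "(nat \<Rightarrow> nat list) \<Rightarrow> nat list list \<Rightarrow> nat \<Rightarrow> nat \<times> nat list list \<Rightarrow>
  (nat \<times> nat list list) set"
  where
  "succs a ah d s = (case norm_state a d s of (p, rows) \<Rightarrow> (case rows of [] \<Rightarrow> {}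
    | v # rest \<Rightarrow> (\<lambda>i. (p, update (a (hd v)) (ah ! i) rest)) ` {i. i < length (tl v) \<and> tl v ! i \<noteq>
      0}))"

text \<open>Recursion on the first step fits the count of phase 0, whose bound depends on the
  starting rows; \<open>reach_Suc_right\<close> peels off the last step instead, in the direction in
  which the table evolves.\<close>

fun reach :: "(nat \<Rightarrow> nat list) \<Rightarrow> nat list list \<Rightarrow> nat \<Rightarrow> nat \<Rightarrow> nat \<times> nat list list \<Rightarrow>
  (nat \<times> nat list list) set"
  where
  "reach a ah d 0 s = {s}"
| "reach a ah d (Suc j) s = (\<Union>s'\<in>succs a ah d s. reach a ah d j s')"

lemma finite_succs: "finite (succs a ah d s)"
  by (auto simp: succs_def split: prod.splits list.splits)

lemma finite_reach: "finite (reach a ah d j s)"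
  by (induction j arbitrary: s) (auto simp: finite_succs)

lemma reach_Suc_right: "reach a ah d (Suc j) s = (\<Union>s'\<in>reach a ah d j s. succs a ah d s')"
proof (induction j arbitrary: s)
  case (Suc j)
  have "reach a ah d (Suc (Suc j)) s = (\<Union>s'\<in>succs a ah d s. \<Union>s''\<in>reach a ah d j s'. succs a ah d
    s'')"
    unfolding reach.simps(2)[of a ah d "Suc j" s] Suc.IH ..
  then show ?case by auto
qed simp

definition total_size :: "nat list list \<Rightarrow> nat" where
  "total_size rows = (\<Sum>u\<leftarrow>rows. sum_list (tl u))"

lemma dfs_induct_fixed [case_names Nil Root Visit]:
  assumes "P [] []" "\<And>r unv. P [r] unv \<Longrightarrow> P [] (r # unv)"
    and "\<And>v st unv. P (nbr (a (hd v)) unv @ st) (non_nbr (a (hd v)) unv) \<Longrightarrow> P (v # st) unv"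
  shows "P st unv"
  using dfs.induct[of "\<lambda>a' st unv. a' = a \<longrightarrow> P st unv" a st unv] assms by auto

lemma select_eq_Nil:
  assumes "select a d rows acc vs = []" "v \<in> set vs"
  shows "2 \<le> sum_list (tl v)" "length (nbr (a (hd v)) rows) < d"
  using assms by (induction vs arbitrary: acc) (auto split: if_splits)

lemma select_eq_Cons:
  assumes "select a d rows acc vs = v # rest"
  shows "sum_list (tl v) < 2 \<or> d \<le> length (nbr (a (hd v)) rows)"
  using assms by (induction vs arbitrary: acc) (auto split: if_splits)

lemma nth_restrict_row:
  "length b = length l \<Longrightarrow> i < length l \<Longrightarrow> restrict_row l b ! i = (if b ! i = 0 then 0 else l ! i)"
  by (simp add: restrict_row_def)

lemma set_restrict_row: "set (restrict_row l b) \<subseteq> insert 0 (set l)"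
proof
  fix z assume "z \<in> set (restrict_row l b)"
  then obtain x y where "(x, y) \<in> set (zip l b)" "z = (if y = 0 then 0 else x)"
    by (auto simp: restrict_row_def)
  then show "z \<in> insert 0 (set l)" using set_zip_leftD[of x y l b] by auto
qed

lemma length_restrict_row: "length b = length l \<Longrightarrow> length (restrict_row l b) = length l"
  by (simp add: restrict_row_def)

lemma sum_list_restrict_row_le:
  assumes "length b = length l"
  shows "sum_list (restrict_row l b) \<le> sum_list l"
  using assms by (induction b l rule: list_induct2) (auto simp: restrict_row_def)

lemma sum_list_restrict_row_less:
  assumes "length b = length l" "i < length l" "l ! i \<noteq> 0" "b ! i = 0"
  shows "sum_list (restrict_row l b) < sum_list l"
proof -
  have "(\<Sum>j<length l. restrict_row l b ! j) < (\<Sum>j<length l. l ! j)"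
    using assms by (intro sum_strict_mono_ex1) (auto simp: nth_restrict_row)
  then show ?thesis using assms(1) by (simp add: sum_list_sum_nth length_restrict_row
    atLeast0LessThan)
qed

text \<open>The stack of the search splits into groups, the topmost first: a pair \<open>(p, g)\<close> consists of
  a visited vertex and of those neighbours of it that are still waiting. The vertices \<open>p\<close> form
  an induced path.\<close>

fun stack_ok :: "('b \<Rightarrow> 'b \<Rightarrow> bool) \<Rightarrow> nat \<Rightarrow> ('b \<times> 'b list) list \<Rightarrow> bool" where
  "stack_ok A d [] = True"
| "stack_ok A d ((p, g) # gs) = (stack_ok A d gs \<and> p \<notin> fst ` set gs \<and>
    (gs \<noteq> [] \<longrightarrow> A (fst (hd gs)) p) \<and> (\<forall>q\<in>fst ` set (tl gs). \<not> A q p) \<and> length g < d \<and>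
    (\<forall>x\<in>set g. A p x \<and> x \<noteq> p \<and> (\<forall>q\<in>fst ` set gs. \<not> A q x \<and> q \<noteq> x)))"

text \<open>Groups at the top may have been emptied by earlier pops. They are dropped with their
  visited vertices until a waiting vertex appears; what is left of the induced path is again an
  induced path.\<close>

lemma stack_ok_pop:
  "stack_ok A d gs \<Longrightarrow> concat (map snd gs) = v # st \<Longrightarrow>
    \<exists>p g gs'. stack_ok A d ((p, v # g) # gs') \<and> st = g @ concat (map snd gs') \<and>
      insert p (fst ` set gs') \<subseteq> fst ` set gs"
proof (induction gs)
  case (Cons x gs)
  obtain p g where x: "x = (p, g)" by (cases x)
  show ?case
  proof (cases g)
    case Nil
    with Cons.IH Cons.prems x obtain p' g' gs' where
      "stack_ok A d ((p', v # g') # gs')" "st = g' @ concat (map snd gs')"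
      "insert p' (fst ` set gs') \<subseteq> fst ` set gs" by auto
    then show ?thesis by (intro exI[of _ p'] exI[of _ g'] exI[of _ gs']) auto
  next
    case (Cons y g')
    with Cons.prems x show ?thesis
      by (intro exI[of _ p] exI[of _ g'] exI[of _ gs]) auto
  qed
qed simp

lemma stack_ok_length: "stack_ok A d gs \<Longrightarrow> length (concat (map snd gs)) \<le> length gs * (d - 1)"
  by (induction A d gs rule: stack_ok.induct) auto

text \<open>\<open>stack_ok\<close> speaks of \<open>A\<close> from an older to a newer path vertex
  only, and the newest comes first in the list. So the claim is proved for the later list entry as
  first argument and extended by symmetry.\<close>

lemma stack_ok_induced_path:
  assumes "stack_ok A d gs" "\<forall>x\<in>fst ` set gs. \<forall>y\<in>fst ` set gs. A x y \<longleftrightarrow> A y x"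
    "\<forall>x\<in>fst ` set gs. \<not> A x x"
  shows "distinct (map fst gs)"
    "i < length gs \<Longrightarrow> j < length gs \<Longrightarrow> A (fst (gs ! i)) (fst (gs ! j)) \<longleftrightarrow> j = Suc i \<or> i = Suc j"
proof -
  have "stack_ok A d gs \<Longrightarrow> distinct (map fst gs)"
    by (induction A d gs rule: stack_ok.induct) auto
  with assms(1) show "distinct (map fst gs)" by simp
  have *: "i < j \<Longrightarrow> j < length gs \<Longrightarrow> A (fst (gs ! j)) (fst (gs ! i)) \<longleftrightarrow> j = Suc i" for i j
    using assms(1)
  proof (induction A d gs arbitrary: i j rule: stack_ok.induct)
    case (2 A d p g gs)
    obtain j' where j: "j = Suc j'" using 2(2) by (cases j) auto
    show ?case
    proof (cases i)
      case 0
      show ?thesis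
      proof (cases j')
        case 0
        with \<open>i = 0\<close> j 2 show ?thesis by (cases gs) auto
      next
        case (Suc j'')
        then have "gs ! j' \<in> set (tl gs)" using 2(3) j by (cases gs) auto
        then show ?thesis using 2(4) \<open>i = 0\<close> j Suc by auto
      qed
    next
      case (Suc i')
      with 2 j show ?thesis by auto
    qed
  qed simp
  show "A (fst (gs ! i)) (fst (gs ! j)) \<longleftrightarrow> j = Suc i \<or> i = Suc j" if "i < length gs" "j < length gs"
    using *[of i j] *[of j i] assms(2,3) that by (cases i j rule: linorder_cases) auto
qed

text \<open>The counting argument in terms of indices and matrices read as zero or nonzero:
  \<open>a\<close> holds the adjacency rows of \<open>G\<close>, \<open>ah\<close> those of
  \<open>H\<close>, \<open>common\<close> is the condition on the neighbourhoods of
  \<open>H\<close>, and \<open>no_path\<close> excludes an induced path on \<open>t\<close>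
  vertices. The choice of \<open>d\<close> enters only in the final estimate.\<close>

locale branching =
  fixes a :: "nat \<Rightarrow> nat list" and ah :: "nat list list" and d N k t :: nat
  assumes sym: "i < N \<Longrightarrow> j < N \<Longrightarrow> a i ! j \<noteq> 0 \<longleftrightarrow> a j ! i \<noteq> 0"
    and irrefl: "i < N \<Longrightarrow> a i ! i = 0"
    and ah: "length ah = k" "b \<in> set ah \<Longrightarrow> length b = k"
    and common: "i < k \<Longrightarrow> i' < k \<Longrightarrow> i \<noteq> i' \<Longrightarrow> card {p. p < k \<and> ah ! i ! p \<noteq> 0 \<and> ah ! i' ! p \<noteq> 0} \<le> 1"
    and d: "1 \<le> d" and t: "1 \<le> t"
    and no_path: "distinct ps \<Longrightarrow> length ps = t \<Longrightarrow> set ps \<subseteq> {..<N} \<Longrightarrow>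
      (\<And>i j. i < t \<Longrightarrow> j < t \<Longrightarrow> a (ps ! i) ! (ps ! j) \<noteq> 0 \<longleftrightarrow> j = Suc i \<or> i = Suc j) \<Longrightarrow> False"
begin

definition rows_ok :: "nat list list \<Rightarrow> bool" where
  "rows_ok rows \<longleftrightarrow> distinct (map hd rows) \<and>
    (\<forall>u\<in>set rows. length u = Suc k \<and> hd u < N \<and> set (tl u) \<subseteq> {0, 1})"

abbreviation adj :: "nat list \<Rightarrow> nat list \<Rightarrow> bool" where
  "adj u v \<equiv> a (hd u) ! hd v \<noteq> 0"

lemma rows_ok_mset: "mset rows = mset rows' \<Longrightarrow> rows_ok rows \<longleftrightarrow> rows_ok rows'"
  using mset_eq_setD[of rows rows'] mset_eq_imp_distinct_iff[of "map hd rows" "map hd rows'"]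
  by (auto simp: rows_ok_def mset_map)

lemma map_hd_update [simp]: "map hd (update x b rows) = map hd rows"
  by (simp add: update_def)

lemma rows_ok_update:
  assumes "rows_ok rows" "length b = k"
  shows "rows_ok (update x b rows)"
  unfolding rows_ok_def
proof (intro conjI ballI)
  show "distinct (map hd (update x b rows))" using assms(1) by (simp add: rows_ok_def)
  fix u assume "u \<in> set (update x b rows)"
  then obtain w where w: "w \<in> set rows" "u = (if x ! hd w =
    0 then w else hd w # restrict_row (tl w) b)"
    by (auto simp: update_def)
  then have ok: "length w = Suc k" "hd w < N" "set (tl w) \<subseteq> {0, 1}" using assms(1)
    by (auto simp: rows_ok_def)
  with w(2) assms(2) show "length u = Suc k" by (simp add: length_restrict_row)
  from w(2) ok show "hd u < N" by simp
  from w(2) ok set_restrict_row[of "tl w" b] show "set (tl u) \<subseteq> {0, 1}" by auto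
qed

text \<open>With \<open>t\<close> groups or more, the visited vertices of the first \<open>t\<close>
  of them would induce a forbidden path.\<close>

lemma stack_length:
  assumes "stack_ok adj d gs" "\<forall>u\<in>fst ` set gs. hd u < N" "inj_on hd (fst ` set gs)"
  shows "length gs < t"
proof (rule ccontr)
  assume "\<not> length gs < t"
  define ps where "ps = map (hd \<circ> fst) (take t gs)"
  have ind: "distinct (map fst gs)"
    "i < length gs \<Longrightarrow> j < length gs \<Longrightarrow> adj (fst (gs ! i)) (fst (gs ! j)) \<longleftrightarrow> j = Suc i \<or> i = Suc j"
      for i j
    using stack_ok_induced_path[OF assms(1)] assms(2) sym irrefl by auto
  have "distinct (map hd (map fst gs))"
    using ind(1) assms(3) by (simp only: distinct_map[of hd] set_map)
  then have "distinct (take t (map (hd \<circ> fst) gs))" by (intro distinct_take) simp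
  then have 1: "distinct ps" unfolding ps_def take_map .
  have 2: "length ps = t" using \<open>\<not> length gs < t\<close> by (simp add: ps_def)
  have 3: "set ps \<subseteq> {..<N}" using assms(2) by (auto simp: ps_def dest: in_set_takeD)
  show False
    using no_path[OF 1 2 3] ind(2) \<open>\<not> length gs < t\<close> by (simp add: ps_def)
qed

text \<open>\<open>V\<close> holds the discovered rows and \<open>xs @ ys\<close> is any split of
  the remaining output, so \<open>V \<union> set xs\<close> is the set coloured at some moment of
  phase 1. Discovered vertices off the stack have no undiscovered neighbour, so the border lies
  within the stack, the vertex being visited and its new group. The alternative of a one-element
  stack is for the root of a component, which has no parent and hence no group. Fewer than
  \<open>t\<close> groups of fewer than \<open>d\<close> vertices, together with the new group, give
  \<open>t * d\<close>.\<close>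

lemma dfs_border:
  assumes "rows_ok rows" "\<forall>u\<in>set rows. 2 \<le> sum_list (tl u)"
    and "\<forall>v\<in>set rows. length (nbr (a (hd v)) rows) < d"
  shows "V \<union> set unv \<subseteq> set rows \<Longrightarrow> set st \<subseteq> V \<Longrightarrow> V \<inter> set unv = {} \<Longrightarrow> distinct unv \<Longrightarrow>
    (\<forall>p\<in>V - set st. \<forall>u\<in>set unv. \<not> adj p u) \<Longrightarrow>
    (\<exists>r. st = [r]) \<or> (\<exists>gs. st = concat (map snd gs) \<and> stack_ok adj d gs \<and> fst ` set gs \<subseteq> V \<and>
      (\<forall>p\<in>fst ` set gs. \<forall>u\<in>set unv. \<not> adj p u)) \<Longrightarrow>
    dfs a st unv = xs @ ys \<Longrightarrow> card {p \<in> V \<union> set xs. \<exists>u\<in>set ys. adj p u} \<le> t * d"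
proof (induction st unv arbitrary: V xs ys rule: dfs_induct_fixed[where a = a])
  case Nil
  then show ?case by simp
next
  case (Root r unv)
  show ?case
  proof (cases xs)
    case Nil
    then have "set ys = set (r # unv)"
      using Root(8) mset_dfs[of a "[]" "r # unv"] by (metis append_Nil mset_eq_setD)
    then have "{p \<in> V \<union> set xs. \<exists>u\<in>set ys. adj p u} = {}" using Root(6) Nil by auto
    then show ?thesis by (simp only: card.empty le0)
  next
    case (Cons x xs')
    then have x: "x = r" "dfs a [r] unv = xs' @ ys" using Root(8) by auto
    have "V \<union> set xs = insert r V \<union> set xs'" using Cons x by auto
    moreover have "card {p \<in> insert r V \<union> set xs'. \<exists>u\<in>set ys. adj p u} \<le> t * d"
      using Root(2-6) x(2) by (intro Root(1)) auto
    ultimately show ?thesis by simp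
  qed
next
  case (Visit v st unv)
  define new where "new = nbr (a (hd v)) unv"
  define non where "non = non_nbr (a (hd v)) unv"
  have big: "\<forall>u\<in>set unv. 2 \<le> sum_list (tl u)" using Visit(2) assms(2) by auto
  have new: "set new = {u \<in> set unv. adj v u}" and non: "set non = {u \<in> set unv. \<not> adj v u}"
    using big by (auto simp: new_def non_def nbr_def non_nbr_def)
  have vr: "v \<in> set rows" "v \<in> V" "v \<notin> set unv" using Visit(2-4) by auto
  have lt: "hd u < N" if "u \<in> set rows" for u using assms(1) that by (auto simp: rows_ok_def)
  have inj: "inj_on hd (set rows)" using assms(1) by (simp add: rows_ok_def distinct_map)
  \<comment> \<open>\<open>new\<close> lies within the neighbourhood of \<open>v\<close> among all
    of \<open>rows\<close>, which has fewer than \<open>d\<close> elements when phase 0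
    ends.\<close>
  have "length new = card (set new)"
    using Visit(5) by (intro distinct_card[symmetric]) (auto simp: new_def nbr_def)
  also have "\<dots> \<le> card (set (nbr (a (hd v)) rows))"
    using Visit(2) by (intro card_mono) (auto simp: new_def nbr_def)
  also have "\<dots> \<le> length (nbr (a (hd v)) rows)" by (rule card_length)
  finally have len: "length new < d" using assms(3) vr(1) by fastforce
  have "\<exists>gs. new @ st = concat (map snd gs) \<and> stack_ok adj d gs \<and> fst ` set gs \<subseteq> V \<and>
      (\<forall>p\<in>fst ` set gs. \<forall>u\<in>set non. \<not> adj p u) \<and> length (v # st) + length new \<le> t * d"
    using Visit(7)
  proof
    \<comment> \<open>The path starts afresh at \<open>v\<close>, with the new neighbours as its
      only group.\<close>
    assume "\<exists>r. v # st = [r]"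
    then have "st = []" by simp
    moreover have "1 * d \<le> t * d" using t by (intro mult_le_mono1)
    then have "Suc (length new) \<le> t * d" using len by linarith
    moreover have "x \<noteq> v" if "x \<in> set new" for x using that vr(3) new by auto
    ultimately show ?thesis
      using len vr new non by (intro exI[of _ "[(v, new)]"]) auto
  next
    assume "\<exists>gs. v # st = concat (map snd gs) \<and> stack_ok adj d gs \<and> fst ` set gs \<subseteq> V \<and>
      (\<forall>p\<in>fst ` set gs. \<forall>u\<in>set unv. \<not> adj p u)"
    then obtain gs where gs: "concat (map snd gs) = v # st" "stack_ok adj d gs" "fst ` set gs \<subseteq> V"
      "\<forall>p\<in>fst ` set gs. \<forall>u\<in>set unv. \<not> adj p u" by auto
    from stack_ok_pop[OF gs(2,1)] obtain p g gs' where pop: "stack_ok adj d ((p, v # g) # gs')"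
      "st = g @ concat (map snd gs')" "insert p (fst ` set gs') \<subseteq> fst ` set gs" by blast
    have sub: "insert p (fst ` set gs') \<subseteq> V" using pop(3) gs(3) by blast
    \<comment> \<open>Path vertices have been visited, so all their neighbours are discovered. Hence
      the new neighbours of \<open>v\<close> see no path vertex but \<open>v\<close>, which keeps
      later extensions of the path induced.\<close>
    have far: "\<forall>q\<in>insert p (fst ` set gs'). \<forall>u\<in>set unv. \<not> adj q u \<and> q \<noteq> u"
      using pop(3) gs(4) sub Visit(4) by blast
    have v: "adj p v" "v \<noteq> p" "\<forall>q\<in>fst ` set gs'. \<not> adj q v \<and> q \<noteq> v" "stack_ok adj d ((p, g) # gs')"
      using pop(1) by simp_all
    have "adj v x \<and> x \<noteq> v \<and> (\<forall>q\<in>insert p (fst ` set gs'). \<not> adj q x \<and> q \<noteq> x)" if "x \<in> set new" for x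
      using that far new vr(3) by blast
    then have "stack_ok adj d ((v, new) # (p, g) # gs')"
      using v len unfolding stack_ok.simps(2)[of _ _ v] by (simp del: stack_ok.simps) blast
    moreover have "length (v # st) + length new \<le> t * d"
    proof -
      \<comment> \<open>Groups are counted before \<open>v\<close> opens its own. The waiting
        vertices then number at most \<open>(t - 1) * (d - 1)\<close>, which leaves room for one
        more group.\<close>
      have "length ((p, v # g) # gs') < t"
      proof (rule stack_length[OF pop(1)])
        have "insert p (fst ` set gs') \<subseteq> set rows" using sub Visit(2) by blast
        then have "fst ` set ((p, v # g) # gs') \<subseteq> set rows" by simp
        then show "inj_on hd (fst ` set ((p, v # g) # gs'))"
          "\<forall>u\<in>fst ` set ((p, v # g) # gs'). hd u < N"
          using inj_on_subset[OF inj] lt by blast+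
      qed
      then have "length ((p, v # g) # gs') * (d - 1) \<le> (t - 1) * (d - 1)"
        by (intro mult_le_mono1) simp
      moreover have "length (v # st) \<le> length ((p, v # g) # gs') * (d - 1)"
        using stack_ok_length[OF pop(1)] pop(2) by simp
      moreover have "(t - 1) * (d - 1) + d \<le> t * d"
        using t d by (cases t; cases d) auto
      ultimately show ?thesis using len by linarith
    qed
    moreover have "new @ st = concat (map snd ((v, new) # (p, g) # gs'))" using pop(2) by simp
    moreover have "fst ` set ((v, new) # (p, g) # gs') \<subseteq> V" using sub vr(2) by simp
    moreover have "\<forall>q\<in>insert v (insert p (fst ` set gs')). \<forall>u\<in>set non. \<not> adj q u"
      using far unfolding non by blast
    then have "\<forall>q\<in>fst ` set ((v, new) # (p, g) # gs'). \<forall>u\<in>set non. \<not> adj q u" by simp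
    ultimately show ?thesis by blast
  qed
  then obtain gs where gs: "new @ st = concat (map snd gs)" "stack_ok adj d gs" "fst ` set gs \<subseteq> V"
      "\<forall>p\<in>fst ` set gs. \<forall>u\<in>set non. \<not> adj p u" "length (v # st) + length new \<le> t * d" by blast
  have eq: "new @ dfs a (new @ st) non = xs @ ys" using Visit(8) by (simp add: new_def non_def)
  have visit_v: "set non \<subseteq> set unv" "set new \<subseteq> set unv" using new non by auto
  show ?case
  proof (cases "length xs \<le> length new")
    \<comment> \<open>The split falls inside the group being appended, so \<open>v\<close>, the
      stack and the emitted part of \<open>new\<close> may all still have uncoloured
      neighbours.\<close>
    case True
    then have xs: "set xs \<subseteq> set new" and ys: "set ys \<subseteq> set unv"
    proof -
      obtain zs where zs: "new = xs @ zs" "ys = zs @ dfs a (new @ st) non"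
      proof -
        have "take (length xs) new = xs" "drop (length xs) new @ dfs a (new @ st) non = ys"
          using arg_cong[OF eq, of "take (length xs)"] arg_cong[OF eq, of "drop (length xs)"] True
            by simp_all
        then show ?thesis using that[of "drop (length xs) new"] by (metis append_take_drop_id)
      qed
      have "set (dfs a (new @ st) non) = set non" using mset_dfs mset_eq_setD by blast
      then show "set xs \<subseteq> set new" "set ys \<subseteq> set unv" using zs visit_v by auto
    qed
    have "{p \<in> V \<union> set xs. \<exists>u\<in>set ys. adj p u} \<subseteq> set (v # st @ new)"
      using xs ys Visit(6) by fastforce
    then have "card {p \<in> V \<union> set xs. \<exists>u\<in>set ys. adj p u} \<le> card (set (v # st @ new))"
      by (intro card_mono) auto
    also have "\<dots> \<le> length (v # st @ new)" by (rule card_length)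
    finally show ?thesis using gs(5) by simp
  next
    case False
    then obtain xs' where xs': "xs = new @ xs'" "dfs a (new @ st) non = xs' @ ys"
      using eq by (auto simp: append_eq_append_conv2)
    have "card {p \<in> (V \<union> set new) \<union> set xs'. \<exists>u\<in>set ys. adj p u} \<le> t * d"
    proof (rule Visit(1)[folded new_def non_def])
      show "V \<union> set new \<union> set non \<subseteq> set rows" using Visit(2) visit_v by auto
      show "set (new @ st) \<subseteq> V \<union> set new" using Visit(3) by auto
      show "(V \<union> set new) \<inter> set non = {}" using Visit(4) new non by auto
      show "distinct non" using Visit(5) by (simp add: non_def non_nbr_def)
      show "\<forall>p\<in>V \<union> set new - set (new @ st). \<forall>u\<in>set non. \<not> adj p u"
        using Visit(6) non by auto
      show "(\<exists>r. new @ st = [r]) \<or> (\<exists>gs. new @ st = concat (map snd gs) \<and> stack_ok adj d gs \<and>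
        fst ` set gs \<subseteq> V \<union> set new \<and> (\<forall>p\<in>fst ` set gs. \<forall>u\<in>set non. \<not> adj p u))"
        using gs(1-4) by blast
      show "dfs a (new @ st) non = xs' @ ys" by (rule xs')
    qed
    then show ?thesis using xs'(1) by (simp add: Un_assoc)
  qed
qed

text \<open>The rows \<open>rest\<close> after colouring the vertices in \<open>past\<close> with \<open>g\<close>; only the colours of
  vertices that still have a neighbour in \<open>rest\<close> matter.\<close>

definition residual :: "(nat \<Rightarrow> nat) \<Rightarrow> nat list list \<Rightarrow> nat list list \<Rightarrow> nat list list" where
  "residual g past rest =
    map (\<lambda>u. hd u # foldl (\<lambda>l p. restrict_row l (ah ! g (hd p))) (tl u)
      (filter (\<lambda>p. adj p u) past)) rest"

lemma residual_cong:
  assumes "\<And>p u. p \<in> set past \<Longrightarrow> u \<in> set rest \<Longrightarrow> adj p u \<Longrightarrow> g (hd p) = g' (hd p)"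
  shows "residual g past rest = residual g' past rest"
  unfolding residual_def
proof (intro map_cong refl arg_cong2[where f = Cons])
  fix u assume "u \<in> set rest"
  then show "foldl (\<lambda>l p. restrict_row l (ah ! g (hd p))) (tl u) (filter (\<lambda>p. adj p u) past) =
    foldl (\<lambda>l p. restrict_row l (ah ! g' (hd p))) (tl u) (filter (\<lambda>p. adj p u) past)"
    using assms by (intro foldl_cong) auto
qed

lemma succs_phase1:
  "succs a ah d (1, v # rest) = (\<lambda>i. (1, update (a (hd v)) (ah ! i) rest)) ` {i. i < length (tl v)
    \<and> tl v ! i \<noteq> 0}"
  by (simp add: succs_def norm_state_def)

lemma residual_step:
  assumes "hd v \<notin> hd ` set past"
  shows "update (a (hd v)) (ah ! i) (residual g past rest) =
    residual (g(hd v := i)) (past @ [v]) rest"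
proof -
  have "foldl (\<lambda>l p. restrict_row l (ah ! (g(hd v := i)) (hd p))) z (filter (\<lambda>p. adj p u) past)
    = foldl (\<lambda>l p. restrict_row l (ah ! g (hd p))) z (filter (\<lambda>p. adj p u) past)" for u z
  proof (intro foldl_cong refl)
    fix l p assume "p \<in> set (filter (\<lambda>p. adj p u) past)"
    then have "p \<in> set past" by simp
    then have "hd p \<noteq> hd v" using assms by (metis imageI)
    then show "restrict_row l (ah ! (g(hd v := i)) (hd p)) = restrict_row l (ah ! g (hd p))" by simp
  qed
  then show ?thesis by (simp add: residual_def update_def)
qed

lemma length_foldl_restrict_row:
  "length l = k \<Longrightarrow> (\<And>p. p \<in> set ps \<Longrightarrow> g (hd p) < k) \<Longrightarrow>
    length (foldl (\<lambda>l p. restrict_row l (ah ! g (hd p))) l ps) = k"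
  by (induction ps arbitrary: l) (auto simp: length_restrict_row ah)

text \<open>Phase 1 never reorders the rows: after \<open>j\<close> steps the coloured vertices are
  the first \<open>j\<close> of \<open>ord\<close>, whatever their colours, and states differ only
  in \<open>g\<close>.\<close>

lemma reach_phase1:
  assumes "rows_ok ord" "j \<le> length ord" "s \<in> reach a ah d j (1, ord)"
  shows "\<exists>g. (\<forall>p\<in>set (take j ord). g (hd p) < k) \<and> s = (1, residual g (take j ord) (drop j ord))"
  using assms(2,3)
proof (induction j arbitrary: s)
  case 0
  have "hd u # tl u = u" if "u \<in> set ord" for u
  proof -
    have "length u = Suc k" using that assms(1) by (simp add: rows_ok_def)
    then show ?thesis by (cases u) auto
  qed
  then have "map (\<lambda>u. hd u # tl u) ord = ord" by (intro map_idI)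
  with 0 show ?case by (simp add: residual_def)
next
  case (Suc j)
  then obtain s' where s': "s' \<in> reach a ah d j (1, ord)" "s \<in> succs a ah d s'"
    by (auto simp only: reach_Suc_right)
  from Suc.IH[OF _ s'(1)] Suc.prems(1) obtain g where
    g: "\<forall>p\<in>set (take j ord). g (hd p) < k" "s' = (1, residual g (take j ord) (drop j ord))" by auto
  define v where "v = ord ! j"
  define rest where "rest = drop (Suc j) ord"
  have drop: "drop j ord = v # rest" using Suc.prems(1)
    by (simp add: v_def rest_def Cons_nth_drop_Suc)
  have take: "take (Suc j) ord = take j ord @ [v]"
    using Suc.prems(1) by (simp add: v_def take_Suc_conv_app_nth)
  have ok: "distinct (map hd ord)" "length v = Suc k"
    using assms(1) Suc.prems(1) by (auto simp: rows_ok_def v_def)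
  have "distinct (map hd (take j ord @ v # rest))" using ok(1) drop by (metis append_take_drop_id)
  then have nv: "hd v \<notin> hd ` set (take j ord)" by auto
  obtain l where l: "residual g (take j ord) (drop j ord) =
    (hd v # l) # residual g (take j ord) rest" "length l = k"
  proof -
    have "length (foldl (\<lambda>l p. restrict_row l (ah ! g (hd p))) (tl v)
      (filter (\<lambda>p. adj p v) (take j ord))) = k"
      using ok(2) g(1) by (intro length_foldl_restrict_row) auto
    then show ?thesis using that by (simp add: residual_def drop)
  qed
  from s'(2) obtain i where i: "i < k" "s = (1, update (a (hd v)) (ah ! i)
    (residual g (take j ord) rest))"
    unfolding g(2) l(1) succs_phase1 using l(2) by auto
  then have "s = (1, residual (g(hd v := i)) (take (Suc j) ord) (drop (Suc j) ord))"
    by (simp only: residual_step[OF nv] take rest_def)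
  moreover have "\<forall>p\<in>set (take (Suc j) ord). (g(hd v := i)) (hd p) < k"
    using g(1) i(1) nv by (auto simp: take)
  ultimately show ?case by blast
qed

lemma reach_Nil: "reach a ah d (Suc j) (1, []) = {}"
  by (simp add: succs_def norm_state_def)

lemma reach_phase1_long:
  assumes "length ord < j"
  shows "reach a ah d j (1, ord) = {}"
  using assms
proof (induction ord arbitrary: j rule: length_induct)
  case (1 ord)
  then obtain j' where j: "j = Suc j'" by (cases j) auto
  show ?case
  proof (cases ord)
    case Nil
    then show ?thesis unfolding j by (simp only: reach_Nil)
  next
    case (Cons v rest)
    have "reach a ah d j' (1, update (a (hd v)) (ah ! i) rest) = {}" for i
      using 1 j Cons by (simp add: update_def)
    then show ?thesis unfolding j Cons by (auto simp: succs_phase1[simplified])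
  qed
qed

text \<open>A residual state depends on \<open>g\<close> only through its restriction to the border
  \<open>B\<close>, so there are at most \<open>k ^ card B\<close> states. Base \<open>k + 1\<close>
  instead of \<open>k\<close> makes powers monotone in the exponent also for
  \<open>k = 0\<close>.\<close>

lemma card_reach_phase1:
  assumes "rows_ok rows" "length rows \<le> N" "\<forall>u\<in>set rows. 2 \<le> sum_list (tl u)"
    and "\<forall>v\<in>set rows. length (nbr (a (hd v)) rows) < d"
  shows "card (reach a ah d j (1, dfs a [] rows)) \<le> (k + 1) ^ min N (t * d)"
proof (cases "j \<le> length (dfs a [] rows)")
  case False
  then have "reach a ah d j (1, dfs a [] rows) = {}" by (intro reach_phase1_long) simp
  then show ?thesis by (simp only: card.empty le0)
next
  case True
  define ord where "ord = dfs a [] rows"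
  have m: "mset ord = mset rows" by (simp add: ord_def mset_dfs)
  have ok: "rows_ok ord" using assms(1) rows_ok_mset[OF m] by simp
  define past where "past = take j ord"
  define rest where "rest = drop j ord"
  define B where "B = {p \<in> set past. \<exists>u\<in>set rest. adj p u}"
  have "card {p \<in> {} \<union> set past. \<exists>u\<in>set rest. adj p u} \<le> t * d"
    using assms(1) by (intro dfs_border[OF assms(1,3,4), of "{}" rows "[]"])
      (auto simp: past_def rest_def ord_def rows_ok_def distinct_map intro: exI[of _ "[]"])
  then have "card B \<le> t * d" by (simp add: B_def)
  moreover have "card B \<le> N"
  proof -
    have "card B \<le> card (set past)" by (auto simp: B_def intro!: card_mono)
    also have "\<dots> \<le> length past" by (rule card_length)
    also have "\<dots> \<le> length rows" using mset_eq_length[OF m] by (simp add: past_def)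
    finally show ?thesis using assms(2) by simp
  qed
  ultimately have cB: "card (hd ` B) \<le> min N (t * d)"
    using card_image_le[of B hd] by (simp add: B_def)
  have "reach a ah d j (1, ord) \<subseteq> (\<lambda>g. (1, residual g past rest)) ` (hd ` B \<rightarrow>\<^sub>E {..<k})"
  proof
    fix s assume "s \<in> reach a ah d j (1, ord)"
    with reach_phase1[OF ok _ this] True obtain g where
      g: "\<forall>p\<in>set past. g (hd p) < k" "s = (1, residual g past rest)"
      by (auto simp: ord_def past_def rest_def)
    have "residual g past rest = residual (restrict g (hd ` B)) past rest"
      by (rule residual_cong) (auto simp: B_def)
    moreover have "restrict g (hd ` B) \<in> hd ` B \<rightarrow>\<^sub>E {..<k}" using g(1) by (auto simp: B_def)
    ultimately show "s \<in> (\<lambda>g. (1, residual g past rest)) ` (hd ` B \<rightarrow>\<^sub>E {..<k})" using g(2) by auto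
  qed
  then have "card (reach a ah d j (1, ord)) \<le> card
    ((\<lambda>g. (1::nat, residual g past rest)) ` (hd ` B \<rightarrow>\<^sub>E {..<k}))"
    by (intro card_mono finite_imageI finite_PiE) (auto simp: B_def)
  also have "\<dots> \<le> card (hd ` B \<rightarrow>\<^sub>E {..<k})"
    by (intro card_image_le finite_PiE) (auto simp: B_def)
  also have "\<dots> = k ^ card (hd ` B)" by (subst card_PiE) (auto simp: B_def)
  also have "\<dots> \<le> (k + 1) ^ card (hd ` B)" by (intro power_mono) auto
  also have "\<dots> \<le> (k + 1) ^ min N (t * d)" using cB by (intro power_increasing) auto
  finally show ?thesis by (simp add: ord_def)
qed

section \<open>Counting the states of phase 0\<close>

lemma total_size_mset: "mset rows = mset rows' \<Longrightarrow> total_size rows = total_size rows'"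
  unfolding total_size_def by (simp flip: sum_mset_sum_list)

lemma total_size_Cons [simp]: "total_size (v # rest) = sum_list (tl v) + total_size rest"
  by (simp add: total_size_def)

lemma total_size_update:
  assumes "\<forall>u\<in>set rest. length (tl u) = length b"
  shows "total_size (update x b rest) + length (filter (\<lambda>u. x ! hd u \<noteq> 0 \<and>
    (\<exists>p<length b. tl u ! p \<noteq> 0 \<and> b ! p = 0)) rest) \<le> total_size rest"
proof -
  define hit where "hit u \<longleftrightarrow> (\<exists>p<length b. tl u ! p \<noteq> 0 \<and> b ! p = 0)" for u :: "nat list"
  have "total_size (update x b rest) + length (filter (\<lambda>u. x ! hd u \<noteq> 0 \<and> hit u) rest) \<le>
    total_size rest"
    using assms
  proof (induction rest)
    case Nil
    then show ?case by (simp add: update_def)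
  next
    case (Cons u rest)
    have upd: "update x b (u # rest) =
      (if x ! hd u = 0 then u else hd u # restrict_row (tl u) b) # update x b rest"
      by (simp add: update_def)
    have le: "sum_list (restrict_row (tl u) b) \<le> sum_list (tl u)"
      using Cons.prems by (intro sum_list_restrict_row_le) simp
    have "Suc (sum_list (restrict_row (tl u) b)) \<le> sum_list (tl u)" if "hit u"
      using that Cons.prems sum_list_restrict_row_less[of b "tl u"]
        by (auto simp: Suc_le_eq hit_def)
    moreover have "total_size (update x b rest) + length (filter (\<lambda>u. x ! hd u \<noteq> 0 \<and> hit u) rest)
      \<le> total_size rest"
      using Cons by simp
    ultimately show ?case
      using le by (cases "x ! hd u = 0"; cases "hit u") (simp_all add: upd)
  qed
  then show ?thesis by (simp only: hit_def)
qed

lemma card_colours_le_one: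
  fixes l :: "nat list"
  assumes "sum_list l < 2"
  shows "card {i. i < length l \<and> l ! i \<noteq> 0} \<le> 1"
proof -
  have "card {i. i < length l \<and> l ! i \<noteq> 0} = (\<Sum>i\<in>{i. i < length l \<and> l ! i \<noteq> 0}. 1)" by simp
  also have "\<dots> \<le> (\<Sum>i\<in>{i. i < length l \<and> l ! i \<noteq> 0}. l ! i)" by (intro sum_mono) auto
  also have "\<dots> \<le> (\<Sum>i<length l. l ! i)" by (intro sum_mono2) auto
  also have "\<dots> = sum_list l" by (simp add: sum_list_sum_nth atLeast0LessThan)
  finally show ?thesis using assms by simp
qed

text \<open>A list that neither colour shortens lies in the common neighbourhood of both, which has
  at most one vertex, whereas the list has at least two. This is where the condition on
  \<open>H\<close> is used.\<close>

lemma lost_colour: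
  fixes l :: "nat list"
  assumes "length l = k" "set l \<subseteq> {0, 1}" "2 \<le> sum_list l" "i < k" "i' < k" "i \<noteq> i'"
  shows "(\<exists>p<k. l ! p \<noteq> 0 \<and> ah ! i ! p = 0) \<or> (\<exists>p<k. l ! p \<noteq> 0 \<and> ah ! i' ! p = 0)"
proof (rule ccontr)
  assume "\<not> ?thesis"
  then have "\<forall>p<k. l ! p \<noteq> 0 \<longrightarrow> ah ! i ! p \<noteq> 0 \<and> ah ! i' ! p \<noteq> 0" by metis
  then have sub: "{p. p < k \<and> l ! p \<noteq> 0} \<subseteq> {p. p < k \<and> ah ! i ! p \<noteq> 0 \<and> ah ! i' ! p \<noteq> 0}"
    by (intro Collect_mono impI) simp
  have "sum_list l = (\<Sum>p<k. l ! p)" using assms(1) by (simp add: sum_list_sum_nth atLeast0LessThan)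
  also have "\<dots> = (\<Sum>p\<in>{p. p < k \<and> l ! p \<noteq> 0}. l ! p)" by (intro sum.mono_neutral_right) auto
  also have "\<dots> \<le> (\<Sum>p\<in>{p. p < k \<and> l ! p \<noteq> 0}. 1)"
  proof (intro sum_mono)
    fix p assume "p \<in> {p. p < k \<and> l ! p \<noteq> 0}"
    then have "l ! p \<in> set l" using assms(1) by simp
    then show "l ! p \<le> 1" using assms(2) by auto
  qed
  also have "\<dots> = card {p. p < k \<and> l ! p \<noteq> 0}" by simp
  also have "\<dots> \<le> card {p. p < k \<and> ah ! i ! p \<noteq> 0 \<and> ah ! i' ! p \<noteq> 0}"
    using sub by (intro card_mono) auto
  also have "\<dots> \<le> 1" using assms(4-6) by (rule common)
  finally show False using assms(3) by simp
qed

text \<open>Put \<open>X = 1 + k * j\<close> and let \<open>e\<close> be the exponent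
  \<open>2 * total_size rows div d\<close>. One colour may keep \<open>e\<close>, each of the at
  most \<open>k\<close> others lowers it, and \<open>X ^ e + k * X ^ (e - 1) = X ^ (e - 1) * (X + k)
  \<le> (X + k) ^ e\<close>, where \<open>X + k\<close> is the base for \<open>Suc j\<close>. The
  factor 2 in the exponent is there because such a colour is only sure to remove
  \<open>d / 2\<close> from the total size.\<close>

lemma card_reach:
  assumes "rows_ok rows" "length rows \<le> N"
  shows "card (reach a ah d j (0, rows)) \<le>
    (1 + k * j) ^ (2 * total_size rows div d) * (k + 1) ^ min N (t * d)"
  using assms
proof (induction j arbitrary: rows)
  case 0
  then show ?case by simp
next
  case (Suc j)
  define Q where "Q = (k + 1) ^ min N (t * d)"
  define X where "X = 1 + k * j"
  define Y where "Y = 1 + k * Suc j"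
  have XY: "1 \<le> X" "X \<le> Y" "X + k = Y" by (simp_all add: X_def Y_def)
  show ?case
  proof (cases "select a d rows [] rows")
    case Nil
    have "succs a ah d (0, rows) = succs a ah d (1, dfs a [] rows)"
      by (simp add: succs_def norm_state_def Nil)
    then have "reach a ah d (Suc j) (0, rows) = reach a ah d (Suc j) (1, dfs a [] rows)" by simp
    also have "card \<dots> \<le> Q"
      unfolding Q_def using Suc.prems select_eq_Nil[OF Nil] by (intro card_reach_phase1) auto
    also have "1 * Q \<le> Y ^ (2 * total_size rows div d) * Q" using XY by (intro mult_le_mono1) simp
    finally show ?thesis by (simp only: mult_1 Q_def Y_def)
  next
    case (Cons v rest)
    have m: "mset rows = mset (v # rest)" using mset_select[of a d rows "[]" rows] Cons by simp
    have ok: "rows_ok (v # rest)" using Suc.prems(1) rows_ok_mset[OF m] by simp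
    then have okr: "rows_ok rest" and v: "length v = Suc k" "hd v < N"
      by (simp_all add: rows_ok_def)
    have tot: "total_size rows = sum_list (tl v) + total_size rest" using total_size_mset[OF m]
      by simp
    define C where "C = {i. i < length (tl v) \<and> tl v ! i \<noteq> 0}"
    have C: "finite C" "C \<subseteq> {..<k}" using v by (auto simp: C_def)
    then have cC: "card C \<le> k" using card_mono[of "{..<k}" C] by simp
    \<comment> \<open>\<open>norm_state\<close> switches to phase 1 when the selected row is the
      only one.\<close>
    define p where "p = (if rest = [] then 1 else 0::nat)"
    define R where "R i = reach a ah d j (p, update (a (hd v)) (ah ! i) rest)" for i
    define E where "E i = 2 * total_size (update (a (hd v)) (ah ! i) rest) div d" for i
    define e where "e = 2 * total_size rows div d"
    have succs: "succs a ah d (0, rows) = (\<lambda>i. (p, update (a (hd v)) (ah ! i) rest)) ` C"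
      by (simp add: succs_def norm_state_def Cons C_def p_def)
    have R: "card (R i) \<le> X ^ E i * Q" if "i \<in> C" for i
    proof (cases "rest = []")
      \<comment> \<open>The induction hypothesis speaks of phase 0 only. From \<open>(1, [])\<close>
        there is one state at depth 0 and none deeper.\<close>
      case True
      then have "R i = reach a ah d j (1, [])" by (simp add: R_def p_def update_def)
      then have "card (R i) \<le> 1 * 1"
        by (cases j) (simp, simp only: reach_Nil card.empty le0)
      also have "\<dots> \<le> X ^ E i * Q" using XY by (intro mult_le_mono) (simp_all add: Q_def)
      finally show ?thesis .
    next
      case False
      have "length (ah ! i) = k" using that C ah by auto
      then have "rows_ok (update (a (hd v)) (ah ! i) rest)" by (rule rows_ok_update[OF okr])
      moreover have "length (update (a (hd v)) (ah ! i) rest) \<le> N"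
        using Suc.prems(2) mset_eq_length[OF m] by (simp add: update_def)
      ultimately show ?thesis unfolding R_def E_def X_def Q_def p_def if_not_P[OF False]
        by (rule Suc.IH)
    qed
    define loss where "loss i = length (filter (\<lambda>u. a (hd v) ! hd u \<noteq> 0 \<and>
      (\<exists>p<k. tl u ! p \<noteq> 0 \<and> ah ! i ! p = 0)) rest)" for i
    have lossle: "total_size (update (a (hd v)) (ah ! i) rest) + loss i \<le> total_size rest"
      if "i \<in> C" for i
    proof -
      have "length (ah ! i) = k" using that C ah by auto
      then show ?thesis using okr total_size_update[of rest "ah ! i" "a (hd v)"]
        by (auto simp: rows_ok_def loss_def)
    qed
    have Ee: "E i \<le> e" if "i \<in> C" for i
      unfolding E_def e_def using lossle[OF that] tot by (intro div_le_mono) simp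
    \<comment> \<open>Two colours of \<open>v\<close> cannot both leave the list of a neighbour unchanged, so all colours but
      one shorten at least half of the lists of the neighbours.\<close>
    have heavy: "\<exists>i0. \<forall>i\<in>C - {i0}. Suc (E i) \<le> e"
    proof (cases "sum_list (tl v) < 2")
      case True
      then have "card C \<le> 1" unfolding C_def by (rule card_colours_le_one)
      then have "C = {} \<or> (\<exists>i0. C = {i0})" using C(1)
        by (metis card_0_eq card_1_singletonE le_SucE le_zero_eq One_nat_def)
      then show ?thesis by auto
    next
      case False
      then have deg: "d \<le> length (nbr (a (hd v)) rows)" using select_eq_Cons[OF Cons] by simp
      have "mset (nbr (a (hd v)) rows) = mset (nbr (a (hd v)) (v # rest))"
        using m by (simp add: nbr_def mset_filter)
      then have "length (nbr (a (hd v)) rows) = length (nbr (a (hd v)) (v # rest))"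
        by (rule mset_eq_length)
      \<comment> \<open>The degree was measured with \<open>v\<close> among the rows; as
        \<open>v\<close> is not its own neighbour, removing it changes nothing.\<close>
      also have "\<dots> = length (nbr (a (hd v)) rest)" using irrefl[OF v(2)] by (simp add: nbr_def)
      finally have deg: "d \<le> length (nbr (a (hd v)) rest)" using deg by simp
      have pair: "d \<le> loss i + loss i'" if "i \<in> C" "i' \<in> C" "i \<noteq> i'" for i i'
      proof -
        let ?P = "\<lambda>i u. a (hd v) ! hd u \<noteq> 0 \<and> (\<exists>p<k. tl u ! p \<noteq> 0 \<and> ah ! i ! p = 0)"
        have "?P i u \<or> ?P i' u" if "u \<in> set (nbr (a (hd v)) rest)" for u
          using that lost_colour[of "tl u" i i'] okr \<open>i \<in> C\<close> \<open>i' \<in> C\<close> \<open>i \<noteq> i'\<close> C(2)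
          by (auto simp: nbr_def rows_ok_def)
        moreover have "distinct rest" using okr by (simp add: rows_ok_def distinct_map)
        ultimately have "length (nbr (a (hd v)) rest) \<le>
          card ({u \<in> set rest. ?P i u} \<union> {u \<in> set rest. ?P i' u})"
          unfolding distinct_card[OF distinct_filter[OF \<open>distinct rest\<close>], symmetric] nbr_def
          by (intro card_mono) auto
        also have "\<dots> \<le> card {u \<in> set rest. ?P i u} + card {u \<in> set rest. ?P i' u}"
          by (rule card_Un_le)
        also have "\<dots> = loss i + loss i'"
          using \<open>distinct rest\<close> by (simp add: loss_def distinct_length_filter Int_def conj_commute)
        finally show ?thesis using deg by simp
      qed
      have light: "Suc (E i) \<le> e" if "i \<in> C" "d \<le> 2 * loss i" for i
      proof -
        have "2 * total_size (update (a (hd v)) (ah ! i) rest) + d \<le> 2 * total_size rows"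
          using lossle[OF that(1)] that(2) tot by linarith
        then have "(2 * total_size (update (a (hd v)) (ah ! i) rest) + d) div d \<le> e"
          unfolding e_def by (rule div_le_mono)
        then show ?thesis using d by (simp add: E_def)
      qed
      show ?thesis
      proof (cases "\<exists>i0\<in>C. 2 * loss i0 < d")
        case True
        then obtain i0 where "i0 \<in> C" "2 * loss i0 < d" by blast
        then have "d \<le> 2 * loss i" if "i \<in> C - {i0}" for i using pair[of i0 i] that by auto
        then show ?thesis using light by (metis DiffD1)
      next
        case False
        then show ?thesis using light by (metis DiffD1 not_less)
      qed
    qed
    then obtain i0 where i0: "\<forall>i\<in>C - {i0}. Suc (E i) \<le> e" by blast
    have "card (reach a ah d (Suc j) (0, rows)) = card (\<Union>i\<in>C. R i)" by (simp add: succs R_def)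
    also have "\<dots> \<le> (\<Sum>i\<in>C. card (R i))" using C(1) by (rule card_UN_le)
    also have "\<dots> \<le> (\<Sum>i\<in>C. X ^ E i * Q)" by (intro sum_mono R)
    also have "\<dots> \<le> Y ^ e * Q"
    proof (cases "C - {i0} = {}")
      case True
      then have "C = {} \<or> C = {i0}" by auto
      moreover have "X ^ E i \<le> Y ^ e" if "i \<in> C" for i
        using Ee[OF that] XY by (meson le_trans power_increasing power_mono zero_le)
      ultimately show ?thesis by (auto intro: mult_le_mono1)
    next
      case False
      then obtain i1 where "i1 \<in> C - {i0}" by blast
      with i0 obtain e' where e: "e = Suc e'" by (metis Suc_le_D)
      \<comment> \<open>The exceptional \<open>i0\<close> need not lie in \<open>C\<close>, so its
        term is added to the sum; \<open>min e\<close> keeps that term at most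
        \<open>X ^ e * Q\<close> in this case too.\<close>
      have "(\<Sum>i\<in>C. X ^ E i * Q) \<le> (\<Sum>i\<in>insert i0 C. X ^ (if i = i0 then min e (E i0) else E i) * Q)"
      proof -
        have "(\<Sum>i\<in>C. X ^ E i * Q) = (\<Sum>i\<in>C. X ^ (if i = i0 then min e (E i0) else E i) * Q)"
          using Ee by (intro sum.cong) auto
        also have "\<dots> \<le> (\<Sum>i\<in>insert i0 C. X ^ (if i = i0 then min e (E i0) else E i) * Q)"
          using C(1) by (intro sum_mono2) auto
        finally show ?thesis .
      qed
      also have "\<dots> = X ^ min e (E i0) * Q + (\<Sum>i\<in>C - {i0}. X ^
        (if i = i0 then min e (E i0) else E i) * Q)"
        using C(1) by (simp add: sum.insert_remove)
      also have "\<dots> \<le> X ^ e * Q + (\<Sum>i\<in>C - {i0}. X ^ e' * Q)"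
        using i0 XY(1) e by (intro add_mono sum_mono mult_le_mono1 power_increasing) auto
      also have "\<dots> \<le> X ^ e * Q + k * (X ^ e' * Q)"
        using card_Diff1_le[of C i0] cC by simp
      also have "\<dots> = X ^ e' * (X + k) * Q" by (simp add: e algebra_simps)
      also have "\<dots> \<le> Y ^ e' * Y * Q" using XY by (intro mult_le_mono1 mult_le_mono power_mono) auto
      finally show ?thesis by (simp add: e mult.commute)
    qed
    finally show ?thesis by (simp only: Y_def e_def Q_def)
  qed
qed

end

section \<open>The partition function\<close>

definition sub_partition :: "'v set set \<Rightarrow> 'h set \<Rightarrow> 'h set set \<Rightarrow> ('v \<Rightarrow> 'h \<Rightarrow> 'r::comm_ring_1) \<Rightarrow>
    'v set \<Rightarrow> ('v \<Rightarrow> 'h set) \<Rightarrow> ('h, 'r) mpoly" where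
  "sub_partition EG VH EH w A L = partition_function A (induced_edges EG A) L VH EH w"

lemma mem_list_colourings_induced:
  "f \<in> list_colourings A (induced_edges EG A) L VH EH \<longleftrightarrow> f \<in> A \<rightarrow>\<^sub>E VH \<and> (\<forall>u\<in>A. f u \<in> L u) \<and>
    (\<forall>x\<in>A. \<forall>y\<in>A. {x, y} \<in> EG \<longrightarrow> {f x, f y} \<in> EH)"
  by (auto simp: list_colourings_def graph_homs_def induced_edges_def)

lemma sub_partition_cong:
  assumes "\<And>v. v \<in> A \<Longrightarrow> L v = L' v"
  shows "sub_partition EG VH EH w A L = sub_partition EG VH EH w A L'"
proof -
  have "list_colourings A (induced_edges EG A) L VH EH = list_colourings A (induced_edges EG A) L'
    VH EH"
    using assms by (intro set_eqI) (simp add: mem_list_colourings_induced)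
  then show ?thesis by (simp add: sub_partition_def partition_function_def)
qed

lemma sub_partition_empty: "sub_partition EG VH EH w {} L = 1"
proof -
  have "list_colourings {} (induced_edges EG {}) L VH EH = {\<lambda>_. undefined}"
    by (intro set_eqI) (simp add: mem_list_colourings_induced)
  then show ?thesis by (simp add: sub_partition_def partition_function_def)
qed

text \<open>Colourings are sorted by the colour \<open>h\<close> of \<open>v\<close>. What remains
  is a colouring of \<open>A\<close> whose lists at the neighbours of \<open>v\<close> are cut down
  to \<open>nbhd EH h\<close>; as \<open>G\<close> has no loops, \<open>v\<close> imposes no
  condition on itself.\<close>

lemma sub_partition_insert:
  assumes "finite A" "v \<notin> A" "finite VH" "\<And>x. {x} \<notin> EG"
  shows "sub_partition EG VH EH w (insert v A) L = (\<Sum>h\<in>VH \<inter> L v. mpoly_const (w v h) * mpoly_var h *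
    sub_partition EG VH EH w A (\<lambda>u. if {v, u} \<in> EG then L u \<inter> nbhd EH h else L u))"
proof -
  define C where "C h = list_colourings A (induced_edges EG A)
    (\<lambda>u. if {v, u} \<in> EG then L u \<inter> nbhd EH h else L u) VH EH" for h
  define T where "T u h = mpoly_const (w u h) * mpoly_var h" for u h
  have fin: "finite (C h)" for h
    by (rule finite_subset[of _ "A \<rightarrow>\<^sub>E VH"])
      (auto simp: C_def mem_list_colourings_induced assms intro!: finite_PiE)
  have "sub_partition EG VH EH w (insert v A) L =
    (\<Sum>g\<in>list_colourings (insert v A) (induced_edges EG (insert v A)) L VH EH. \<Prod>u\<in>insert v A. T u
      (g u))"
    by (simp add: sub_partition_def partition_function_def T_def)
  also have "\<dots> = (\<Sum>(h, f)\<in>(SIGMA h:VH \<inter> L v. C h). T v h * (\<Prod>u\<in>A. T u (f u)))"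
  \<comment> \<open>Colourings are extensional, so the part on \<open>A\<close> has to be
    \<open>undefined\<close> at \<open>v\<close>.\<close>
  proof (rule sum.reindex_bij_witness[where i = "\<lambda>(h, f). f(v := h)"
    and j = "\<lambda>g. (g v, g(v := undefined))"])
    fix g assume g: "g \<in> list_colourings (insert v A) (induced_edges EG (insert v A)) L VH EH"
    show "(case (g v, g(v := undefined)) of (h, f) \<Rightarrow> f(v := h)) = g" by simp
    have "g(v := undefined) \<in> A \<rightarrow>\<^sub>E VH"
      using g assms(2) by (auto simp: mem_list_colourings_induced PiE_def Pi_def extensional_def)
    moreover have "{g v, g u} \<in> EH" if "u \<in> A" "{v, u} \<in> EG" for u
      using g that by (simp add: mem_list_colourings_induced)
    ultimately show "(g v, g(v := undefined)) \<in> (SIGMA h:VH \<inter> L v. C h)"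
      using g assms(2) unfolding C_def by (auto simp: mem_list_colourings_induced nbhd_def)
    have "(\<Prod>u\<in>A. T u ((g(v := undefined)) u)) = (\<Prod>u\<in>A. T u (g u))"
      using assms(2) by (intro prod.cong) auto
    then show "(case (g v, g(v := undefined)) of (h, f) \<Rightarrow> T v h * (\<Prod>u\<in>A. T u (f u))) =
      (\<Prod>u\<in>insert v A. T u (g u))" using assms(1,2) by simp
  next
    fix b assume "b \<in> (SIGMA h:VH \<inter> L v. C h)"
    then obtain h f where b: "b = (h, f)" "h \<in> VH" "h \<in> L v" "f \<in> C h" by auto
    then have f: "f \<in> A \<rightarrow>\<^sub>E VH" "\<forall>u\<in>A. f u \<in> (if {v, u} \<in> EG then L u \<inter> nbhd EH h else L u)"
      "\<forall>x\<in>A. \<forall>y\<in>A. {x, y} \<in> EG \<longrightarrow> {f x, f y} \<in> EH"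
      by (simp_all add: C_def mem_list_colourings_induced)
    have fv: "f v = undefined" using f(1) assms(2) by (auto simp: PiE_def extensional_def)
    show "(\<lambda>g. (g v, g(v := undefined))) (case b of (h, f) \<Rightarrow> f(v := h)) = b"
      using fv b(1) by (auto simp: fun_upd_idem)
    have 1: "f(v := h) \<in> insert v A \<rightarrow>\<^sub>E VH" using f(1) b(2)
      by (auto simp: PiE_def extensional_def Pi_def)
    have 2: "(f(v := h)) u \<in> L u" if "u \<in> insert v A" for u
      using that f(2) b(3) by (auto split: if_splits)
    have 3: "{(f(v := h)) x, (f(v := h)) y} \<in> EH" if "x \<in> insert v A" "y \<in> insert v A"
      "{x, y} \<in> EG" for x y
    proof -
      have *: "{h, f u} \<in> EH" if "u \<in> A" "{v, u} \<in> EG" for u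
        using f(2) that by (auto simp: nbhd_def)
      have "x \<noteq> y" using that(3) assms(4)[of x] by auto
      then show ?thesis using that f(3) *[of x] *[of y] assms(2) by (auto simp: insert_commute)
    qed
    show "(case b of (h, f) \<Rightarrow> f(v := h)) \<in> list_colourings (insert v A)
      (induced_edges EG (insert v A)) L VH EH"
      unfolding mem_list_colourings_induced b(1) prod.case using 1 2 3 by blast
  qed
  also have "\<dots> = (\<Sum>h\<in>VH \<inter> L v. \<Sum>f\<in>C h. T v h * (\<Prod>u\<in>A. T u (f u)))"
    using fin assms(3) by (subst sum.Sigma) auto
  also have "\<dots> = (\<Sum>h\<in>VH \<inter> L v. T v h * (\<Sum>f\<in>C h. \<Prod>u\<in>A. T u (f u)))"
    by (simp add: sum_distrib_left)
  finally show ?thesis by (simp add: sub_partition_def partition_function_def T_def C_def)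
qed

section \<open>From graphs and homomorphisms to index lists\<close>

definition instance_data :: "'v list \<Rightarrow> 'h list \<Rightarrow> 'v set set \<Rightarrow> ('v \<Rightarrow> 'h set) \<Rightarrow> ('v \<Rightarrow> 'h \<Rightarrow> 'r) \<Rightarrow>
    'r vertex_data list" where
  "instance_data vs hs EG L w = map (\<lambda>v. (map (\<lambda>u. if {v, u} \<in> EG then 1 else 0) vs,
    map (\<lambda>h. if h \<in> L v then 1 else 0) hs, map (w v) hs)) vs"

lemma enc_instance_eq: "enc_instance vs hs EG L w = enc_vertices (instance_data vs hs EG L w)"
  by (auto simp: enc_instance_def instance_data_def enc_vertex_def enc_nats_def enc_rings_def
    enc_bool_def o_def
    intro!: arg_cong[of _ _ enc_list])

definition adjacency_matrix :: "'h list \<Rightarrow> 'h set set \<Rightarrow> nat list list" where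
  "adjacency_matrix hs EH = map (\<lambda>h. map (\<lambda>h'. if {h, h'} \<in> EH then 1 else 0) hs) hs"

lemma sum_list_branch:
  assumes "length l \<le> length ws" "length l \<le> length bs"
  shows "(\<Sum>e\<leftarrow>branch a e0 rest c l ws bs i0. F e) = (\<Sum>i<length l. if l ! i = 0 then 0
    else F (bump (i0 + i) e0 # update a (bs ! i) rest, c * ws ! i))"
  using assms
proof (induction l arbitrary: ws bs i0)
  case (Cons x l)
  obtain w ws' b bs' where wb: "ws = w # ws'" "bs = b # bs'" using Cons.prems
    by (cases ws; cases bs) auto
  with Cons.prems Cons.IH[of ws' bs' "Suc i0"] show ?case
    unfolding wb by (simp add: sum.lessThan_Suc_shift del: sum.lessThan_Suc cong: if_cong)
qed simp

lemma branch_memE: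
  assumes "(key', c') \<in> set (branch a e0 rest c l ws bs i0)" "length l \<le> length bs"
  obtains i where "i < length l" "l ! i \<noteq> 0" "key' = bump (i0 + i) e0 # update a (bs ! i) rest"
proof -
  have "\<exists>i<length l. l ! i \<noteq> 0 \<and> key' = bump (i0 + i) e0 # update a (bs ! i) rest"
    using assms
  proof (induction l arbitrary: ws bs i0)
    case (Cons x l)
    then obtain b bs' where bs: "bs = b # bs'" by (cases bs) auto
    show ?case
    proof (cases "(key', c') \<in> set (branch a e0 rest c l (tl ws) bs' (Suc i0))")
      case True
      with Cons.IH[of "tl ws" bs' "Suc i0"] Cons.prems(2) bs obtain i where
        "i < length l" "l ! i \<noteq> 0" "key' = bump (Suc i0 + i) e0 # update a (bs' ! i) rest" by auto
      then show ?thesis using bs by (intro exI[of _ "Suc i"]) simp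
    next
      case False
      with Cons.prems(1) bs have "x \<noteq> 0" "key' = bump i0 e0 # update a b rest"
        by (auto split: if_splits)
      then show ?thesis using bs by (intro exI[of _ 0]) simp
    qed
  qed simp
  with that show thesis by blast
qed

text \<open>The bridge between the keys of the program and the states that are counted: the
  exponents \<open>x\<close> are merely carried along.\<close>

lemma normalise_norm_state:
  "normalise a d ((p # x) # rows) = (fst (norm_state a d (p, rows)) # x) # snd
    (norm_state a d (p, rows))"
  by (auto simp: normalise_def norm_state_def Let_def)

lemma norm_state_mset: "mset (snd (norm_state a d (p, rows))) = mset rows"
  by (auto simp: norm_state_def Let_def mset_select mset_dfs)

locale colouring =
  fixes VG :: "'v set" and EG :: "'v set set" and vs :: "'v list" and L :: "'v \<Rightarrow> 'h set"
    and w :: "'v \<Rightarrow> 'h \<Rightarrow> 'r::comm_ring_1" and VH :: "'h set" and EH :: "'h set set"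
      and hs :: "'h list"
    and t :: nat
  assumes H: "loop_graph VH EH"
    and common_nbhd: "\<And>h h'. h \<in> VH \<Longrightarrow> h' \<in> VH \<Longrightarrow> h \<noteq> h' \<Longrightarrow> card (nbhd EH h \<inter> nbhd EH h') \<le> 1"
    and hs: "distinct hs" "set hs = VH"
    and t: "1 \<le> t"
    and G: "simple_graph VG EG" "path_free t VG EG"
    and vs: "distinct vs" "set vs = VG"
begin

abbreviation "N \<equiv> length vs"
abbreviation "k \<equiv> length hs"
abbreviation "inp \<equiv> instance_data vs hs EG L w"
abbreviation "ahm \<equiv> adjacency_matrix hs EH"
abbreviation "d \<equiv> degree_bound t N"
definition "arow i = fst (inp ! i)"

lemma arow: "i < N \<Longrightarrow> j < N \<Longrightarrow> arow i ! j = (if {vs ! i, vs ! j} \<in> EG then 1 else 0)"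
  by (simp add: arow_def instance_data_def)

lemma ahm: "i < k \<Longrightarrow> j < k \<Longrightarrow> ahm ! i ! j = (if {hs ! i, hs ! j} \<in> EH then 1 else 0)"
  by (simp add: adjacency_matrix_def)

lemma loopless: "{x} \<notin> EG"
  using G(1) by (force simp: simple_graph_def doubleton_eq_iff)

text \<open>The vertices \<open>f i\<close> named by such an index sequence induce a path in
  \<open>G\<close>; the isomorphism onto \<open>{..<t}\<close> is the inverse of
  \<open>f\<close>.\<close>

lemma no_induced_path:
  assumes "distinct ps" "length ps = t" "set ps \<subseteq> {..<N}"
    and "\<And>i j. i < t \<Longrightarrow> j < t \<Longrightarrow> arow (ps ! i) ! (ps ! j) \<noteq> 0 \<longleftrightarrow> j = Suc i \<or> i = Suc j"
  shows False
proof -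
  define f where "f i = vs ! (ps ! i)" for i
  have psN: "ps ! i < N" if "i < t" for i
  proof -
    have "ps ! i \<in> set ps" using that assms(2) by simp
    then show ?thesis using assms(3) by auto
  qed
  have edge: "{f i, f j} \<in> EG \<longleftrightarrow> j = Suc i \<or> i = Suc j" if "i < t" "j < t" for i j
    using assms(4)[OF that] arow[OF psN psN, OF that] by (auto simp: f_def split: if_splits)
  have inj: "inj_on f {..<t}"
    using assms(1,2) vs(1) psN by (auto simp: inj_on_def f_def nth_eq_iff_index_eq)
  define W where "W = f ` {..<t}"
  define \<phi> where "\<phi> = the_inv_into {..<t} f"
  have \<phi>: "\<phi> (f i) = i" if "i < t" for i using inj that by (simp add: \<phi>_def the_inv_into_f_f)
  have bij: "bij_betw \<phi> W {..<t}"
    unfolding \<phi>_def W_def by (intro bij_betw_the_inv_into inj_on_imp_bij_betw inj)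
  have "induced_edges EG W = (\<lambda>i. {f i, f (Suc i)}) ` {i. Suc i < t}"
  proof (intro equalityI subsetI)
    fix e assume "e \<in> induced_edges EG W"
    then obtain u v where e: "e = {u, v}" "e \<in> EG" "e \<subseteq> W"
      using G(1) by (auto simp: induced_edges_def simple_graph_def)
    then obtain i j where ij: "u = f i" "v = f j" "i < t" "j < t" by (auto simp: W_def)
    then consider "j = Suc i" | "i = Suc j" using edge e by auto
    then show "e \<in> (\<lambda>i. {f i, f (Suc i)}) ` {i. Suc i < t}"
      using ij e(1) by cases (auto simp: insert_commute)
  next
    fix e assume "e \<in> (\<lambda>i. {f i, f (Suc i)}) ` {i. Suc i < t}"
    then obtain i where "Suc i < t" "e = {f i, f (Suc i)}" by auto
    then show "e \<in> induced_edges EG W" using edge[of i "Suc i"]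
      by (auto simp: induced_edges_def W_def)
  qed
  then have "(\<lambda>e. \<phi> ` e) ` induced_edges EG W = (\<lambda>i. {i, Suc i}) ` {i. Suc i < t}"
    using \<phi> by (simp add: image_image cong: image_cong_simp)
  also have "\<dots> = path_edges t" by (auto simp: path_edges_def)
  finally have "graph_iso W (induced_edges EG W) {..<t} (path_edges t)"
    using bij unfolding graph_iso_def by blast
  moreover have "W \<subseteq> VG" using psN vs(2) by (auto simp: W_def f_def)
  ultimately show False using G(2) by (auto simp: path_free_def)
qed

sublocale branching arow ahm d N k t
proof
  show "arow i ! j \<noteq> 0 \<longleftrightarrow> arow j ! i \<noteq> 0" if "i < N" "j < N" for i j
    using that by (simp add: arow insert_commute)
  show "arow i ! i = 0" if "i < N" for i using that loopless by (simp add: arow)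
  show "length ahm = k" "b \<in> set ahm \<Longrightarrow> length b = k" for b by (auto simp: adjacency_matrix_def)
  show "1 \<le> d" using degree_bound_props(1)[OF t] .
  show "1 \<le> t" by (rule t)
  show "card {p. p < k \<and> ahm ! i ! p \<noteq> 0 \<and> ahm ! i' ! p \<noteq> 0} \<le> 1" if "i < k" "i' < k" "i \<noteq> i'"
    for i i'
  proof -
    have VH: "nbhd EH h \<subseteq> VH" for h
      using H by (force simp: loop_graph_def nbhd_def doubleton_eq_iff)
    have "card {p. p < k \<and> ahm ! i ! p \<noteq> 0 \<and> ahm ! i' ! p \<noteq> 0}
      \<le> card (nbhd EH (hs ! i) \<inter> nbhd EH (hs ! i'))"
    proof (rule card_inj_on_le[where f = "nth hs"])
      show "inj_on ((!) hs) {p. p < k \<and> ahm ! i ! p \<noteq> 0 \<and> ahm ! i' ! p \<noteq> 0}"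
        using hs(1) by (auto simp: inj_on_def nth_eq_iff_index_eq)
      show "(!) hs ` {p. p < k \<and> ahm ! i ! p \<noteq> 0 \<and> ahm ! i' ! p \<noteq> 0}
        \<subseteq> nbhd EH (hs ! i) \<inter> nbhd EH (hs ! i')"
        using that by (auto simp: ahm nbhd_def split: if_splits)
      show "finite (nbhd EH (hs ! i) \<inter> nbhd EH (hs ! i'))"
        using finite_subset[OF VH] H by (simp add: loop_graph_def)
    qed
    also have "\<dots> \<le> 1" using that hs by (intro common_nbhd) (auto simp: nth_eq_iff_index_eq)
    finally show ?thesis .
  qed
  show False if "distinct ps" "length ps = t" "set ps \<subseteq> {..<N}"
    "\<And>i j. i < t \<Longrightarrow> j < t \<Longrightarrow> arow (ps ! i) ! (ps ! j) \<noteq> 0 \<longleftrightarrow> j = Suc i \<or> i = Suc j" for ps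
    using no_induced_path[OF that] .
qed

definition rows0 :: "nat list list" where "rows0 = init_rows 0 inp"

lemma init_rows_eq: "init_rows i xs = map (\<lambda>j. (i + j) # fst (snd (xs ! j))) [0..<length xs]"
proof (induction xs arbitrary: i)
  case (Cons x xs)
  have "[0..<length (x # xs)] = 0 # map Suc [0..<length xs]"
    by (simp add: map_Suc_upt upt_conv_Cons del: upt_Suc)
  with Cons show ?case by (simp add: o_def del: upt_Suc)
qed simp

lemma length_inp: "length inp = N" "\<forall>x\<in>set inp. length (fst x) = N \<and> length (snd (snd x)) = k"
  by (auto simp: instance_data_def)

lemma rows0_eq: "rows0 = map (\<lambda>j. j # map (\<lambda>h. if h \<in> L (vs ! j) then 1 else 0) hs) [0..<N]"
  by (simp add: rows0_def init_rows_eq length_inp(1)) (simp add: instance_data_def)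

lemma rows0: "rows_ok rows0" "length rows0 = N"
  by (auto simp: rows_ok_def rows0_eq o_def)

text \<open>The last clause pins the phase of final states to 1, so that final keys can differ only
  in their exponents.\<close>

lemma reach_ok:
  "j \<le> N \<Longrightarrow> s \<in> reach arow ahm d j (0, rows0) \<Longrightarrow> rows_ok (snd s) \<and> length (snd s) = N - j \<and> fst s \<le>
    1 \<and>
    (0 < j \<and> snd s = [] \<longrightarrow> fst s = 1)"
proof (induction j arbitrary: s)
  case 0
  then show ?case using rows0 by simp
next
  case (Suc j)
  then obtain s' where s': "s' \<in> reach arow ahm d j (0, rows0)" "s \<in> succs arow ahm d s'"
    by (auto simp only: reach_Suc_right)
  then have ok: "rows_ok (snd s')" "length (snd s') = N - j" "fst s' \<le> 1" using Suc by auto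
  obtain p rows where n: "norm_state arow d s' = (p, rows)" by force
  have m: "mset rows = mset (snd s')" using norm_state_mset[of arow d "fst s'" "snd s'"] n by simp
  have "length rows = N - j" using mset_eq_length[OF m] ok(2) by simp
  then obtain v rest where r: "rows = v # rest" using Suc.prems(1) by (cases rows) auto
  have vr: "rows_ok (v # rest)" using ok(1) rows_ok_mset[OF m] r by simp
  from s'(2) obtain i where i: "i < length (tl v)" "s = (p, update (arow (hd v)) (ahm ! i) rest)"
    unfolding succs_def n r by auto
  then have "i < k" using vr by (simp add: rows_ok_def)
  then have "length (ahm ! i) = k" using ah by simp
  moreover have "rows_ok rest" using vr by (simp add: rows_ok_def)
  ultimately have "rows_ok (snd s)" using i(2) by (simp add: rows_ok_update)
  moreover have len: "length (snd s) = N - Suc j" using i(2) \<open>length rows = N - j\<close> r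
    by (simp add: update_def)
  moreover have "p \<le> 1 \<and> (rest = [] \<longrightarrow> p = 1)"
  proof -
    have "fst s' = 1" if "fst s' \<noteq> 0" using that ok(3) by linarith
    then show ?thesis using n r by (cases s') (auto simp: norm_state_def Let_def split: if_splits)
  qed
  ultimately show ?case using i(2) by (auto simp: update_def)
qed

text \<open>The family \<open>K\<close> of the cost analysis. No exponent exceeds the number
  \<open>j\<close> of coloured vertices. The set is empty beyond \<open>N\<close> because the
  cardinality bound is demanded for every \<open>j\<close>.\<close>

definition dp_keys :: "nat \<Rightarrow> nat list list set" where
  "dp_keys j = (if j \<le> N then (\<lambda>((p, rows), x). (p # x) # rows) `
    (reach arow ahm d j (0, rows0) \<times> {x. set x \<subseteq> {..j} \<and> length x = k}) else {})"

lemma finite_dp_keys: "finite (dp_keys j)"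
  by (auto simp: dp_keys_def finite_reach finite_lists_length_eq intro!: finite_imageI)

text \<open>Combines \<open>card_reach\<close>, with the initial total size at most
  \<open>k * N\<close>, and the at most \<open>(N + 1) ^ k\<close> exponent vectors.\<close>

lemma card_dp_keys: "card (dp_keys j) \<le> (1 + k * N) ^ (2 * (k * N) div d) * (k + 1) ^ min N
  (t * d) * (N + 1) ^ k"
proof (cases "j \<le> N")
  case False
  then show ?thesis by (simp add: dp_keys_def)
next
  case True
  have "card (dp_keys j) \<le> card (reach arow ahm d j (0, rows0) \<times> {x. set x \<subseteq> {..j} \<and> length x = k})"
    unfolding dp_keys_def using True by (simp, intro card_image_le)
      (auto simp: finite_reach finite_lists_length_eq)
  also have "\<dots> = card (reach arow ahm d j (0, rows0)) * (j + 1) ^ k"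
    by (simp add: card_cartesian_product card_lists_length_eq)
  also have "\<dots> \<le> (1 + k * N) ^ (2 * (k * N) div d) * (k + 1) ^ min N (t * d) * (N + 1) ^ k"
  proof (intro mult_le_mono power_mono)
    have "total_size rows0 \<le> (\<Sum>u\<leftarrow>rows0. k)"
      unfolding total_size_def
    proof (intro sum_list_mono)
      fix u assume "u \<in> set rows0"
      then have u: "length (tl u) = k" "set (tl u) \<subseteq> {0, 1}" using rows0(1)
        by (auto simp: rows_ok_def)
      have "sum_list (tl u) \<le> (\<Sum>x\<leftarrow>tl u. 1)"
        using sum_list_mono[of "tl u" "\<lambda>x. x" "\<lambda>_. 1"] u(2) by auto
      then show "sum_list (tl u) \<le> k" using u(1) by (simp add: sum_list_triv)
    qed
    also have "\<dots> = k * N" using rows0(2) by (simp add: sum_list_triv)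
    finally have tot: "2 * total_size rows0 div d \<le> 2 * (k * N) div d" by (intro div_le_mono) simp
    have "card (reach arow ahm d j (0, rows0)) \<le> (1 + k * j) ^ (2 * total_size rows0 div d) *
      (k + 1) ^ min N (t * d)"
      using rows0 by (intro card_reach) auto
    also have "\<dots> \<le> (1 + k * N) ^ (2 * (k * N) div d) * (k + 1) ^ min N (t * d)"
    proof (intro mult_le_mono1)
      have "(1 + k * j) ^ (2 * total_size rows0 div d) \<le> (1 + k * N) ^ (2 * total_size rows0 div d)"
        using True by (intro power_mono) auto
      also have "\<dots> \<le> (1 + k * N) ^ (2 * (k * N) div d)" using tot by (intro power_increasing) auto
      finally show "(1 + k * j) ^ (2 * total_size rows0 div d) \<le>
        (1 + k * N) ^ (2 * (k * N) div d)" .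
    qed
    finally show "card (reach arow ahm d j (0, rows0)) \<le>
      (1 + k * N) ^ (2 * (k * N) div d) * (k + 1) ^ min N (t * d)" .
  qed (use True in auto)
  finally show ?thesis .
qed

lemma dp_keysE:
  assumes "key \<in> dp_keys j"
  obtains p x rows where "key = (p # x) # rows" "(p, rows) \<in> reach arow ahm d j (0, rows0)"
    "set x \<subseteq> {..j}"
    "length x = k" "rows_ok rows" "length rows = N - j" "0 < j \<and> rows = [] \<longrightarrow> p = 1" "j \<le> N"
proof -
  from assms have j: "j \<le> N" by (auto simp: dp_keys_def split: if_splits)
  with assms obtain p rows x where "key = (p # x) # rows"
    "(p, rows) \<in> reach arow ahm d j (0, rows0)"
    "set x \<subseteq> {..j}" "length x = k" by (auto simp: dp_keys_def)
  with that reach_ok[OF j] j show thesis by fastforce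
qed

lemma dp_keys_key_ok: "key \<in> dp_keys j \<Longrightarrow> key_ok N k (N - j) key"
  by (elim dp_keysE) (auto simp: key_ok_def rows_ok_def)

lemma expand_eq:
  assumes "key \<in> dp_keys j" "j < N" and key: "key = (p # x) # rows"
  obtains p' v rest where "norm_state arow d (p, rows) = (p', v # rest)"
    "mset (v # rest) = mset rows"
    "rows_ok (v # rest)" "length x = k" "set x \<subseteq> {..j}" "(p, rows) \<in> reach arow ahm d j (0, rows0)"
    "\<And>c. expand inp ahm d (key, c) = branch (arow (hd v)) (p' # x) rest c (tl v)
      (map (w (vs ! hd v)) hs) ahm 1"
proof -
  from assms(1) have k: "(p, rows) \<in> reach arow ahm d j (0, rows0)" "set x \<subseteq> {..j}" "length x = k"
    "rows_ok rows"
    "length rows = N - j" by (elim dp_keysE; simp add: key)+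
  obtain p' rows' where n: "norm_state arow d (p, rows) = (p', rows')" by force
  have m: "mset rows' = mset rows" using norm_state_mset[of arow d p rows] n by simp
  then obtain v rest where r: "rows' = v # rest" using k(5) assms(2) mset_eq_length[OF m]
    by (cases rows') auto
  have ok: "rows_ok (v # rest)" using k(4) rows_ok_mset[OF m] r by simp
  then have "hd v < N" by (simp add: rows_ok_def)
  then have "snd (snd (inp ! hd v)) = map (w (vs ! hd v)) hs" by (simp add: instance_data_def)
  then have "expand inp ahm d (key, c) = branch (arow (hd v)) (p' # x) rest c (tl v)
    (map (w (vs ! hd v)) hs) ahm 1" for c
    using normalise_norm_state[of arow d p x rows] n r
    by (simp add: expand_def key Let_def arow_def[abs_def])
  with that n r m ok k show thesis by auto
qed

lemma dp_keys_closed: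
  assumes "key \<in> dp_keys j" "j < N" "(key', c') \<in> set (expand inp ahm d (key, c))"
  shows "key' \<in> dp_keys (Suc j)"
proof -
  obtain p x rows where key: "key = (p # x) # rows" using assms(1) by (elim dp_keysE)
  from expand_eq[OF assms(1,2) key] obtain p' v rest where
    e: "norm_state arow d (p, rows) = (p', v # rest)" "rows_ok (v # rest)" "length x = k"
      "set x \<subseteq> {..j}"
      "(p, rows) \<in> reach arow ahm d j (0, rows0)"
      "expand inp ahm d (key, c) = branch (arow (hd v)) (p' # x) rest c (tl v)
        (map (w (vs ! hd v)) hs) ahm 1"
    by metis
  have lv: "length (tl v) = k" using e(2) by (simp add: rows_ok_def)
  then have "length (tl v) \<le> length ahm" using ah(1) by simp
  from branch_memE[OF assms(3)[unfolded e(6)] this] obtain i where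
    i: "i < k" "tl v ! i \<noteq> 0" "key' = bump (1 + i) (p' # x) # update (arow (hd v)) (ahm ! i) rest"
    using lv by auto
  have "(p', update (arow (hd v)) (ahm ! i) rest) \<in> succs arow ahm d (p, rows)"
    using i lv by (auto simp: succs_def e(1))
  then have "(p', update (arow (hd v)) (ahm ! i) rest) \<in> reach arow ahm d (Suc j) (0, rows0)"
    using e(5) unfolding reach_Suc_right by blast
  moreover have "set (bump i x) \<subseteq> {..Suc j}"
  proof -
    have "x ! i \<in> set x" using e(3) i(1) by simp
    then have "insert (Suc (x ! i)) (set x) \<subseteq> {..Suc j}" using e(4) by auto
    then show ?thesis unfolding bump_def by (rule subset_trans[OF set_update_subset_insert])
  qed
  moreover have "key' = (p' # bump i x) # update (arow (hd v)) (ahm ! i) rest" using i(3)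
    by (simp add: bump_def)
  moreover have "length (bump i x) = k" using e(3) by (simp add: bump_def)
  ultimately show ?thesis using assms(2) unfolding dp_keys_def by force
qed

lemma init_key: "replicate (Suc k) 0 # init_rows 0 inp \<in> dp_keys 0"
  by (auto simp: dp_keys_def image_iff rows0_def intro!: exI[of _ "replicate k 0"])

section \<open>The meaning of rows and table entries\<close>

definition region :: "nat list list \<Rightarrow> 'v set" where
  "region rows = (\<lambda>u. vs ! hd u) ` set rows"

text \<open>Turns rows into a function of the vertex, the form that
  \<open>partition_function\<close> takes. Indices are distinct under \<open>rows_ok\<close>, so
  only one row contributes to a vertex.\<close>

definition lists_at :: "nat list list \<Rightarrow> 'v \<Rightarrow> 'h set" where
  "lists_at rows v = {hs ! i |i. i < k \<and> (\<exists>u\<in>set rows. vs ! hd u = v \<and> tl u ! i \<noteq> 0)}"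

definition value_of :: "nat list list \<Rightarrow> ('h, 'r) mpoly" where
  "value_of rows = sub_partition EG VH EH w (region rows) (lists_at rows)"

lemma value_of_mset: "mset rows = mset rows' \<Longrightarrow> value_of rows = value_of rows'"
  using mset_eq_setD[of rows rows'] by (simp add: value_of_def region_def lists_at_def[abs_def])

lemma value_of_Nil: "value_of [] = 1"
  by (simp add: value_of_def region_def sub_partition_empty)

lemma lists_at_eq:
  assumes "rows_ok rows" "u \<in> set rows"
  shows "lists_at rows (vs ! hd u) = {hs ! i |i. i < k \<and> tl u ! i \<noteq> 0}"
proof -
  have "u' = u" if "u' \<in> set rows" "vs ! hd u' = vs ! hd u" for u'
  proof -
    have "hd u' = hd u" using that assms vs(1) by (auto simp: rows_ok_def nth_eq_iff_index_eq)
    then show ?thesis using that assms by (auto simp: rows_ok_def distinct_map dest: inj_onD)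
  qed
  then show ?thesis using assms(2) by (auto simp: lists_at_def)
qed

text \<open>Rows have one position per element of \<open>hs\<close>, so they record
  \<open>L v \<inter> VH\<close>; this admits the same colourings, since homomorphisms map into
  \<open>VH\<close>.\<close>

lemma value_of_rows0: "value_of rows0 = partition_function VG EG L VH EH w"
proof -
  have "region rows0 = VG" using vs(2) by (force simp: region_def rows0_eq set_conv_nth)
  moreover have "induced_edges EG VG = EG" using G(1)
    by (auto simp: induced_edges_def simple_graph_def)
  moreover have "sub_partition EG VH EH w VG (lists_at rows0) =
    sub_partition EG VH EH w VG (\<lambda>v. L v \<inter> VH)"
  proof (rule sub_partition_cong)
    fix v assume "v \<in> VG"
    then obtain j where j: "j < N" "v = vs ! j" using vs(2) by (auto simp: set_conv_nth)
    define u where "u = j # map (\<lambda>h. if h \<in> L v then 1 else 0) hs"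
    have "u \<in> set rows0" using j by (auto simp: rows0_eq u_def)
    from lists_at_eq[OF rows0(1) this] have "lists_at rows0 v = {hs ! i |i. i < k \<and> tl u ! i \<noteq> 0}"
      using j by (simp add: u_def)
    also have "\<dots> = {hs ! i |i. i < k \<and> hs ! i \<in> L v}"
      by (intro Collect_cong ex_cong conj_cong refl) (simp add: u_def)
    also have "\<dots> = L v \<inter> VH" unfolding hs(2)[symmetric] by (auto simp: in_set_conv_nth)
    finally show "lists_at rows0 v = L v \<inter> VH" .
  qed
  moreover have "list_colourings VG EG (\<lambda>v. L v \<inter> VH) VH EH = list_colourings VG EG L VH EH"
    by (auto simp: list_colourings_def graph_homs_def)
  ultimately show ?thesis by (simp add: value_of_def sub_partition_def partition_function_def)
qed

text \<open>The recursion that \<open>branch\<close> implements: \<open>sub_partition_insert\<close>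
  carried over to rows, where cutting lists down to \<open>nbhd EH h\<close> becomes
  \<open>update\<close> with a row of the matrix of \<open>H\<close>.\<close>

lemma value_of_Cons:
  assumes "rows_ok (v # rest)"
  shows "value_of (v # rest) = (\<Sum>i<k. if tl v ! i = 0 then 0 else
    mpoly_const (w (vs ! hd v) (hs ! i)) * mpoly_var (hs ! i) *
      value_of (update (arow (hd v)) (ahm ! i) rest))"
proof -
  define y where "y = vs ! hd v"
  have okr: "rows_ok rest" and v: "length v = Suc k" "hd v < N" using assms
    by (simp_all add: rows_ok_def)
  have hdN: "hd u < N" if "u \<in> set rest" for u using that okr by (simp add: rows_ok_def)
  have y: "y \<notin> region rest"
  proof
    assume "y \<in> region rest"
    then obtain u where "u \<in> set rest" "vs ! hd u = vs ! hd v" by (auto simp: region_def y_def)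
    then have "hd u = hd v" using vs(1) hdN v(2) by (auto simp: nth_eq_iff_index_eq)
    with \<open>u \<in> set rest\<close> assms show False by (simp add: rows_ok_def) (metis imageI)
  qed
  define F where "F h = mpoly_const (w y h) * mpoly_var h *
    sub_partition EG VH EH w (region rest) (\<lambda>u. if {y, u} \<in> EG then lists_at (v # rest) u \<inter> nbhd
      EH h else lists_at (v # rest) u)" for h
  have ly: "VH \<inter> lists_at (v # rest) y = (!) hs ` {i. i < k \<and> tl v ! i \<noteq> 0}"
    using lists_at_eq[OF assms, of v] hs(2) by (auto simp: y_def)
  have "region (v # rest) = insert y (region rest)" by (simp add: region_def y_def)
  then have "value_of (v # rest) = (\<Sum>h\<in>VH \<inter> lists_at (v # rest) y. F h)"
    unfolding value_of_def F_def using y H loopless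
    by (simp add: sub_partition_insert loop_graph_def region_def)
  also have "\<dots> = (\<Sum>i\<in>{i. i < k \<and> tl v ! i \<noteq> 0}. F (hs ! i))"
    unfolding ly using hs(1) by (subst sum.reindex) (auto simp: inj_on_def nth_eq_iff_index_eq)
  also have "\<dots> = (\<Sum>i<k. if tl v ! i = 0 then 0 else F (hs ! i))"
    by (intro sum.mono_neutral_cong_left) auto
  also have "\<dots> = (\<Sum>i<k. if tl v ! i = 0 then 0 else
    mpoly_const (w y (hs ! i)) * mpoly_var (hs ! i) *
      value_of (update (arow (hd v)) (ahm ! i) rest))"
  proof (intro sum.cong refl if_cong)
    fix i assume "i \<in> {..<k}"
    then have i: "i < k" "length (ahm ! i) = k" using ah by auto
    define rows where "rows = update (arow (hd v)) (ahm ! i) rest"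
    have okrows: "rows_ok rows" unfolding rows_def by (rule rows_ok_update[OF okr i(2)])
    have "set (map hd rows) = set (map hd rest)" by (simp only: rows_def map_hd_update)
    then have reg: "region rows = region rest"
      unfolding region_def by (metis (no_types) image_image list.set_map)
    have "sub_partition EG VH EH w (region rest) (lists_at rows) =
      sub_partition EG VH EH w (region rest)
      (\<lambda>u. if {y, u} \<in> EG then lists_at (v # rest) u \<inter> nbhd EH (hs ! i) else lists_at (v # rest) u)"
    proof (rule sub_partition_cong)
      fix z assume "z \<in> region rest"
      then obtain u where u: "u \<in> set rest" "z = vs ! hd u" by (auto simp: region_def)
      define u' where "u' = (if arow (hd v) ! hd u =
        0 then u else hd u # restrict_row (tl u) (ahm ! i))"
      have u': "u' \<in> set rows" "hd u' = hd u" using u by (auto simp: rows_def update_def u'_def)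
      have lu: "length (tl u) = k" using u okr by (simp add: rows_ok_def)
      have "lists_at rows z = {hs ! j |j. j < k \<and> tl u' ! j \<noteq> 0}"
        using lists_at_eq[OF okrows u'(1)] u'(2) u(2) by simp
      moreover have "lists_at (v # rest) z = {hs ! j |j. j < k \<and> tl u ! j \<noteq> 0}"
        using lists_at_eq[OF assms, of u] u by simp
      moreover have "arow (hd v) ! hd u = (if {y, z} \<in> EG then 1 else 0)"
        using arow[OF v(2) hdN[OF u(1)]] by (simp add: y_def u(2))
      moreover have "restrict_row (tl u) (ahm ! i) ! j \<noteq> 0 \<longleftrightarrow> tl u ! j \<noteq> 0 \<and> {hs ! i, hs ! j} \<in> EH"
        if "j < k" for j
        using nth_restrict_row[of "ahm ! i" "tl u" j] i lu that ahm[OF i(1) that] by auto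
      ultimately show "lists_at rows z = (if {y, z} \<in> EG then lists_at (v # rest) z \<inter> nbhd EH
        (hs ! i) else lists_at (v # rest) z)"
        by (auto simp: u'_def nbhd_def)
    qed
    then show "F (hs ! i) = mpoly_const (w y (hs ! i)) * mpoly_var (hs ! i) *
      value_of (update (arow (hd v)) (ahm ! i) rest)"
      by (simp add: F_def value_of_def reg flip: rows_def)
  qed
  finally show ?thesis unfolding y_def .
qed

definition exponent :: "nat list \<Rightarrow> 'h \<Rightarrow>\<^sub>0 nat" where
  "exponent x = (\<Sum>i<k. Poly_Mapping.single (hs ! i) (x ! i))"

lemma lookup_exponent: "i < k \<Longrightarrow> Poly_Mapping.lookup (exponent x) (hs ! i) = x ! i"
proof -
  assume i: "i < k"
  have "Poly_Mapping.lookup (exponent x) (hs ! i) = (\<Sum>j<k. if j = i then x ! j else 0)"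
    using i hs(1) by (auto simp: exponent_def lookup_sum lookup_single when_def
      nth_eq_iff_index_eq intro!: sum.cong)
  then show ?thesis using i by simp
qed

lemma keys_exponent: "Poly_Mapping.keys (exponent x) \<subseteq> set hs"
proof (rule ccontr)
  assume "\<not> ?thesis"
  then obtain h where h: "h \<in> Poly_Mapping.keys (exponent x)" "h \<notin> set hs" by blast
  have "Poly_Mapping.lookup (exponent x) h = (\<Sum>i<k. Poly_Mapping.lookup
    (Poly_Mapping.single (hs ! i) (x ! i)) h)"
    by (simp add: exponent_def lookup_sum)
  also have "\<dots> = 0"
  proof (intro sum.neutral ballI)
    fix i assume "i \<in> {..<k}"
    then have "hs ! i \<noteq> h" using h(2) nth_mem[of i hs] by auto
    then show "Poly_Mapping.lookup (Poly_Mapping.single (hs ! i) (x ! i)) h = 0"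
      by (simp add: lookup_single)
  qed
  finally show False using h(1) by (simp add: in_keys_iff)
qed

lemma exponent_bump:
  assumes "i < k" "length x = k"
  shows "exponent (bump i x) = exponent x + Poly_Mapping.single (hs ! i) 1"
proof -
  have "exponent (bump i x) = (\<Sum>j<k. Poly_Mapping.single (hs ! j) (x ! j) +
    (if j = i then Poly_Mapping.single (hs ! i) 1 else 0))"
    unfolding exponent_def using assms
    by (intro sum.cong) (auto simp: bump_def nth_list_update single_add[symmetric])
  also have "\<dots> = exponent x + Poly_Mapping.single (hs ! i) 1"
    using assms(1) by (simp add: sum.distrib exponent_def)
  finally show ?thesis .
qed

text \<open>The invariant of the algorithm is that these values sum to the partition function. A
  value is additive in the coefficient, which is why entries with equal keys may be merged.\<close>

definition entry_value :: "'r entry \<Rightarrow> ('h, 'r) mpoly" where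
  "entry_value e = Poly_Mapping.single (exponent (tl (hd (fst e)))) (snd e) * value_of (tl (fst e))"

lemma sum_list_insert_entry:
  "(\<Sum>e\<leftarrow>insert_entry f tab. entry_value e) = entry_value f + (\<Sum>e\<leftarrow>tab. entry_value e)"
  by (induction tab) (auto simp: entry_value_def single_add distrib_right add_ac)

lemma sum_list_insert_all:
  "(\<Sum>e\<leftarrow>insert_all es tab. entry_value e) = (\<Sum>e\<leftarrow>es. entry_value e) + (\<Sum>e\<leftarrow>tab. entry_value e)"
  by (induction es) (auto simp: insert_all_def sum_list_insert_entry add_ac)

lemma entry_value_expand:
  assumes "key \<in> dp_keys j" "j < N"
  shows "(\<Sum>e\<leftarrow>expand inp ahm d (key, c). entry_value e) = entry_value (key, c)"
proof -
  obtain p x rows where key: "key = (p # x) # rows" using assms(1) by (elim dp_keysE)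
  from expand_eq[OF assms(1,2) key] obtain p' v rest where
    e: "mset (v # rest) = mset rows" "rows_ok (v # rest)" "length x = k"
      "expand inp ahm d (key, c) = branch (arow (hd v)) (p' # x) rest c (tl v)
        (map (w (vs ! hd v)) hs) ahm 1"
    by metis
  have lv: "length (tl v) = k" using e(2) by (simp add: rows_ok_def)
  define W where "W i = w (vs ! hd v) (hs ! i)" for i
  define Z where "Z i = value_of (update (arow (hd v)) (ahm ! i) rest)" for i
  have "(\<Sum>e\<leftarrow>expand inp ahm d (key, c). entry_value e) = (\<Sum>i<k. if tl v ! i = 0 then 0
    else entry_value (bump (1 + i) (p' # x) # update (arow (hd v)) (ahm ! i) rest, c * map
      (w (vs ! hd v)) hs ! i))"
    unfolding e(4) using lv ah(1) by (subst sum_list_branch) auto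
  also have "\<dots> = (\<Sum>i<k. if tl v ! i = 0 then 0
    else Poly_Mapping.single (exponent x) c * (mpoly_const (W i) * mpoly_var (hs ! i) * Z i))"
  proof (intro sum.cong refl if_cong)
    fix i assume "i \<in> {..<k}"
    then have i: "i < k" by simp
    have "entry_value (bump (1 + i) (p' # x) # update (arow (hd v)) (ahm ! i) rest, c * map
      (w (vs ! hd v)) hs ! i)
      = Poly_Mapping.single (exponent (bump i x)) (c * W i) * Z i"
      using i by (simp add: entry_value_def bump_def W_def Z_def)
    also have "Poly_Mapping.single (exponent (bump i x)) (c * W i) =
      Poly_Mapping.single (exponent x) c * (mpoly_const (W i) * mpoly_var (hs ! i))"
      by (simp add: exponent_bump[OF i e(3)] mpoly_const_def mpoly_var_def mult_single)
    finally show "entry_value (bump (1 + i) (p' # x) # update (arow (hd v)) (ahm ! i) rest, c *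
      map (w (vs ! hd v)) hs ! i)
      = Poly_Mapping.single (exponent x) c * (mpoly_const (W i) * mpoly_var (hs ! i) * Z i)"
      by (simp add: mult.assoc)
  qed
  also have "\<dots> = Poly_Mapping.single (exponent x) c * value_of (v # rest)"
    unfolding value_of_Cons[OF e(2)] sum_distrib_left by (intro sum.cong) (auto simp: W_def Z_def)
  also have "\<dots> = entry_value (key, c)"
    by (simp add: entry_value_def key value_of_mset[OF e(1)])
  finally show ?thesis .
qed

lemma sum_list_step:
  assumes "fst ` set tab \<subseteq> dp_keys j" "j < N"
  shows "(\<Sum>e\<leftarrow>step inp ahm d tab. entry_value e) = (\<Sum>e\<leftarrow>tab. entry_value e)"
  using assms(1)
proof (induction tab)
  case (Cons e tab)
  have "(\<Sum>e\<leftarrow>expand inp ahm d e. entry_value e) = entry_value e"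
    using entry_value_expand[of "fst e" j "snd e"] Cons.prems assms(2) by simp
  with Cons show ?case by (simp add: step_def sum_list_insert_all)
qed (simp add: step_def)

lemma iterate_invariant:
  "j \<le> N \<Longrightarrow> fst ` set ((step inp ahm d ^^ j) (init_table k inp)) \<subseteq> dp_keys j \<and>
    distinct (map fst ((step inp ahm d ^^ j) (init_table k inp))) \<and>
    (\<Sum>e\<leftarrow>(step inp ahm d ^^ j) (init_table k inp). entry_value e) = partition_function VG EG L VH
      EH w"
proof (induction j)
  case 0
  have "exponent (replicate k 0) = 0" by (simp add: exponent_def)
  then have "entry_value (replicate (Suc k) 0 # init_rows 0 inp, 1) = value_of rows0"
    by (simp add: entry_value_def rows0_def)
  then show ?case using init_key by (simp add: init_table_def value_of_rows0 del: replicate_Suc)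
next
  case (Suc j)
  let ?T = "(step inp ahm d ^^ j) (init_table k inp)"
  have IH: "fst ` set ?T \<subseteq> dp_keys j" "(\<Sum>e\<leftarrow>?T. entry_value e) = partition_function VG EG L VH EH w"
    using Suc by auto
  have "fst ` set (step inp ahm d ?T) \<subseteq> dp_keys (Suc j)"
  proof
    fix key' assume "key' \<in> fst ` set (step inp ahm d ?T)"
    then obtain e c' where e: "e \<in> set ?T" "(key', c') \<in> set (expand inp ahm d (fst e, snd e))"
      by (auto simp: keys_step)
    from e(1) IH(1) have "fst e \<in> dp_keys j" by auto
    then show "key' \<in> dp_keys (Suc j)" using dp_keys_closed[OF _ _ e(2)] Suc.prems by simp
  qed
  then show ?case using sum_list_step[OF IH(1)] IH(2) Suc.prems by (simp add: distinct_step)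
qed

text \<open>After \<open>N\<close> steps no rows are left, so each entry is worth a single term. All
  keys share the phase \<open>P\<close>, hence distinct keys give distinct monomials. For
  \<open>N = 0\<close> no step is made and the phase is still 0.\<close>

lemma represents_result:
  "represents_mpoly hs (enc_list (map (\<lambda>(m, c). VCons (enc_nats m) (VRing c))
      (final_terms ((step inp ahm d ^^ N) (init_table k inp)))))
    (partition_function VG EG L VH EH w)"
proof -
  define T where "T = (step inp ahm d ^^ N) (init_table k inp)"
  have T: "fst ` set T \<subseteq> dp_keys N" "distinct (map fst T)"
    "(\<Sum>e\<leftarrow>T. entry_value e) = partition_function VG EG L VH EH w"
    using iterate_invariant[of N] by (simp_all add: T_def)
  define P where "P = (if N = 0 then 0 else 1::nat)"
  have key: "\<exists>x. fst e = [P # x] \<and> length x = k" if "e \<in> set T" for e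
  proof -
    have "fst e \<in> dp_keys N" using that T(1) by auto
    then show ?thesis
    proof (elim dp_keysE)
      fix p x rows
      assume a: "fst e = (p # x) # rows" "(p, rows) \<in> reach arow ahm d N (0, rows0)" "length x = k"
        "length rows = N - N" "0 < N \<and> rows = [] \<longrightarrow> p = 1"
      then have "rows = []" by simp
      moreover have "p = P"
      proof (cases "N = 0")
        case True
        with a(2) show ?thesis by (simp add: P_def)
      next
        case False
        with a(5) \<open>rows = []\<close> show ?thesis by (simp add: P_def)
      qed
      ultimately show ?thesis using a by simp
    qed
  qed
  define ts where "ts = map (\<lambda>e. (exponent (tl (hd (fst e))), snd e)) T"
  have enc: "enc_mono hs (exponent x) = (enc_nats x :: 'r val)" if "length x = k" for x
  proof -
    have "enc_mono hs (exponent x) = (enc_nats (map (Poly_Mapping.lookup (exponent x)) hs) :: 'r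
      val)"
      by (simp add: enc_mono_def enc_nats_def o_def)
    also have "map (Poly_Mapping.lookup (exponent x)) hs = x"
      using that lookup_exponent by (intro nth_equalityI) auto
    finally show ?thesis .
  qed
  have "distinct (map fst ts)"
  proof -
    have inj: "inj_on (\<lambda>key. exponent (tl (hd key))) (fst ` set T)"
    proof (rule inj_onI)
      fix y z assume yz: "y \<in> fst ` set T" "z \<in> fst ` set T"
        "exponent (tl (hd y)) = exponent (tl (hd z))"
      then obtain x x' where "y = [P # x]" "z = [P # x']" "length x = k" "length x' = k" using key
        by blast
      moreover from this yz(3) have "x = x'"
        using lookup_exponent by (intro nth_equalityI) (auto, metis)
      ultimately show "y = z" by simp
    qed
    have "map fst ts = map (\<lambda>key. exponent (tl (hd key))) (map fst T)" by (simp add: ts_def)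
    then show ?thesis using inj T(2) by (simp only:
      distinct_map[of "\<lambda>key. exponent (tl (hd key))"] set_map)
  qed
  moreover have "\<forall>(m, c)\<in>set ts. Poly_Mapping.keys m \<subseteq> set hs" using keys_exponent
    by (auto simp: ts_def)
  moreover have "map (\<lambda>(m, c). VCons (enc_nats m) (VRing c)) (final_terms T) =
    map (\<lambda>(m, c). VCons (enc_mono hs m) (VRing c)) ts"
    unfolding ts_def final_terms_def map_map
  proof (intro map_cong refl)
    fix e assume "e \<in> set T"
    with key enc show "((\<lambda>(m, c). VCons (enc_nats m) (VRing c)) \<circ> (\<lambda>e. (tl (hd (fst e)), snd e)))
      e =
      ((\<lambda>(m, c). VCons (enc_mono hs m) (VRing c)) \<circ> (\<lambda>e. (exponent (tl (hd (fst e))), snd e)))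
        e" by fastforce
  qed
  moreover have "partition_function VG EG L VH EH w = (\<Sum>(m, c)\<leftarrow>ts. Poly_Mapping.single m c)"
  proof -
    have "(\<Sum>e\<leftarrow>T. entry_value e) = (\<Sum>e\<leftarrow>T. Poly_Mapping.single (exponent (tl (hd (fst e)))) (snd e))"
    proof (intro arg_cong[of _ _ sum_list] map_cong refl)
      fix e assume "e \<in> set T"
      then show "entry_value e = Poly_Mapping.single (exponent (tl (hd (fst e)))) (snd e)"
        using key[of e] by (auto simp: entry_value_def value_of_Nil)
    qed
    then show ?thesis using T(3) by (simp add: ts_def o_def)
  qed
  ultimately show ?thesis unfolding represents_mpoly_def T_def[symmetric] by metis
qed

end

section \<open>The running time\<close>

definition state_bound :: "nat \<Rightarrow> nat \<Rightarrow> nat \<Rightarrow> nat" where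
  "state_bound k t n = (1 + k * n) ^ (2 * (k * n) div degree_bound t n)
    * (k + 1) ^ min n (t * degree_bound t n) * (n + 1) ^ k"

text \<open>The summand 2 pays for the nodes \<open>Call 0\<close> and \<open>Var 0\<close> around
  the main function.\<close>

definition time_bound :: "nat \<Rightarrow> nat \<Rightarrow> nat \<Rightarrow> nat" where
  "time_bound k t n = 10000 * ((n + k + 2) ^ 5 * (state_bound k t n + 1) ^ 2) + 2"

lemma ln_2_bounds: "1 / 2 \<le> ln (2::real)" "ln (2::real) \<le> 1"
  using ln_le_minus_one[of "1 / 2 :: real"] ln_le_minus_one[of "2 :: real"]
    by (simp_all add: ln_div)

lemma half_le_ln:
  assumes "2 \<le> n"
  shows "1 / 2 \<le> ln (real n)"
proof -
  have "ln 2 \<le> ln (real n)" using assms by (intro ln_mono) auto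
  then show ?thesis using ln_2_bounds(1) by linarith
qed

text \<open>Minimality gives \<open>ceil_log n - 1 \<le> 2 * ln n\<close>, and the two further units
  are at most \<open>4 * ln n\<close> as \<open>ln n\<close> is at least \<open>1 / 2\<close>; hence
  the factor 6.\<close>

lemma ceil_log_bounds:
  assumes "2 \<le> n"
  shows "ln (real n) \<le> real (Suc (ceil_log n))" "real (Suc (ceil_log n)) \<le> 6 * ln (real n)"
proof -
  note ln2 = ln_2_bounds
  have n: "1 / 2 \<le> ln (real n)" by (rule half_le_ln[OF assms])
  have "n \<le> 2 ^ ceil_log n"
    unfolding ceil_log_def by (rule LeastI[where P = "\<lambda>j. n \<le> 2 ^ j" and k = n])
      (simp add: less_imp_le)
  then have "real n \<le> 2 ^ ceil_log n" by (metis of_nat_le_iff of_nat_numeral of_nat_power)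
  then have "ln (real n) \<le> ln (2 ^ ceil_log n)" using assms by (subst ln_le_cancel_iff) auto
  also have "\<dots> = real (ceil_log n) * ln 2" by (simp add: ln_realpow)
  also have "\<dots> \<le> real (ceil_log n) * 1" using ln2 by (intro mult_left_mono) auto
  finally show "ln (real n) \<le> real (Suc (ceil_log n))" by simp
  have c: "1 \<le> ceil_log n"
    using \<open>n \<le> 2 ^ ceil_log n\<close> assms by (cases "ceil_log n") auto
  have "\<not> n \<le> 2 ^ (ceil_log n - 1)"
    using c not_less_Least[of "ceil_log n - 1" "\<lambda>j. n \<le> 2 ^ j"] by (simp add: ceil_log_def)
  then have "2 ^ (ceil_log n - 1) < real n" by (metis not_le of_nat_less_iff of_nat_numeral
    of_nat_power)
  then have "ln (2 ^ (ceil_log n - 1)) < ln (real n)" using assms by (subst ln_less_cancel_iff) auto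
  then have "real (ceil_log n - 1) * ln 2 < ln (real n)" by (simp add: ln_realpow)
  moreover have "real (ceil_log n - 1) * (1 / 2) \<le> real (ceil_log n - 1) * ln 2"
    using ln2 by (intro mult_left_mono) auto
  ultimately have "real (ceil_log n - 1) \<le> 2 * ln (real n)" by simp
  then show "real (Suc (ceil_log n)) \<le> 6 * ln (real n)" using n c by simp
qed

lemma power_le_exp:
  assumes "0 < x" "real m * ln x \<le> y"
  shows "x ^ m \<le> exp y"
proof -
  have "x ^ m = exp (real m * ln x)" using assms(1) by (simp add: exp_of_nat_mult)
  then show ?thesis using assms(2) by simp
qed

text \<open>Each of the three factors is compared with an exponential in \<open>x\<close>: the first
  by the lower bound on \<open>d * d * t\<close>, the second by minimality of \<open>d\<close>, and
  the third, polynomial in \<open>n\<close>, by \<open>ln n \<le> x\<close>.\<close>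

lemma state_bound_le:
  fixes k t n :: nat
  assumes "1 \<le> t" "2 \<le> n"
  defines "x \<equiv> sqrt (real t * real n * ln (real n))"
  shows "real (state_bound k t n) \<le> exp ((2 * k * (1 + 2 * ln (k + 1)) + 5 * ln (k + 1) + k * 3) *
    x)"
    and "ln (real n) \<le> x" "1 / 2 \<le> x"
proof -
  define d where "d = degree_bound t n"
  define l where "l = ln (real n)"
  have l: "1 / 2 \<le> l" unfolding l_def by (rule half_le_ln[OF assms(2)])
  have x0: "0 \<le> x" using l by (simp add: x_def flip: l_def)
  have x2: "x ^ 2 = t * n * l" using l by (simp add: x_def flip: l_def)
  have "l \<le> real n" using ln_le_minus_one[of "real n"] assms(2) by (simp add: l_def)
  also have "1 * real n \<le> real t * real n" using assms(1) by (intro mult_right_mono) auto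
  finally have "l * l \<le> real t * real n * l" using l by (intro mult_right_mono) auto
  then have "l ^ 2 \<le> x ^ 2" unfolding x2 by (simp add: power2_eq_square)
  then show lx: "ln (real n) \<le> x" unfolding l_def[symmetric] using x0 by (rule power2_le_imp_le)
  then show "1 / 2 \<le> x" using l by (simp add: l_def)
  have d: "1 \<le> d" "real n * l \<le> real d * real d * real t"
  proof -
    show "1 \<le> d" using degree_bound_props(1)[OF assms(1)] by (simp add: d_def)
    have "real n * l \<le> real n * real (Suc (ceil_log n))"
      unfolding l_def using ceil_log_bounds(1)[OF assms(2)] by (intro mult_left_mono) auto
    also have "\<dots> \<le> real (d * d * t)"
      using degree_bound_props(2)[OF assms(1), of n] unfolding d_def
        by (metis of_nat_le_iff of_nat_mult)
    finally show "real n * l \<le> real d * real d * real t" by simp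
  qed
  \<comment> \<open>With \<open>l = ln n\<close> and \<open>x ^ 2 = t * n * l\<close>, multiplying
    \<open>n * l \<le> d * d * t\<close> by \<open>n * l\<close> gives the squared claim.\<close>
  have nd: "real n / real d * l \<le> x"
  proof (rule power2_le_imp_le)
    have "(real n * l) * (real n * l) \<le> (real n * l) * (real d * real d * real t)"
      using d(2) l by (intro mult_left_mono) auto
    also have "\<dots> = x ^ 2 * real d ^ 2" unfolding x2 by (simp add: power2_eq_square)
    finally have "(real n * l) ^ 2 \<le> x ^ 2 * real d ^ 2" by (simp add: power2_eq_square)
    then have "(real n * l) ^ 2 / real d ^ 2 \<le> x ^ 2" using d(1) by (subst divide_le_eq) auto
    then show "(real n / real d * l) ^ 2 \<le> x ^ 2" by (simp add: power_mult_distrib power_divide)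
  qed (rule x0)
  have lk: "0 \<le> ln (real k + 1)" by simp
  have n1: "ln (1 + real k * real n) \<le> l * (1 + 2 * ln (k + 1))"
  proof -
    have "1 + real k * real n \<le> (real k + 1) * real n" using assms(2) by (simp add: algebra_simps)
    then have "ln (1 + real k * real n) \<le> ln ((real k + 1) * real n)"
      by (intro ln_mono) (auto intro: add_pos_nonneg)
    also have "\<dots> = ln (real k + 1) + l" using assms(2) by (simp add: ln_mult l_def)
    also have "\<dots> \<le> 2 * l * ln (real k + 1) + l" using mult_right_mono[of 1 "2 * l"
      "ln (real k + 1)"] l lk by simp
    finally show ?thesis by (simp add: algebra_simps)
  qed
  have "real (2 * (k * n) div d) * ln (1 + real k * real n) \<le>
    (2 * real k * real n / real d) * (l * (1 + 2 * ln (k + 1)))"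
  proof (intro mult_mono n1)
    have "real (2 * (k * n) div d) \<le> real (2 * (k * n)) / real d" by (rule of_nat_div_le_of_nat)
    then show "real (2 * (k * n) div d) \<le> 2 * real k * real n / real d" by simp
  qed auto
  also have "\<dots> = (2 * k * (1 + 2 * ln (k + 1))) * (real n / real d * l)" by simp
  also have "\<dots> \<le> (2 * k * (1 + 2 * ln (k + 1))) * x" using nd lk
    by (intro mult_left_mono) (auto simp: add.commute)
  finally have f1: "(1 + real k * real n) ^ (2 * (k * n) div d) \<le>
    exp ((2 * k * (1 + 2 * ln (k + 1))) * x)"
    by (intro power_le_exp) (auto intro: add_pos_nonneg)
  \<comment> \<open>5 rounds up the root of 24: \<open>t * (d - 1) ^ 2\<close> is at most
    \<open>6 * n * l\<close>, and \<open>d \<le> 2 * (d - 1)\<close> contributes a factor 4. For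
    \<open>d = 1\<close> minimality says nothing; there the square of \<open>min n t\<close> is at
    most \<open>t * n\<close>.\<close>
  have td: "real (min n (t * d)) \<le> 5 * x"
  proof (rule power2_le_imp_le)
    show "0 \<le> 5 * x" using x0 by simp
    show "real (min n (t * d)) ^ 2 \<le> (5 * x) ^ 2"
    proof (cases "d = 1")
      case True
      have "min n (t * d) * min n (t * d) \<le> t * n" using True by (simp add: mult_le_mono)
      then have "real (min n (t * d)) ^ 2 \<le> real t * real n"
        by (metis of_nat_le_iff of_nat_mult power2_eq_square)
      also have "\<dots> * 1 \<le> real t * real n * (25 * l)" using l by (intro mult_left_mono) auto
      finally show ?thesis using x2 by (simp add: power_mult_distrib mult_ac)
    next
      case False
      then have d2: "2 \<le> d" using d(1) by simp
      have "(d - 1) * (d - 1) * t < n * Suc (ceil_log n)"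
        using degree_bound_props(3)[OF assms(1), of "d - 1" n] d2 by (simp add: d_def)
      then have "real (d - 1) * real (d - 1) * real t \<le> real n * real (Suc (ceil_log n))"
        by (metis less_imp_le of_nat_le_iff of_nat_mult)
      also have "\<dots> \<le> real n * (6 * l)"
        unfolding l_def using ceil_log_bounds(2)[OF assms(2)] by (intro mult_left_mono) auto
      finally have *: "real t * (real (d - 1) * real (d - 1) * real t) \<le>
        real t * (real n * (6 * l))"
        by (intro mult_left_mono) auto
      have "real (min n (t * d)) \<le> real t * real d"
        by (metis min.cobounded2 of_nat_le_iff of_nat_mult)
      also have "\<dots> \<le> real t * (2 * real (d - 1))" using d2 by (intro mult_left_mono) auto
      finally have "real (min n (t * d)) ^ 2 \<le> (real t * (2 * real (d - 1))) ^ 2"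
        by (intro power_mono) auto
      also have "\<dots> = 4 * (real t * (real (d - 1) * real (d - 1) * real t))"
        by (simp add: power2_eq_square)
      also have "\<dots> \<le> 24 * x ^ 2" using * unfolding x2 by (simp add: mult_ac)
      also have "\<dots> \<le> (5 * x) ^ 2" by (simp add: power_mult_distrib)
      finally show ?thesis .
    qed
  qed
  have f2: "(real k + 1) ^ min n (t * d) \<le> exp (5 * ln (k + 1) * x)"
  proof (intro power_le_exp)
    have "real (min n (t * d)) * ln (real k + 1) \<le> 5 * x * ln (real k + 1)"
      by (intro mult_right_mono td lk)
    then show "real (min n (t * d)) * ln (real k + 1) \<le> 5 * ln (k + 1) * x"
      by (simp add: mult_ac add.commute)
  qed simp
  have f3: "(real n + 1) ^ k \<le> exp (k * 3 * x)"
  proof (intro power_le_exp)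
    have "ln (real n + 1) \<le> ln (2 * real n)" using assms(2) by (intro ln_mono) auto
    also have "\<dots> = ln 2 + l" using assms(2) by (simp add: ln_mult l_def)
    also have "\<dots> \<le> 3 * l" using l ln_2_bounds by linarith
    also have "\<dots> \<le> 3 * x" using lx by (simp add: l_def)
    finally have "real k * ln (real n + 1) \<le> real k * (3 * x)" by (intro mult_left_mono) auto
    then show "real k * ln (real n + 1) \<le> k * 3 * x" by simp
  qed simp
  have "real (state_bound k t n) = (1 + real k * real n) ^ (2 * (k * n) div d) * (real k + 1) ^
    min n (t * d) * (real n + 1) ^ k"
    by (simp add: state_bound_def d_def add.commute)
  also have "\<dots> \<le> exp ((2 * k * (1 + 2 * ln (k + 1))) * x) * exp (5 * ln (k + 1) * x) * exp
    (k * 3 * x)"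
    by (intro mult_mono f1 f2 f3) auto
  also have "\<dots> = exp ((2 * k * (1 + 2 * ln (k + 1)) + 5 * ln (k + 1) + k * 3) * x)"
    by (simp add: distrib_right flip: exp_add)
  finally
    show "real (state_bound k t n) \<le> exp ((2 * k * (1 + 2 * ln (k + 1)) + 5 * ln (k + 1) + k * 3)
      * x)" .
qed

text \<open>\<open>C\<close> is both the leading factor and the factor in the exponent. For
  \<open>n < 2\<close> the root vanishes, so the leading factor alone must cover the value
  \<open>C0\<close>. For larger \<open>n\<close>, \<open>2 * B\<close> changes the base from e to 2
  by way of \<open>ln 2 \<ge> 1 / 2\<close>, and 40002 collects \<open>10000 * 2 ^ 2\<close> and the
  final 2.\<close>

lemma time_bound_le:
  "\<exists>C::real. \<forall>t n. 1 \<le> t \<longrightarrow> real (time_bound k t n) \<le>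
    C * 2 powr (C * sqrt (real t * real n * ln (real n)))"
proof -
  define A where "A = 2 * k * (1 + 2 * ln (real k + 1)) + 5 * ln (real k + 1) + k * 3"
  define A' where "A' = 1 + 2 * ln (real k + 3)"
  define B where "B = 5 * A' + 2 * A"
  define C0
    where "C0 = real (10000 * ((k + 3) ^ 5 * ((k + 1) ^ (2 * k) * (k + 1) * 2 ^ k + 1) ^ 2) + 2)"
  define C where "C = max (max 40002 (2 * B)) C0"
  have A0: "0 \<le> A" "0 \<le> A'" "0 \<le> B" by (simp_all add: A_def A'_def B_def)
  have C: "40002 \<le> C" "2 * B \<le> C" "C0 \<le> C" by (auto simp: C_def)
  have "real (time_bound k t n) \<le> C * 2 powr (C * sqrt (real t * real n * ln (real n)))" if t:
    "1 \<le> t" for t n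
  proof (cases "2 \<le> n")
    case False
    have "state_bound k t n \<le> (k + 1) ^ (2 * k) * (k + 1) * 2 ^ k"
      unfolding state_bound_def
    proof (intro mult_le_mono)
      have "2 * (k * n) div degree_bound t n \<le> 2 * (k * n)" by simp
      also have "\<dots> \<le> 2 * k" using False by (cases n) auto
      finally have "2 * (k * n) div degree_bound t n \<le> 2 * k" .
      moreover have "1 + k * n \<le> k + 1" using False by (cases n) auto
      ultimately show "(1 + k * n) ^ (2 * (k * n) div degree_bound t n) \<le> (k + 1) ^ (2 * k)"
        by (meson le_trans power_increasing power_mono le_add2 zero_le)
      have "(k + 1) ^ min n (t * degree_bound t n) \<le> (k + 1) ^ 1" using False
        by (intro power_increasing) auto
      then show "(k + 1) ^ min n (t * degree_bound t n) \<le> k + 1" by simp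
      show "(n + 1) ^ k \<le> 2 ^ k" using False by (intro power_mono) auto
    qed
    moreover have "n + k + 2 \<le> k + 3" using False by simp
    ultimately have "(n + k + 2) ^ 5 * (state_bound k t n + 1) ^ 2 \<le>
      (k + 3) ^ 5 * ((k + 1) ^ (2 * k) * (k + 1) * 2 ^ k + 1) ^ 2"
      by (intro mult_le_mono power_mono) simp_all
    then have "time_bound k t n \<le> 10000 * ((k + 3) ^ 5 * ((k + 1) ^ (2 * k) * (k + 1) * 2 ^ k + 1)
      ^ 2) + 2"
      unfolding time_bound_def by (intro add_le_mono1 mult_le_mono2)
    then have "real (time_bound k t n) \<le> C0" unfolding C0_def by (rule of_nat_mono)
    also have "\<dots> \<le> C * 1" using C by simp
    also have "\<dots> \<le> C * 2 powr (C * sqrt (real t * real n * ln (real n)))"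
      using C False by (intro mult_left_mono) (auto simp: not_le less_Suc_eq numeral_2_eq_2)
    finally show ?thesis .
  next
    case True
    define x where "x = sqrt (real t * real n * ln (real n))"
    have M: "real (state_bound k t n) \<le> exp (A * x)" and lx: "ln (real n) \<le> x" "1 / 2 \<le> x"
      using state_bound_le(1)[OF t True, of k] state_bound_le(2,3)[OF t True]
        by (simp_all add: A_def x_def add.commute)
    have S: "(real n + real k + 2) ^ 5 \<le> exp (5 * A' * x)"
    proof (intro power_le_exp)
      have "real n + real k + 2 \<le> real n * (real k + 3)"
        using mult_right_mono[of 1 "real n" "real k + 2"] True by (simp add: algebra_simps)
      then have "ln (real n + real k + 2) \<le> ln (real n * (real k + 3))" by (intro ln_mono) auto
      also have "\<dots> = ln (real n) + ln (real k + 3)" using True by (simp add: ln_mult)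
      also have "\<dots> \<le> x + (2 * x) * ln (real k + 3)"
      proof -
        have "1 * ln (real k + 3) \<le> (2 * x) * ln (real k + 3)"
          using lx(2) by (intro mult_right_mono) auto
        then show ?thesis using lx(1) by linarith
      qed
      finally show "real 5 * ln (real n + real k + 2) \<le> 5 * A' * x"
        by (simp add: A'_def algebra_simps)
    qed simp
    have "0 < state_bound k t n" by (simp add: state_bound_def)
    then have M1: "1 \<le> real (state_bound k t n)" by simp
    have "real (time_bound k t n) = 10000 * ((real n + real k + 2) ^ 5 *
      (real (state_bound k t n) + 1) ^ 2) + 2"
      by (simp add: time_bound_def add_ac)
    also have "\<dots> \<le> 10000 * (exp (5 * A' * x) * (2 * exp (A * x)) ^ 2) + 2"
      using M M1 by (intro add_mono mult_left_mono mult_mono S power_mono order_refl) auto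
    also have "\<dots> = 40000 * exp (B * x) + 2"
      by (simp add: B_def power_mult_distrib distrib_right exp_add mult.assoc flip: exp_double)
    also have "\<dots> \<le> 40002 * exp (B * x)"
      using A0 lx(2) by simp
    also have "\<dots> \<le> C * 2 powr (C * x)"
    proof (intro mult_mono)
      note ln2 = ln_2_bounds(1)
      have "B * x \<le> C * (1 / 2) * x" using C(2) lx(2) by (intro mult_right_mono) auto
      also have "\<dots> \<le> C * ln 2 * x" using C(1) lx(2) ln2
        by (intro mult_right_mono mult_left_mono) auto
      finally show "exp (B * x) \<le> 2 powr (C * x)" by (simp add: powr_def mult_ac)
    qed (use C in auto)
    finally show ?thesis by (simp add: x_def)
  qed
  then show ?thesis by blast
qed

context colouring
begin

lemma computes_partition_function:
  "\<exists>out c. computes_in (program t ahm) (enc_instance vs hs EG L w) out c \<and>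
    represents_mpoly hs out (partition_function VG EG L VH EH w) \<and> c \<le> time_bound k t N"
proof -
  interpret machine t ahm "TYPE('r)" .
  have "\<exists>c' \<le> 10000 * ((N + k + 2) ^ 5 * (state_bound k t N + 1) ^ 2).
    call 0 (enc_vertices inp) = Some (enc_list (map (\<lambda>(m, c). VCons (enc_nats m) (VRing c))
        (final_terms ((step inp ahm d ^^ N) (init_table k inp)))), c')"
  proof (rule fn_main)
    show "1 \<le> t" by (rule t)
    show "length ahm = k" "\<forall>b\<in>set ahm. length b = k" using ah by auto
    show "length inp = N" "\<forall>x\<in>set inp. length (fst x) = N \<and> length (snd (snd x)) = k"
      by (rule length_inp)+
    show "\<forall>j<N. \<forall>key\<in>dp_keys j. \<forall>c key' c'. (key', c') \<in> set (expand inp ahm d (key, c)) \<longrightarrow> key' \<in>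
      dp_keys (Suc j)"
      using dp_keys_closed by blast
    show "finite (dp_keys j)" for j by (rule finite_dp_keys)
    show "card (dp_keys j) \<le> state_bound k t N" for j unfolding state_bound_def
      by (rule card_dp_keys)
    show "key_ok N k (N - j) key" if "j \<le> N" "key \<in> dp_keys j" for j key
      using dp_keys_key_ok that(2) .
    show "replicate (Suc k) 0 # init_rows 0 inp \<in> dp_keys 0" by (rule init_key)
  qed
  then obtain c' where c': "c' \<le> 10000 * ((N + k + 2) ^ 5 * (state_bound k t N + 1) ^ 2)"
    "call 0 (enc_vertices inp) = Some (enc_list (map (\<lambda>(m, c). VCons (enc_nats m) (VRing c))
        (final_terms ((step inp ahm d ^^ N) (init_table k inp)))), c')" by blast
  have "run (program t ahm) [enc_instance vs hs EG L w] (Call 0 (Var 0)) =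
    Some (enc_list (map (\<lambda>(m, c). VCons (enc_nats m) (VRing c))
        (final_terms ((step inp ahm d ^^ N) (init_table k inp)))), 1 + c' + 1)"
    using c'(2) by (simp add: enc_instance_eq)
  then have "computes_in (program t ahm) (enc_instance vs hs EG L w)
    (enc_list (map (\<lambda>(m, c). VCons (enc_nats m) (VRing c))
        (final_terms ((step inp ahm d ^^ N) (init_table k inp))))) (1 + c' + 1)"
    unfolding computes_in_def run_eq_Some .
  moreover have "1 + c' + 1 \<le> time_bound k t N" using c'(1) by (simp add: time_bound_def)
  ultimately show ?thesis using represents_result by blast
qed

end

theorem theorem1:
  fixes VH :: "'h set" and EH :: "'h set set" and hs :: "'h list"
  assumes "loop_graph VH EH"
    and "\<And>h h'. h \<in> VH \<Longrightarrow> h' \<in> VH \<Longrightarrow> h \<noteq> h' \<Longrightarrow> card (nbhd EH h \<inter> nbhd EH h') \<le> 1"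
    and "distinct hs" and "set hs = VH"
  shows "\<exists>C::real. \<forall>t::nat. t \<ge> 4 \<longrightarrow> (\<exists>P::prog.
    \<forall>(VG :: 'v set) EG vs (L :: 'v \<Rightarrow> 'h set) (w :: 'v \<Rightarrow> 'h \<Rightarrow> 'r::comm_ring_1) n.
      simple_graph VG EG \<and> card VG = n \<and> path_free t VG EG \<and>
      (\<forall>v \<in> VG. L v \<subseteq> VH) \<and> distinct vs \<and> set vs = VG \<longrightarrow>
      (\<exists>out c. computes_in P (enc_instance vs hs EG L w) out c \<and>
        represents_mpoly hs out (partition_function VG EG L VH EH w) \<and>
        real c \<le> C * 2 powr (C * sqrt (real t * real n * ln (real n)))))"
proof -
  obtain C :: real where C: "real (time_bound (length hs) t n) \<le>
    C * 2 powr (C * sqrt (real t * real n * ln (real n)))"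
    if "1 \<le> t" for t n using time_bound_le by blast
  show ?thesis
  \<comment> \<open>\<open>C\<close> depends on \<open>length hs\<close> alone and is fixed before
    \<open>t\<close>. The program may depend on \<open>t\<close>, which it contains as a literal
    next to the matrix of \<open>H\<close>.\<close>
  proof (intro exI[of _ C] allI impI exI[of _ "program t (adjacency_matrix hs EH)" for t])
    fix t :: nat and VG :: "'v set" and EG vs and L :: "'v \<Rightarrow> 'h set" and w :: "'v \<Rightarrow> 'h \<Rightarrow> 'r" and n
    assume t: "4 \<le> t" and a: "simple_graph VG EG \<and> card VG = n \<and> path_free t VG EG \<and>
      (\<forall>v \<in> VG. L v \<subseteq> VH) \<and> distinct vs \<and> set vs = VG"
    interpret colouring VG EG vs L w VH EH hs t
      using assms t a by unfold_locales auto
    have n: "length vs = n" using a distinct_card[of vs] by auto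
    obtain out c where "computes_in (program t (adjacency_matrix hs EH))
      (enc_instance vs hs EG L w) out c"
      "represents_mpoly hs out (partition_function VG EG L VH EH w)"
        "c \<le> time_bound (length hs) t (length vs)"
      using computes_partition_function by blast
    moreover from this(3) have "real c \<le> C * 2 powr (C * sqrt (real t * real n * ln (real n)))"
      using C[of t n] t n by (meson le_trans of_nat_le_iff order_trans one_le_numeral)
    ultimately show "\<exists>out c. computes_in (program t (adjacency_matrix hs EH))
      (enc_instance vs hs EG L w) out c \<and>
        represents_mpoly hs out (partition_function VG EG L VH EH w) \<and>
        real c \<le> C * 2 powr (C * sqrt (real t * real n * ln (real n)))" by blast
  qed
qed

end
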